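(* Let $X,Y,A,B$ be rational functions with complex coefficients, of degree at least two, such that $B$ is a Galois covering. Then $X,Y,A,B$ form a good solution of the equation $A\circ X=B\circ Y$ if and only if there exist Möbius transformations $\eta$ and $\nu$ and rational functions $V$ and $C$ such that the diagram $$\begin{array}{ccccc}\mathbb{CP}^1&\xrightarrow{\,V\,}&\mathbb{CP}^1&\xrightarrow{\,\eta\,}&\mathbb{CP}^1\\ {\scriptstyle X}\downarrow&&{\scriptstyle X}\downarrow&&\downarrow{\scriptstyle B}\\ \mathbb{CP}^1&\xrightarrow{\,C\,}&\mathbb{CP}^1&\xrightarrow{\,\nu\,}&\mathbb{CP}^1\end{array}$$ commutes (that is, $X\circ V=C\circ X$ and $B\circ\eta=\nu\circ X$), the equalities $Y=\eta\circ V$ and $A=\nu\circ C$ hold, and the function $V$ is $G_X$-equivariant.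
   Context: Rational functions are viewed as holomorphic maps $\mathbb{CP}^1\to\mathbb{CP}^1$. For a rational function $F$, $G_F=\{\mu\in\mathrm{Aut}(\mathbb{CP}^1) : F\circ\mu=F\}$; $F$ is a Galois covering if $G_F$ acts transitively on the fibers of $F$, equivalently $|G_F|=\deg F$. A rational function $V$ is $G_X$-equivariant if there exists a group automorphism $\varphi:G_X\to G_X$ such that $V\circ\mu=\varphi(\mu)\circ V$ for all $\mu\in G_X$. Rational functions $X,Y,A,B$ form a good solution of $A\circ X=B\circ Y$ if this equality holds and: (i) the fiber product of $A$ and $B$ has a unique component, i.e. the algebraic curve $\{(x,y)\in\mathbb{CP}^1\times\mathbb{CP}^1 : A(x)=B(y)\}$ has exactly one irreducible component; and (ii) $X$ and $Y$ have no non-trivial common compositional right factor, i.e. $X=\widehat X\circ T$, $Y=\widehat Y\circ T$ with rational functions $\widehat X,\widehat Y,T$ implies $\deg T=1$ (equivalently, $\mathbb{C}(X,Y)=\mathbb{C}(z)$). *)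

theory Defs
  imports
    "HOL-Computational_Algebra.Field_as_Ring"
    "HOL-Computational_Algebra.Polynomial_Factorial"
    "HOL-Algebra.Group"
begin

datatype cp1 = Fin complex | Infty

text \<open>The point $[a : b]$; meaningful only for $(a, b) \neq (0, 0)$.\<close>

definition proj_point :: "complex \<Rightarrow> complex \<Rightarrow> cp1" where
  "proj_point a b = (if b = 0 then Infty else Fin (a / b))"

text \<open>For coprime \<open>p\<close>, \<open>q\<close> this is the map $z \mapsto p(z)/q(z)$ of the sphere.  With
  $n = \max(\deg p, \deg q)$, its homogeneous form is
  $[x : y] \mapsto [y^n p(x/y) : y^n q(x/y)]$, so at $\infty = [1 : 0]$ the value is given by
  the coefficients of degree $n$.\<close>

fun quot_map :: "complex poly \<Rightarrow> complex poly \<Rightarrow> cp1 \<Rightarrow> cp1" where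
  "quot_map p q (Fin z) = proj_point (poly p z) (poly q z)"
| "quot_map p q Infty =
     (let n = max (degree p) (degree q) in proj_point (coeff p n) (coeff q n))"

definition rational_fun :: "(cp1 \<Rightarrow> cp1) \<Rightarrow> bool" where
  "rational_fun F \<longleftrightarrow> (\<exists>p q. coprime p q \<and> q \<noteq> 0 \<and> F = quot_map p q)"

definition rat_degree :: "(cp1 \<Rightarrow> cp1) \<Rightarrow> nat" where
  "rat_degree F = (THE d. \<exists>p q. coprime p q \<and> q \<noteq> 0 \<and> F = quot_map p q \<and>
      d = max (degree p) (degree q))"

lemma quot_map_eq_imp:
  assumes "q \<noteq> 0" "q' \<noteq> 0" "quot_map p q = quot_map p' q'"
  shows "p * q' = p' * q"
proof -
  have "poly (p * q' - p' * q) z = 0" if z: "poly (q * q') z \<noteq> 0" for z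
    using fun_cong[OF assms(3), of "Fin z"] z
    by (auto simp: proj_point_def field_simps)
  then have "UNIV \<subseteq> {z. poly (q * q') z = 0} \<union> {z. poly (p * q' - p' * q) z = 0}"
    by blast
  moreover have "finite {z. poly (q * q') z = 0}"
    using assms(1,2) poly_roots_finite[of "q * q'"] by simp
  ultimately have "infinite {z. poly (p * q' - p' * q) z = 0}"
    using finite_subset infinite_UNIV_char_0[where 'a = complex] by (metis finite_Un)
  then have "p * q' - p' * q = 0"
    using poly_roots_finite by blast
  then show ?thesis by simp
qed

lemma rat_degree_quot_map:
  assumes "coprime p q" "q \<noteq> 0"
  shows "rat_degree (quot_map p q) = max (degree p) (degree q)"
  unfolding rat_degree_def
proof (rule the_equality)
  show "\<exists>p' q'. coprime p' q' \<and> q' \<noteq> 0 \<and> quot_map p q = quot_map p' q' \<and>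
      max (degree p) (degree q) = max (degree p') (degree q')"
    using assms by blast
next
  fix d
  assume "\<exists>p' q'. coprime p' q' \<and> q' \<noteq> 0 \<and> quot_map p q = quot_map p' q' \<and>
      d = max (degree p') (degree q')"
  then obtain p' q' where *: "coprime p' q'" "q' \<noteq> 0" "quot_map p q = quot_map p' q'"
    and d: "d = max (degree p') (degree q')" by blast
  have eq: "p * q' = p' * q"
    using quot_map_eq_imp[OF assms(2) *(2,3)] .
  have cross: "a dvd a' \<and> b dvd b'" if "coprime a b" "a * b' = a' * b" for a b a' b' :: "complex poly"
  proof
    have "a dvd a' * b" using that(2) by (metis dvd_triv_left)
    then show "a dvd a'" using that(1) by (simp add: coprime_dvd_mult_left_iff)
    have "b dvd a * b'" using that(2) by simp
    moreover have "coprime b a" using that(1) by (simp add: coprime_commute)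
    ultimately show "b dvd b'" by (simp add: coprime_dvd_mult_right_iff)
  qed
  have deg: "degree a = degree b" if "a dvd b" "b dvd a" for a b :: "complex poly"
    using that by (cases "a = 0"; cases "b = 0") (auto intro: le_antisym dvd_imp_degree_le)
  have "p dvd p'" "q dvd q'" "p' dvd p" "q' dvd q"
    using cross[OF assms(1) eq] cross[OF *(1) eq[symmetric]] by auto
  then show "d = max (degree p) (degree q)"
    using deg[of p p'] deg[of q q'] by (simp add: d)
qed

definition moebius :: "(cp1 \<Rightarrow> cp1) \<Rightarrow> bool" where
  "moebius F \<longleftrightarrow> (\<exists>a b c d. a * d - b * c \<noteq> 0 \<and> F = quot_map [:b, a:] [:d, c:])"

definition Aut_cp1 :: "(cp1 \<Rightarrow> cp1) set" where
  "Aut_cp1 = {\<mu>. rational_fun \<mu> \<and> (\<exists>\<sigma>. rational_fun \<sigma> \<and> \<mu> \<circ> \<sigma> = id \<and> \<sigma> \<circ> \<mu> = id)}"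

definition deck_group :: "(cp1 \<Rightarrow> cp1) \<Rightarrow> (cp1 \<Rightarrow> cp1) monoid" where
  "deck_group F = \<lparr>carrier = {\<mu> \<in> Aut_cp1. F \<circ> \<mu> = F}, mult = (\<circ>), one = id\<rparr>"

definition galois_covering :: "(cp1 \<Rightarrow> cp1) \<Rightarrow> bool" where
  "galois_covering F \<longleftrightarrow> rational_fun F \<and>
     (\<forall>x y. F x = F y \<longrightarrow> (\<exists>\<mu> \<in> carrier (deck_group F). \<mu> x = y))"

definition equivariant :: "(cp1 \<Rightarrow> cp1) \<Rightarrow> (cp1 \<Rightarrow> cp1) \<Rightarrow> bool" where
  "equivariant X V \<longleftrightarrow> (\<exists>\<phi> \<in> iso (deck_group X) (deck_group X).
     \<forall>\<mu> \<in> carrier (deck_group X). V \<circ> \<mu> = \<phi> \<mu> \<circ> V)"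

fun hom_coords :: "cp1 \<Rightarrow> complex \<times> complex" where
  "hom_coords (Fin z) = (z, 1)"
| "hom_coords Infty = (1, 0)"

text \<open>The form of bidegree \<open>(m, n)\<close> in \<open>(x0, x1)\<close>, \<open>(y0, y1)\<close> with coefficients \<open>c\<close>.
  Only its vanishing is used below; this does not depend on the homogeneous coordinates
  chosen.\<close>

definition bihom_eval ::
  "nat \<Rightarrow> nat \<Rightarrow> (nat \<Rightarrow> nat \<Rightarrow> complex) \<Rightarrow> cp1 \<times> cp1 \<Rightarrow> complex" where
  "bihom_eval m n c P =
     (let (x0, x1) = hom_coords (fst P); (y0, y1) = hom_coords (snd P)
      in \<Sum>i\<le>m. \<Sum>j\<le>n. c i j * x0 ^ i * x1 ^ (m - i) * y0 ^ j * y1 ^ (n - j))"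

definition zariski_closed :: "(cp1 \<times> cp1) set \<Rightarrow> bool" where
  "zariski_closed S \<longleftrightarrow> (\<exists>E. S = {P. \<forall>(m, n, c) \<in> E. bihom_eval m n c P = 0})"

definition zariski_irreducible :: "(cp1 \<times> cp1) set \<Rightarrow> bool" where
  "zariski_irreducible S \<longleftrightarrow> S \<noteq> {} \<and>
     (\<forall>Z1 Z2. zariski_closed Z1 \<and> zariski_closed Z2 \<and> S \<subseteq> Z1 \<union> Z2 \<longrightarrow> S \<subseteq> Z1 \<or> S \<subseteq> Z2)"

definition irreducible_component :: "(cp1 \<times> cp1) set \<Rightarrow> (cp1 \<times> cp1) set \<Rightarrow> bool" where
  "irreducible_component W Z \<longleftrightarrow>
     Z \<subseteq> W \<and> zariski_closed Z \<and> zariski_irreducible Z \<and>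
     (\<forall>Z'. Z \<subseteq> Z' \<and> Z' \<subseteq> W \<and> zariski_closed Z' \<and> zariski_irreducible Z' \<longrightarrow> Z' = Z)"

definition fiber_product :: "(cp1 \<Rightarrow> cp1) \<Rightarrow> (cp1 \<Rightarrow> cp1) \<Rightarrow> (cp1 \<times> cp1) set" where
  "fiber_product A B = {(x, y). A x = B y}"

definition no_common_right_factor :: "(cp1 \<Rightarrow> cp1) \<Rightarrow> (cp1 \<Rightarrow> cp1) \<Rightarrow> bool" where
  "no_common_right_factor X Y \<longleftrightarrow>
     (\<forall>X' Y' T. rational_fun X' \<and> rational_fun Y' \<and> rational_fun T \<and>
        X = X' \<circ> T \<and> Y = Y' \<circ> T \<longrightarrow> rat_degree T = 1)"

definition good_solution ::
  "(cp1 \<Rightarrow> cp1) \<Rightarrow> (cp1 \<Rightarrow> cp1) \<Rightarrow> (cp1 \<Rightarrow> cp1) \<Rightarrow> (cp1 \<Rightarrow> cp1) \<Rightarrow> bool" where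
  "good_solution X Y A B \<longleftrightarrow>
     rational_fun X \<and> rational_fun Y \<and> rational_fun A \<and> rational_fun B \<and>
     A \<circ> X = B \<circ> Y \<and>
     (\<exists>!Z. irreducible_component (fiber_product A B) Z) \<and>
     no_common_right_factor X Y"

end

theory Submission
  imports Defs "HOL-Computational_Algebra.Fundamental_Theorem_Algebra"
begin

text \<open>
  Let \<open>G\<close> be the deck group of the Galois covering \<open>B\<close>. The fibre product of \<open>A\<close> and \<open>B\<close> is the union of the
  curves \<open>t \<mapsto> (X t, \<mu> (Y t))\<close>, \<open>\<mu> \<in> G\<close>. If it is irreducible, these curves coincide. Since by Lueroth's
  theorem the absence of a common right factor makes \<open>(X, Y)\<close> generically injective, each \<open>\<mu>\<close> then lifts to
  a unique automorphism \<open>\<sigma>\<close> with \<open>X \<circ> \<sigma> = X\<close> and \<open>Y \<circ> \<sigma> = \<mu> \<circ> Y\<close>, so that \<open>X\<close> is Galois with a group isomorphic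
  to \<open>G\<close>. Isomorphic finite groups of automorphisms of the sphere are conjugate, by some \<open>\<eta>\<close>. Hence \<open>X\<close>
  and \<open>B \<circ> \<eta>\<close> have the same fibres and differ by a Moebius transformation, and the inverse of \<open>\<eta>\<close> followed
  after \<open>Y\<close> is the equivariant function \<open>V\<close>. Conversely, equivariance of \<open>V\<close> shows that the single curve
  \<open>t \<mapsto> (X t, Y t)\<close> covers the fibre product, and a common right factor \<open>T\<close> of \<open>X\<close> and \<open>Y\<close> is injective,
  because a deck transformation of \<open>X\<close> that preserves \<open>T\<close> preserves \<open>V\<close> and hence is trivial.

  Instead of resultants, function fields or topology, the proof counts points on generic fibres, that is,
  outside finite sets: a form with enough coefficients can be prescribed to vanish at so many points of a curve
  that it vanishes on the whole curve. The conjugacy of isomorphic groups follows from counting orbits, which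
  leaves cyclic, dihedral and three polyhedral types. The latter are pinned down in quaternion coordinates:
  once the group contains the Klein four-group of \<open>i\<close>, \<open>j\<close>, \<open>k\<close>, every coordinate of every element is, up to sign, half the
  trace of an element of the group, and there are only finitely many possible traces.
\<close>

subsection \<open>Rational maps in homogeneous coordinates\<close>

text \<open>The main obstacle is that the lift \<open>\<psi>\<close> from the deck group of
  \<open>B\<close> to that of \<open>X\<close> is only an abstract isomorphism, whereas the square
  with \<open>\<eta>\<close> and \<open>\<nu>\<close> needs \<open>X\<close> and \<open>B\<close> to
  be quotient maps of groups conjugate inside the automorphisms of the sphere. This is what brings a
  classification of finite groups of Moebius transformations into a theorem on functional equations.
  Conjugacy is obtained for the groups as sets only, and conjugation by \<open>\<eta>\<close> need
  not induce \<open>\<psi>\<close>; the difference between the two is precisely the automorphism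
  \<open>\<phi>\<close> in the equivariance of \<open>V\<close>.

  The second obstacle is ramification. Two rational functions that agree on an infinite set are
  equal, so identities are needed at cofinitely many points only, where all fibres in question
  consist of simple roots. The price is that generic statements have to be carried along maps in
  both directions.\<close>

definition heval :: "complex poly \<Rightarrow> nat \<Rightarrow> complex \<Rightarrow> complex \<Rightarrow> complex" where
  "heval p n a b = (\<Sum>i\<le>n. coeff p i * a ^ i * b ^ (n - i))"

lemma heval_Infty: "heval p n a 0 = coeff p n * a ^ n"
proof -
  have "heval p n a 0 = (\<Sum>i\<le>n. if i = n then coeff p n * a ^ n else 0)"
    unfolding heval_def by (intro sum.cong) auto
  then show ?thesis by simp
qed

lemma poly_altdef_le: "degree (p :: complex poly) \<le> n \<Longrightarrow> poly p z = (\<Sum>i\<le>n. coeff p i * z ^ i)"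
  by (subst poly_altdef, rule sum.mono_neutral_left) (auto simp: coeff_eq_0)

lemma heval_finite:
  assumes "b \<noteq> 0" "degree p \<le> n"
  shows "heval p n a b = b ^ n * poly p (a / b)"
proof -
  have "coeff p i * a ^ i * b ^ (n - i) = b ^ n * (coeff p i * (a / b) ^ i)" if "i \<le> n" for i
    using assms(1) that by (simp add: power_diff power_divide)
  then show ?thesis
    unfolding heval_def poly_altdef_le[OF assms(2)] sum_distrib_left by (intro sum.cong) auto
qed

lemma heval_1: "degree p \<le> n \<Longrightarrow> heval p n z 1 = poly p z"
  using heval_finite[of 1 p n z] by simp

lemma coeff_mult_bounds:
  fixes p q :: "complex poly"
  assumes "degree p \<le> m" "degree q \<le> n"
  shows "coeff (p * q) (m + n) = coeff p m * coeff q n"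
proof (cases "degree p = m \<and> degree q = n")
  case True
  then show ?thesis using coeff_mult_degree_sum by blast
next
  case False
  then have "degree p < m \<or> degree q < n" using assms by auto
  moreover have "degree (p * q) < m + n"
    using degree_mult_le[of p q] False assms by linarith
  ultimately show ?thesis by (auto simp: coeff_eq_0)
qed

lemma heval_mult:
  assumes "degree p \<le> m" "degree q \<le> n"
  shows "heval (p * q) (m + n) a b = heval p m a b * heval q n a b"
proof (cases "b = 0")
  case True
  then show ?thesis by (simp add: heval_Infty coeff_mult_bounds[OF assms] power_add)
next
  case False
  have "degree (p * q) \<le> m + n" using degree_mult_le[of p q] assms by linarith
  with False assms show ?thesis by (simp add: heval_finite power_add)
qed

lemma heval_add: "heval (p + q) n a b = heval p n a b + heval q n a b"
  by (simp add: heval_def sum.distrib algebra_simps)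

lemma heval_diff: "heval (p - q) n a b = heval p n a b - heval q n a b"
  by (simp add: heval_def sum_subtractf algebra_simps)

lemma heval_smult: "heval (smult c p) n a b = c * heval p n a b"
  by (simp add: heval_def sum_distrib_left algebra_simps)

lemma heval_0 [simp]: "heval 0 n a b = 0"
  by (simp add: heval_def)

lemma heval_sum: "heval (sum f I) n a b = (\<Sum>i\<in>I. heval (f i) n a b)"
  by (induction I rule: infinite_finite_induct) (auto simp: heval_add)

lemma degree_power_le_mult: "degree (p :: complex poly) \<le> m \<Longrightarrow> degree (p ^ k) \<le> k * m"
  by (metis degree_power_le le_trans mult.commute mult_le_mono1)

lemma heval_power: "degree p \<le> m \<Longrightarrow> heval (p ^ k) (k * m) a b = heval p m a b ^ k"
proof (induction k)
  case 0
  then show ?case by (simp add: heval_def)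
next
  case (Suc k)
  then show ?case
    using heval_mult[OF Suc.prems degree_power_le_mult[OF Suc.prems, of k]] by simp
qed

section \<open>Representations of rational maps by pairs of forms\<close>

lemma proj_point_eq_iff:
  assumes "a \<noteq> 0 \<or> b \<noteq> 0" "c \<noteq> 0 \<or> d \<noteq> 0"
  shows "proj_point a b = proj_point c d \<longleftrightarrow> a * d = c * b"
  using assms by (auto simp: proj_point_def field_simps)

lemma proj_point_scale: "k \<noteq> 0 \<Longrightarrow> proj_point (k * a) (k * b) = proj_point a b"
  by (simp add: proj_point_def)

lemma Fin_eq_proj: "Fin z = proj_point z 1" and Infty_eq_proj: "Infty = proj_point 1 0"
  by (auto simp: proj_point_def)

lemma cp1_proj_cases:
  obtains a b where "x = proj_point a b" "a \<noteq> 0 \<or> b \<noteq> 0"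
  by (metis Fin_eq_proj Infty_eq_proj cp1.exhaust zero_neq_one)

text \<open>The degree \<open>n\<close> is a parameter because numerator and denominator must be
  homogenized in one common degree; \<open>Infty\<close> is then a point like any other.\<close>

definition rep :: "(cp1 \<Rightarrow> cp1) \<Rightarrow> complex poly \<Rightarrow> complex poly \<Rightarrow> nat \<Rightarrow> bool" where
  "rep F p q n \<longleftrightarrow> coprime p q \<and> q \<noteq> 0 \<and> F = quot_map p q \<and> n = max (degree p) (degree q)"

lemma rational_fun_rep: "rational_fun F \<longleftrightarrow> (\<exists>p q n. rep F p q n)"
  unfolding rational_fun_def rep_def by auto

lemma rat_degree_rep: "rep F p q n \<Longrightarrow> rat_degree F = n"
  unfolding rep_def using rat_degree_quot_map by blast

lemma obtain_rep:
  assumes "rational_fun F"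
  obtains p q where "rep F p q (rat_degree F)"
  using assms rat_degree_rep unfolding rational_fun_rep by blast

lemma rep_degrees: "rep F p q n \<Longrightarrow> degree p \<le> n \<and> degree q \<le> n"
  unfolding rep_def by auto

text \<open>At finite points coprimality excludes a common root. At \<open>Infty\<close> it matters
  that \<open>n\<close> is the exact maximum of the two degrees, so that one of the top coefficients
  is nonzero.\<close>

lemma rep_nonzero:
  assumes "rep F p q n" "a \<noteq> 0 \<or> b \<noteq> 0"
  shows "heval p n a b \<noteq> 0 \<or> heval q n a b \<noteq> 0"
proof (cases "b = 0")
  case True
  have "coeff p n \<noteq> 0 \<or> coeff q n \<noteq> 0"
  proof (cases "degree p \<le> degree q")
    case True
    then show ?thesis using assms(1) by (auto simp: rep_def max_def)
  next
    case False
    then have "p \<noteq> 0" by auto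
    then show ?thesis using False assms(1) by (auto simp: rep_def max_def)
  qed
  then show ?thesis using True assms(2) by (auto simp: heval_Infty)
next
  case False
  have "\<not> (poly p (a / b) = 0 \<and> poly q (a / b) = 0)"
    using assms(1) coprime_poly_0 unfolding rep_def by blast
  then show ?thesis using False assms by (auto simp: heval_finite rep_def)
qed

lemma rep_value:
  assumes "rep F p q n" "a \<noteq> 0 \<or> b \<noteq> 0"
  shows "F (proj_point a b) = proj_point (heval p n a b) (heval q n a b)"
proof (cases "b = 0")
  case True
  then have "a \<noteq> 0" "proj_point a b = Infty" using assms by (auto simp: proj_point_def)
  then show ?thesis using True assms(1) proj_point_scale[of "a ^ n" "coeff p n" "coeff q n"]
    by (simp add: heval_Infty rep_def Let_def mult.commute)
next
  case False
  then have "proj_point a b = Fin (a / b)" by (simp add: proj_point_def)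
  then show ?thesis using False assms(1) by (simp add: heval_finite rep_def proj_point_scale)
qed

lemma rep_eq_iff:
  assumes "rep F p q n" "rep G u v m" "a \<noteq> 0 \<or> b \<noteq> 0" "c \<noteq> 0 \<or> d \<noteq> 0"
  shows "F (proj_point a b) = G (proj_point c d) \<longleftrightarrow>
    heval p n a b * heval v m c d = heval u m c d * heval q n a b"
  unfolding rep_value[OF assms(1,3)] rep_value[OF assms(2,4)]
  by (rule proj_point_eq_iff[OF rep_nonzero[OF assms(1,3)] rep_nonzero[OF assms(2,4)]])

lemma rep_Fin_eq_iff:
  assumes "rep F p q n" "rep G u v m"
  shows "F (Fin z) = G (Fin w) \<longleftrightarrow> poly p z * poly v w = poly u w * poly q z"
  using rep_eq_iff[OF assms, of z 1 w 1] rep_degrees[OF assms(1)] rep_degrees[OF assms(2)]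
  by (simp add: heval_1 Fin_eq_proj[symmetric])

section \<open>Generic points and generic fibres\<close>

lemma inj_Fin: "inj_on Fin A"
  by (simp add: inj_on_def)

lemma infinite_cp1: "infinite (UNIV :: cp1 set)"
  using infinite_UNIV_char_0[where 'a = complex] finite_imageD[OF _ inj_Fin[of UNIV]]
    finite_subset[OF subset_UNIV] by blast

lemma eventually_Fin:
  "(\<forall>\<^sub>F z in cofinite. P (Fin z)) \<longleftrightarrow> (\<forall>\<^sub>F x in cofinite. P x)"
proof
  assume "\<forall>\<^sub>F z in cofinite. P (Fin z)"
  then have "finite (insert Infty (Fin ` {z. \<not> P (Fin z)}))"
    by (simp add: eventually_cofinite)
  moreover have "x \<in> insert Infty (Fin ` {z. \<not> P (Fin z)})" if "\<not> P x" for x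
    using that by (cases x) auto
  ultimately show "\<forall>\<^sub>F x in cofinite. P x"
    unfolding eventually_cofinite by (elim finite_subset[rotated]) blast
next
  assume "\<forall>\<^sub>F x in cofinite. P x"
  moreover have "Fin ` {z. \<not> P (Fin z)} \<subseteq> {x. \<not> P x}" by auto
  ultimately have "finite (Fin ` {z. \<not> P (Fin z)})"
    unfolding eventually_cofinite using finite_subset by blast
  then show "\<forall>\<^sub>F z in cofinite. P (Fin z)"
    unfolding eventually_cofinite by (rule finite_imageD[OF _ inj_Fin])
qed

lemma frequently_Fin:
  "(\<exists>\<^sub>F z in cofinite. P (Fin z)) \<longleftrightarrow> (\<exists>\<^sub>F x in cofinite. P x)"
  unfolding frequently_def using eventually_Fin[of "\<lambda>x. \<not> P x"] by simp

text \<open>Agreement on an infinite set gives \<open>p * v - u * q\<close> infinitely many roots,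
  so the cross products are equal as polynomials, and homogenizing carries this identity to
  \<open>Infty\<close>. This is what permits all later arguments to discard finite sets.\<close>

lemma rational_fun_eqI:
  assumes "rational_fun F" "rational_fun G" "\<exists>\<^sub>F x in cofinite. F x = G x"
  shows "F = G"
proof -
  obtain p q n where F: "rep F p q n" using assms(1) rational_fun_rep by blast
  obtain u v m where G: "rep G u v m" using assms(2) rational_fun_rep by blast
  have "infinite {z. F (Fin z) = G (Fin z)}"
    using assms(3) frequently_Fin[of "\<lambda>x. F x = G x"] by (simp add: frequently_cofinite)
  then have "infinite {z. poly (p * v - u * q) z = 0}"
    by (simp add: rep_Fin_eq_iff[OF F G])
  then have "p * v - u * q = 0" using poly_roots_finite by blast
  then have eq: "p * v = u * q" by simp
  show ?thesis
  proof
    fix x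
    obtain a b where x: "x = proj_point a b" "a \<noteq> 0 \<or> b \<noteq> 0" by (rule cp1_proj_cases)
    have "heval (p * v) (n + m) a b = heval (u * q) (m + n) a b"
      using eq by (simp add: add.commute)
    then show "F x = G x"
      unfolding x using rep_degrees[OF F] rep_degrees[OF G] rep_eq_iff[OF F G x(2) x(2)]
      by (simp add: heval_mult)
  qed
qed

lemma fibre_form:
  assumes "rep F p q n" "a \<noteq> 0 \<or> b \<noteq> 0" "c \<noteq> 0 \<or> d \<noteq> 0"
  shows "F (proj_point a b) = proj_point c d \<longleftrightarrow> heval (smult d p - smult c q) n a b = 0"
  unfolding rep_value[OF assms(1,2)] proj_point_eq_iff[OF rep_nonzero[OF assms(1,2)] assms(3)]
  by (auto simp: heval_diff heval_smult mult.commute)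

text \<open>For nonzero \<open>d\<close> a vanishing form would make \<open>p\<close> a multiple of
  \<open>q\<close>; by coprimality both would then be constant.\<close>

lemma fibre_form_nonzero:
  assumes "rep F p q n" "1 \<le> n" "c \<noteq> 0 \<or> d \<noteq> 0"
  shows "smult d p - smult c q \<noteq> 0"
proof
  assume "smult d p - smult c q = 0"
  then have eq: "smult d p = smult c q" by simp
  have q: "q \<noteq> 0" "coprime p q" using assms(1) by (auto simp: rep_def)
  show False
  proof (cases "d = 0")
    case True
    then show False using eq assms(3) q by simp
  next
    case False
    then have p: "p = smult (c / d) q"
      using eq by (metis divide_inverse_commute left_inverse smult_1_left smult_smult)
    then have "q dvd p" by (metis dvd_smult dvd_refl)
    then have "is_unit q" using q(2) by (meson coprime_def dvd_refl)
    then have "degree q = 0" by (simp add: is_unit_iff_degree q(1))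
    then show False using p assms(1,2) by (auto simp: rep_def split: if_splits)
  qed
qed

lemma fibre_eq_roots:
  assumes "rep F p q n" "c \<noteq> 0 \<or> d \<noteq> 0"
  defines "h \<equiv> smult d p - smult c q"
  shows "{x. F x = proj_point c d} = Fin ` {z. poly h z = 0} \<union> (if coeff h n = 0 then {Infty} else {})"
proof -
  have dh: "degree h \<le> n"
    unfolding h_def using rep_degrees[OF assms(1)]
    by (meson degree_diff_le degree_smult_le le_trans)
  have "F (Fin z) = proj_point c d \<longleftrightarrow> poly h z = 0" for z
    unfolding Fin_eq_proj using fibre_form[OF assms(1) _ assms(2), of z 1] dh
    by (simp add: h_def heval_1)
  moreover have "F Infty = proj_point c d \<longleftrightarrow> coeff h n = 0"
    unfolding Infty_eq_proj using fibre_form[OF assms(1) _ assms(2), of 1 0]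
    by (simp add: h_def heval_Infty)
  ultimately have "F x = proj_point c d \<longleftrightarrow>
      x \<in> Fin ` {z. poly h z = 0} \<union> (if coeff h n = 0 then {Infty} else {})" for x
    by (cases x) auto
  then show ?thesis by blast
qed

lemma fibre_card_le:
  assumes "rational_fun F" "1 \<le> rat_degree F"
  shows "finite {x. F x = y} \<and> card {x. F x = y} \<le> rat_degree F"
proof -
  let ?n = "rat_degree F"
  obtain p q where F: "rep F p q ?n" using obtain_rep[OF assms(1)] .
  obtain c d where y: "y = proj_point c d" "c \<noteq> 0 \<or> d \<noteq> 0" by (rule cp1_proj_cases)
  define h where "h = smult d p - smult c q"
  have h0: "h \<noteq> 0" unfolding h_def by (rule fibre_form_nonzero[OF F assms(2) y(2)])
  have dh: "degree h \<le> ?n"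
    unfolding h_def using rep_degrees[OF F] by (meson degree_diff_le degree_smult_le le_trans)
  have eq: "{x. F x = y} = Fin ` {z. poly h z = 0} \<union> (if coeff h ?n = 0 then {Infty} else {})"
    unfolding y h_def by (rule fibre_eq_roots[OF F y(2)])
  have fin: "finite {z. poly h z = 0}" by (rule poly_roots_finite[OF h0])
  have card: "card (Fin ` {z. poly h z = 0}) \<le> degree h"
    using card_poly_roots_bound[OF h0] by (simp add: card_image inj_Fin)
  show ?thesis
  proof (cases "coeff h ?n = 0")
    case True
    \<comment> \<open>A zero of the form at \<open>Infty\<close> shows up as a drop of the degree of
      \<open>h\<close>, which pays for the additional point of the fibre.\<close>
    then have "degree h < ?n" using dh h0 by (metis le_neq_implies_less leading_coeff_0_iff)
    then show ?thesis using card fin True eq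
      by (auto simp: card_insert_if)
  next
    case False
    then show ?thesis using card fin eq dh by auto
  qed
qed

lemma rational_fun_surj:
  assumes "rational_fun F" "1 \<le> rat_degree F"
  shows "\<exists>x. F x = y"
proof -
  let ?n = "rat_degree F"
  obtain p q where F: "rep F p q ?n" using obtain_rep[OF assms(1)] .
  obtain c d where y: "y = proj_point c d" "c \<noteq> 0 \<or> d \<noteq> 0" by (rule cp1_proj_cases)
  define h where "h = smult d p - smult c q"
  have eq: "{x. F x = y} = Fin ` {z. poly h z = 0} \<union> (if coeff h ?n = 0 then {Infty} else {})"
    unfolding y h_def by (rule fibre_eq_roots[OF F y(2)])
  show ?thesis
  proof (cases "coeff h ?n = 0")
    case True
    then show ?thesis using eq by auto
  next
    case False
    then have "degree h \<ge> 1" using assms(2) le_degree le_trans by blast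
    then have "\<not> constant (poly h)" by (simp add: constant_degree)
    then obtain z where "poly h z = 0" using fundamental_theorem_of_algebra by blast
    then show ?thesis using eq by blast
  qed
qed

lemma card_roots_rsquarefree:
  fixes h :: "complex poly"
  assumes "rsquarefree h"
  shows "card {z. poly h z = 0} = degree h"
proof -
  have h0: "h \<noteq> 0" using assms by (simp add: rsquarefree_def)
  have "degree h = degree (smult (lead_coeff h) (\<Prod>z | poly h z = 0. [:-z, 1:]))"
    by (subst complex_poly_decompose_rsquarefree[OF assms]) simp
  also have "\<dots> = card {z. poly h z = 0}"
    using h0 by (simp add: degree_prod_eq_sum_degree)
  finally show ?thesis by simp
qed

text \<open>The Wronskian is, up to sign, the numerator of the derivative of \<open>p / q\<close>.
  If it vanished, coprimality would make each of \<open>p\<close> and \<open>q\<close> divide its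
  own derivative, and both would be constant.\<close>

lemma wronskian_nonzero:
  assumes "rep F p q n" "1 \<le> n"
  shows "p * pderiv q - pderiv p * q \<noteq> 0"
proof
  assume "p * pderiv q - pderiv p * q = 0"
  then have eq: "p * pderiv q = pderiv p * q" by simp
  have cop: "coprime p q" and q0: "q \<noteq> 0" using assms(1) by (auto simp: rep_def)
  have "p dvd pderiv p * q" "q dvd p * pderiv q" by (metis eq dvd_triv_left, simp add: eq)
  then have "p dvd pderiv p" "q dvd pderiv q"
    using cop by (simp_all add: coprime_dvd_mult_left_iff coprime_dvd_mult_right_iff coprime_commute)
  then have "degree p = 0" "degree q = 0"
    using not_dvd_pderiv by (blast, metis not_dvd_pderiv)
  then show False using assms by (simp add: rep_def)
qed

text \<open>A multiple root of the fibre polynomial is a root of the Wronskian, so only finitely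
  many values are affected. The value at \<open>Infty\<close> is discarded as well: this keeps the
  degree of the fibre polynomial at \<open>rat_degree F\<close> and the whole fibre at finite
  points.\<close>

lemma generic_fibre:
  assumes "rational_fun F" "1 \<le> rat_degree F"
  shows "\<forall>\<^sub>F y in cofinite. F Infty \<noteq> y \<and> card {x. F x = y} = rat_degree F"
proof -
  let ?n = "rat_degree F"
  obtain p q where F: "rep F p q ?n" using obtain_rep[OF assms(1)] .
  define w where "w = p * pderiv q - pderiv p * q"
  have w0: "w \<noteq> 0" unfolding w_def by (rule wronskian_nonzero[OF F assms(2)])
  define B where "B = {F Infty, Infty} \<union> F ` Fin ` {z. poly w z = 0}"
  have "finite B" unfolding B_def using poly_roots_finite[OF w0] by auto
  moreover have "F Infty \<noteq> y \<and> card {x. F x = y} = ?n" if "y \<notin> B" for y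
  proof -
    have "y \<noteq> Infty" using that by (simp add: B_def)
    then obtain c where c: "y = Fin c" using cp1.exhaust by auto
    then have y: "y = proj_point c 1" by (simp add: Fin_eq_proj)
    define h where "h = smult 1 p - smult c q"
    have eq: "{x. F x = y} = Fin ` {z. poly h z = 0} \<union> (if coeff h ?n = 0 then {Infty} else {})"
      unfolding y h_def by (rule fibre_eq_roots[OF F]) simp
    have cf: "coeff h ?n \<noteq> 0" using eq that unfolding B_def by (auto split: if_splits)
    have dh: "degree h = ?n"
      unfolding h_def using rep_degrees[OF F] cf le_degree
      by (metis (no_types, lifting) antisym degree_diff_le degree_smult_le h_def le_trans)
    have "rsquarefree h"
      unfolding rsquarefree_roots
    proof (intro allI notI)
      fix a assume a: "poly h a = 0 \<and> poly (pderiv h) a = 0"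
      then have "poly p a = c * poly q a" "poly (pderiv p) a = c * poly (pderiv q) a"
        by (auto simp: h_def pderiv_diff pderiv_smult)
      then have "poly w a = 0" by (simp add: w_def)
      moreover have "F (Fin a) = y" using a eq by blast
      ultimately show False using that unfolding B_def by blast
    qed
    then have "card {z. poly h z = 0} = degree h" by (rule card_roots_rsquarefree)
    then show ?thesis using eq cf dh that by (auto simp: card_image inj_Fin B_def)
  qed
  ultimately show ?thesis
    unfolding eventually_cofinite by (elim finite_subset[rotated]) blast
qed

text \<open>Cofinite properties pull back because fibres are finite. Pushing them forward, as in
  \<open>eventually_push\<close>, uses only that the image of a finite set is finite.\<close>

lemma eventually_pull:
  assumes "rational_fun F" "1 \<le> rat_degree F" "\<forall>\<^sub>F y in cofinite. P y"
  shows "\<forall>\<^sub>F x in cofinite. P (F x)"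
proof -
  have "{x. \<not> P (F x)} = (\<Union>y\<in>{y. \<not> P y}. {x. F x = y})" by auto
  then show ?thesis using assms(3) fibre_card_le[OF assms(1,2)]
    unfolding eventually_cofinite by auto
qed

lemma eventually_push:
  assumes "\<forall>\<^sub>F x in cofinite. P x"
  shows "\<forall>\<^sub>F y in cofinite. \<forall>x. F x = y \<longrightarrow> P x"
proof -
  have "{y. \<not> (\<forall>x. F x = y \<longrightarrow> P x)} = F ` {x. \<not> P x}" by auto
  then show ?thesis using assms unfolding eventually_cofinite by auto
qed

lemma eventually_fibre:
  assumes "rational_fun F" "1 \<le> rat_degree F" "\<forall>\<^sub>F x in cofinite. P x"
  shows "\<forall>\<^sub>F x in cofinite. \<forall>s. F s = F x \<longrightarrow> P s"
  by (rule eventually_pull[OF assms(1,2) eventually_push[OF assms(3)]])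

section \<open>Composition of rational maps\<close>

definition hcomp :: "complex poly \<Rightarrow> nat \<Rightarrow> complex poly \<Rightarrow> complex poly \<Rightarrow> complex poly" where
  "hcomp p n u v = (\<Sum>i\<le>n. smult (coeff p i) (u ^ i * v ^ (n - i)))"

lemma degree_hcomp:
  assumes "degree u \<le> m" "degree v \<le> m"
  shows "degree (hcomp p n u v) \<le> n * m"
  unfolding hcomp_def
proof (intro degree_sum_le)
  fix i assume "i \<in> {..n}"
  then have "i * m + (n - i) * m = n * m" by (simp flip: add_mult_distrib)
  then show "degree (smult (coeff p i) (u ^ i * v ^ (n - i))) \<le> n * m"
    using degree_power_le_mult[OF assms(1), of i] degree_power_le_mult[OF assms(2), of "n - i"]
      degree_mult_le[of "u ^ i" "v ^ (n - i)"] degree_smult_le[of "coeff p i" "u ^ i * v ^ (n - i)"]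
    by linarith
qed simp

lemma heval_hcomp:
  assumes "degree u \<le> m" "degree v \<le> m"
  shows "heval (hcomp p n u v) (n * m) a b = heval p n (heval u m a b) (heval v m a b)"
proof -
  have "heval (u ^ i * v ^ (n - i)) (n * m) a b = heval u m a b ^ i * heval v m a b ^ (n - i)"
    if "i \<le> n" for i
  proof -
    have "i * m + (n - i) * m = n * m" using that by (simp flip: add_mult_distrib)
    then show ?thesis
      using heval_mult[OF degree_power_le_mult[OF assms(1), of i] degree_power_le_mult[OF assms(2), of "n - i"], of a b]
      by (simp add: heval_power assms)
  qed
  then show ?thesis
    unfolding hcomp_def heval_sum heval_smult heval_def[of p]
    by (intro sum.cong) (auto simp: mult.assoc)
qed

lemma coprimeI_roots:
  fixes p q :: "complex poly"
  assumes "\<And>z. poly p z \<noteq> 0 \<or> poly q z \<noteq> 0"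
  shows "coprime p q"
proof (rule ccontr)
  assume n: "\<not> coprime p q"
  have "\<not> (p = 0 \<and> q = 0)" using assms by auto
  then have g0: "gcd p q \<noteq> 0" by simp
  have "\<not> is_unit (gcd p q)" using n by (simp add: coprime_iff_gcd_eq_1 is_unit_gcd)
  then have "degree (gcd p q) \<noteq> 0" using g0 is_unit_iff_degree by blast
  then obtain z where "poly (gcd p q) z = 0"
    using fundamental_theorem_of_algebra constant_degree by metis
  then have "poly p z = 0" "poly q z = 0"
    by (meson dvd_trans gcd_dvd1 gcd_dvd2 poly_eq_0_iff_dvd)+
  then show False using assms by blast
qed

text \<open>Absence of common zeros on the whole projective line encodes both parts of
  \<open>rep\<close>: at finite points it gives coprimality, at \<open>Infty\<close> it says that
  one of the degrees equals \<open>N\<close>.\<close>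

lemma repI:
  assumes "degree p \<le> N" "degree q \<le> N" "q \<noteq> 0"
    and nz: "\<And>a b. a \<noteq> 0 \<or> b \<noteq> 0 \<Longrightarrow> heval p N a b \<noteq> 0 \<or> heval q N a b \<noteq> 0"
    and val: "\<And>a b. a \<noteq> 0 \<or> b \<noteq> 0 \<Longrightarrow> F (proj_point a b) = proj_point (heval p N a b) (heval q N a b)"
  shows "rep F p q N"
proof -
  have cop: "coprime p q"
    using nz[of _ 1] assms(1,2) by (intro coprimeI_roots) (simp add: heval_1)
  have N: "N = max (degree p) (degree q)"
    using nz[of 1 0] assms(1,2) by (auto simp: heval_Infty max_def dest: le_degree)
  have r: "rep (quot_map p q) p q N" using cop N assms(3) by (simp add: rep_def)
  have "F = quot_map p q"
  proof
    fix x
    obtain a b where x: "x = proj_point a b" "a \<noteq> 0 \<or> b \<noteq> 0" by (rule cp1_proj_cases)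
    then show "F x = quot_map p q x" using val rep_value[OF r] by simp
  qed
  then show ?thesis using r by simp
qed

text \<open>Forms without common zeros compose to forms without common zeros, so nothing cancels and
  degrees multiply. The point \<open>t\<close> rules out that the composition is constantly
  \<open>Infty\<close>, a map that has no nonzero denominator.\<close>

lemma rep_comp:
  assumes F: "rep F p q n" and G: "rep G u v m" and ne: "F (G t) \<noteq> Infty"
  shows "rep (F \<circ> G) (hcomp p n u v) (hcomp q n u v) (n * m)"
proof (rule repI)
  note d = rep_degrees[OF G]
  show "degree (hcomp p n u v) \<le> n * m" "degree (hcomp q n u v) \<le> n * m"
    using degree_hcomp d by auto
  show nz: "heval (hcomp p n u v) (n * m) a b \<noteq> 0 \<or> heval (hcomp q n u v) (n * m) a b \<noteq> 0"
    if "a \<noteq> 0 \<or> b \<noteq> 0" for a b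
    using d rep_nonzero[OF F rep_nonzero[OF G that]] by (simp add: heval_hcomp)
  show val: "(F \<circ> G) (proj_point a b) =
      proj_point (heval (hcomp p n u v) (n * m) a b) (heval (hcomp q n u v) (n * m) a b)"
    if "a \<noteq> 0 \<or> b \<noteq> 0" for a b
    using d rep_value[OF G that] rep_value[OF F rep_nonzero[OF G that]] by (simp add: heval_hcomp)
  show "hcomp q n u v \<noteq> 0"
  proof
    assume "hcomp q n u v = 0"
    moreover obtain a b where "t = proj_point a b" "a \<noteq> 0 \<or> b \<noteq> 0" by (rule cp1_proj_cases)
    ultimately show False using val[of a b] ne by (simp add: proj_point_def)
  qed
qed

lemma rational_fun_comp_nonpole:
  assumes "rational_fun F" "rational_fun G" "F (G t) \<noteq> Infty"
  shows "rational_fun (F \<circ> G)" "rat_degree (F \<circ> G) = rat_degree F * rat_degree G"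
proof -
  obtain p q where F: "rep F p q (rat_degree F)" using obtain_rep[OF assms(1)] .
  obtain u v where G: "rep G u v (rat_degree G)" using obtain_rep[OF assms(2)] .
  note r = rep_comp[OF F G assms(3)]
  show "rational_fun (F \<circ> G)" using r rational_fun_rep by blast
  show "rat_degree (F \<circ> G) = rat_degree F * rat_degree G" by (rule rat_degree_rep[OF r])
qed

lemma rational_fun_not_Infty:
  assumes "rational_fun F"
  shows "\<exists>x. F x \<noteq> Infty"
proof -
  obtain p q n where F: "rep F p q n" using assms rational_fun_rep by blast
  then have "q \<noteq> 0" by (simp add: rep_def)
  then obtain z where "poly q z \<noteq> 0" using poly_all_0_iff_0 by blast
  then have "F (Fin z) \<noteq> Infty" using F by (simp add: rep_def proj_point_def)
  then show ?thesis by blast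
qed

lemma rational_fun_comp:
  assumes "rational_fun F" "rational_fun G" "1 \<le> rat_degree G"
  shows "rational_fun (F \<circ> G)" "rat_degree (F \<circ> G) = rat_degree F * rat_degree G"
proof -
  obtain x where x: "F x \<noteq> Infty" using rational_fun_not_Infty[OF assms(1)] by blast
  obtain t where "G t = x" using rational_fun_surj[OF assms(2,3)] by blast
  then have "F (G t) \<noteq> Infty" using x by simp
  note c = rational_fun_comp_nonpole[OF assms(1,2) this]
  show "rational_fun (F \<circ> G)" "rat_degree (F \<circ> G) = rat_degree F * rat_degree G"
    using c by auto
qed

lemma rational_fun_const:
  assumes "rational_fun F" "rat_degree F = 0"
  shows "F x = F y"
proof -
  obtain p q where F: "rep F p q 0" using obtain_rep[OF assms(1)] assms(2) by auto
  then have d: "degree p = 0" "degree q = 0" by (auto simp: rep_def)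
  obtain a b where x: "x = proj_point a b" "a \<noteq> 0 \<or> b \<noteq> 0" by (rule cp1_proj_cases)
  obtain c e where y: "y = proj_point c e" "c \<noteq> 0 \<or> e \<noteq> 0" by (rule cp1_proj_cases)
  show ?thesis unfolding x y using rep_value[OF F x(2)] rep_value[OF F y(2)] by (simp add: heval_def)
qed

lemma rat_degree_pos:
  assumes "rational_fun F" "F x \<noteq> F y"
  shows "1 \<le> rat_degree F"
  using rational_fun_const[OF assms(1)] assms(2) by (metis less_one not_le)

subsection \<open>Curves with few points over a line\<close>

text \<open>Gaussian elimination by induction over the equations: an equation with nonzero
  coefficient at \<open>u0\<close> is the pivot, \<open>g\<close> is the system with
  \<open>u0\<close> eliminated, and \<open>c'\<close> restores the value of the unknown
  \<open>u0\<close>.\<close>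

lemma homogeneous_system_nontrivial:
  fixes f :: "'i \<Rightarrow> 'u \<Rightarrow> complex"
  assumes "finite I" "finite U" "card I < card U"
  shows "\<exists>c. (\<exists>u\<in>U. c u \<noteq> 0) \<and> (\<forall>i\<in>I. (\<Sum>u\<in>U. f i u * c u) = 0)"
  using assms
proof (induction I arbitrary: U f rule: finite_induct)
  case empty
  then have "U \<noteq> {}" by auto
  then obtain u where "u \<in> U" by auto
  then show ?case by (intro exI[of _ "\<lambda>_. 1"]) auto
next
  case (insert i I)
  show ?case
  proof (cases "\<forall>u\<in>U. f i u = 0")
    case True
    have "card I < card U" using insert.prems(2) insert.hyps by simp
    from insert.IH[OF insert.prems(1) this, of f] True show ?thesis by auto
  next
    case False
    then obtain u0 where u0: "u0 \<in> U" "f i u0 \<noteq> 0" by auto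
    define U' where "U' = U - {u0}"
    define g where "g = (\<lambda>j u. f j u - f j u0 / f i u0 * f i u)"
    have U': "finite U'" "card I < card U'"
      using insert.prems insert.hyps u0 by (auto simp: U'_def)
    obtain c where c: "\<exists>u\<in>U'. c u \<noteq> 0" "\<forall>j\<in>I. (\<Sum>u\<in>U'. g j u * c u) = 0"
      using insert.IH[OF U', of g] by auto
    define s where "s = (\<Sum>u\<in>U'. f i u * c u)"
    define c' where "c' = (\<lambda>u. if u = u0 then - s / f i u0 else c u)"
    have split: "(\<Sum>u\<in>U. f j u * c' u) = f j u0 * (- s / f i u0) + (\<Sum>u\<in>U'. f j u * c u)" for j
    proof -
      have "(\<Sum>u\<in>U. f j u * c' u) = f j u0 * c' u0 + (\<Sum>u\<in>U'. f j u * c' u)"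
        unfolding U'_def by (rule sum.remove[OF insert.prems(1) u0(1)])
      also have "(\<Sum>u\<in>U'. f j u * c' u) = (\<Sum>u\<in>U'. f j u * c u)"
        by (intro sum.cong) (auto simp: c'_def U'_def)
      finally show ?thesis by (simp add: c'_def)
    qed
    have "(\<Sum>u\<in>U. f j u * c' u) = 0" if "j \<in> I" for j
    proof -
      have "0 = (\<Sum>u\<in>U'. f j u * c u) - (\<Sum>u\<in>U'. f j u0 / f i u0 * (f i u * c u))"
        using c(2) that by (simp add: g_def algebra_simps sum_subtractf)
      also have "(\<Sum>u\<in>U'. f j u0 / f i u0 * (f i u * c u)) = f j u0 / f i u0 * s"
        by (simp add: s_def sum_distrib_left)
      finally show ?thesis by (simp add: split)
    qed
    moreover have "(\<Sum>u\<in>U. f i u * c' u) = 0"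
      using u0 by (simp add: split s_def)
    moreover have "\<exists>u\<in>U. c' u \<noteq> 0" using c(1) by (auto simp: c'_def U'_def)
    ultimately show ?thesis by (intro exI[of _ c']) auto
  qed
qed

text \<open>The polynomial behind \<open>bihom_eval\<close>, freed from the normalized coordinates
  of \<open>hom_coords\<close>, so that it can be evaluated at the values of forms and
  rescaled.\<close>

definition biform ::
  "nat \<Rightarrow> nat \<Rightarrow> (nat \<Rightarrow> nat \<Rightarrow> complex) \<Rightarrow> complex \<Rightarrow> complex \<Rightarrow> complex \<Rightarrow> complex \<Rightarrow> complex" where
  "biform m n c x0 x1 y0 y1 =
     (\<Sum>i\<le>m. \<Sum>j\<le>n. c i j * x0 ^ i * x1 ^ (m - i) * y0 ^ j * y1 ^ (n - j))"

lemma power_split_le: "i \<le> n \<Longrightarrow> (k :: complex) ^ n = k ^ i * k ^ (n - i)"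
  by (simp flip: power_add)

lemma biform_scale:
  "biform m n c (k * x0) (k * x1) (l * y0) (l * y1) = k ^ m * l ^ n * biform m n c x0 x1 y0 y1"
  unfolding biform_def sum_distrib_left
proof (intro sum.cong refl)
  fix i j assume "i \<in> {..m}" "j \<in> {..n}"
  then show "c i j * (k * x0) ^ i * (k * x1) ^ (m - i) * (l * y0) ^ j * (l * y1) ^ (n - j) =
      k ^ m * l ^ n * (c i j * x0 ^ i * x1 ^ (m - i) * y0 ^ j * y1 ^ (n - j))"
    using power_split_le[of i m k] power_split_le[of j n l] by (simp add: power_mult_distrib)
qed

lemma hom_coords_proj:
  assumes "a \<noteq> 0 \<or> b \<noteq> 0"
  obtains k where "k \<noteq> 0" "a = k * fst (hom_coords (proj_point a b))"
    "b = k * snd (hom_coords (proj_point a b))"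
  using assms by (cases "b = 0") (auto simp: proj_point_def)

lemma bihom_eval_proj:
  assumes "a \<noteq> 0 \<or> b \<noteq> 0" "u \<noteq> 0 \<or> v \<noteq> 0"
  shows "bihom_eval m n c (proj_point a b, proj_point u v) = 0 \<longleftrightarrow> biform m n c a b u v = 0"
proof -
  obtain k where k: "k \<noteq> 0" "a = k * fst (hom_coords (proj_point a b))"
    "b = k * snd (hom_coords (proj_point a b))" using hom_coords_proj[OF assms(1)] .
  obtain l where l: "l \<noteq> 0" "u = l * fst (hom_coords (proj_point u v))"
    "v = l * snd (hom_coords (proj_point u v))" using hom_coords_proj[OF assms(2)] .
  have "biform m n c a b u v = k ^ m * l ^ n * bihom_eval m n c (proj_point a b, proj_point u v)"
    by (subst k(2), subst k(3), subst l(2), subst l(3), subst biform_scale)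
      (simp add: bihom_eval_def biform_def Let_def case_prod_unfold)
  then show ?thesis using k(1) l(1) by simp
qed

text \<open>The restriction of a form of bidegree \<open>(m, n)\<close> to the curve with components
  \<open>p / q\<close> and \<open>r / w\<close>, cleared of denominators. With components of degrees
  \<open>e\<close> and \<open>e'\<close> its formal degree is \<open>m * e + n * e'\<close>.\<close>

definition pull_poly ::
  "nat \<Rightarrow> nat \<Rightarrow> (nat \<Rightarrow> nat \<Rightarrow> complex) \<Rightarrow> complex poly \<Rightarrow> complex poly \<Rightarrow> complex poly \<Rightarrow> complex poly \<Rightarrow> complex poly" where
  "pull_poly m n c p q r w =
     (\<Sum>i\<le>m. \<Sum>j\<le>n. smult (c i j) ((p ^ i * q ^ (m - i)) * (r ^ j * w ^ (n - j))))"

lemma degree_homogeneous_monomial: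
  fixes p q :: "complex poly"
  assumes "degree p \<le> e" "degree q \<le> e" "i \<le> m"
  shows "degree (p ^ i * q ^ (m - i)) \<le> m * e"
proof -
  have "i * e + (m - i) * e = m * e" using assms(3) by (simp flip: add_mult_distrib)
  then show ?thesis
    using degree_power_le_mult[OF assms(1), of i] degree_power_le_mult[OF assms(2), of "m - i"]
      degree_mult_le[of "p ^ i" "q ^ (m - i)"] by linarith
qed

lemma heval_homogeneous_monomial:
  assumes "degree p \<le> e" "degree q \<le> e" "i \<le> m"
  shows "heval (p ^ i * q ^ (m - i)) (m * e) a b = heval p e a b ^ i * heval q e a b ^ (m - i)"
proof -
  have "i * e + (m - i) * e = m * e" using assms(3) by (simp flip: add_mult_distrib)
  then show ?thesis
    using heval_mult[OF degree_power_le_mult[OF assms(1), of i] degree_power_le_mult[OF assms(2), of "m - i"], of a b]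
    by (simp add: heval_power assms)
qed

lemma degree_pull_poly:
  assumes "degree p \<le> e" "degree q \<le> e" "degree r \<le> e'" "degree w \<le> e'"
  shows "degree (pull_poly m n c p q r w) \<le> m * e + n * e'"
  unfolding pull_poly_def
proof (intro degree_sum_le)
  fix i j assume "i \<in> {..m}" "j \<in> {..n}"
  then have "degree (p ^ i * q ^ (m - i)) \<le> m * e" "degree (r ^ j * w ^ (n - j)) \<le> n * e'"
    using degree_homogeneous_monomial assms by auto
  then show "degree (smult (c i j) ((p ^ i * q ^ (m - i)) * (r ^ j * w ^ (n - j)))) \<le> m * e + n * e'"
    using degree_mult_le[of "p ^ i * q ^ (m - i)" "r ^ j * w ^ (n - j)"]
      degree_smult_le[of "c i j" "(p ^ i * q ^ (m - i)) * (r ^ j * w ^ (n - j))"] by linarith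
qed auto

lemma heval_pull_poly:
  assumes "degree p \<le> e" "degree q \<le> e" "degree r \<le> e'" "degree w \<le> e'"
  shows "heval (pull_poly m n c p q r w) (m * e + n * e') a b =
    biform m n c (heval p e a b) (heval q e a b) (heval r e' a b) (heval w e' a b)"
  unfolding pull_poly_def biform_def heval_sum heval_smult
proof (intro sum.cong refl)
  fix i j assume ij: "i \<in> {..m}" "j \<in> {..n}"
  then have "degree (p ^ i * q ^ (m - i)) \<le> m * e" "degree (r ^ j * w ^ (n - j)) \<le> n * e'"
    using degree_homogeneous_monomial assms by auto
  then show "c i j * heval ((p ^ i * q ^ (m - i)) * (r ^ j * w ^ (n - j))) (m * e + n * e') a b =
      c i j * heval p e a b ^ i * heval q e a b ^ (m - i) * heval r e' a b ^ j * heval w e' a b ^ (n - j)"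
    using ij by (simp add: heval_mult heval_homogeneous_monomial assms)
qed

lemma bihom_eval_curve:
  assumes "rep X p q e" "rep Y r w e'" "a \<noteq> 0 \<or> b \<noteq> 0"
  shows "bihom_eval m n c (X (proj_point a b), Y (proj_point a b)) = 0 \<longleftrightarrow>
    heval (pull_poly m n c p q r w) (m * e + n * e') a b = 0"
  using rep_degrees[OF assms(1)] rep_degrees[OF assms(2)]
  by (simp add: rep_value[OF assms(1,3)] rep_value[OF assms(2,3)] heval_pull_poly
      bihom_eval_proj[OF rep_nonzero[OF assms(1,3)] rep_nonzero[OF assms(2,3)]])

text \<open>A form of sufficiently large bidegree \<open>(M, k)\<close> has more coefficients than there are points
  of the curve over \<open>L\<close> chosen values of \<open>X\<close>, while each such value contributes \<open>deg X\<close> zeros of the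
  pulled back polynomial; so prescribing its vanishing at these points forces it to vanish
  on the whole curve.\<close>

lemma interpolation:
  assumes X: "rational_fun X" "1 \<le> rat_degree X" and Y: "rational_fun Y"
    and few: "\<forall>\<^sub>F x in cofinite. \<exists>S. finite S \<and> card S \<le> k \<and> (\<forall>t. X t = x \<longrightarrow> Y t \<in> S)"
  shows "\<exists>M c. (\<exists>i\<le>M. \<exists>j\<le>k. c i j \<noteq> 0) \<and> (\<forall>t. bihom_eval M k c (X t, Y t) = 0)"
proof -
  let ?e = "rat_degree X" and ?e' = "rat_degree Y"
  obtain p q where rX: "rep X p q ?e" using obtain_rep[OF X(1)] .
  obtain r w where rY: "rep Y r w ?e'" using obtain_rep[OF Y(1)] .
  \<comment> \<open>The \<open>L * deg X\<close> zeros must exceed the degree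
    \<open>M * deg X + k * deg Y\<close> of the pulled back polynomial; this dictates
    \<open>L\<close>. The number of conditions is then at most
    \<open>L * k = (M + 1) * k + k * k * deg Y\<close>, and \<open>M = k * k * deg Y\<close> keeps
    it just below the number \<open>(M + 1) * (k + 1)\<close> of coefficients.\<close>
  define M where "M = k * k * ?e'"
  define L where "L = M + 1 + k * ?e'"
  define good where "good = {x. (X Infty \<noteq> x \<and> card {t. X t = x} = ?e) \<and>
     (\<exists>S. finite S \<and> card S \<le> k \<and> (\<forall>t. X t = x \<longrightarrow> Y t \<in> S))}"
  have "\<forall>\<^sub>F x in cofinite. x \<in> good"
    unfolding good_def using eventually_conj[OF generic_fibre[OF X] few] by simp
  then have "finite (- good)" by (simp add: eventually_cofinite Compl_eq)
  then have "infinite good" using infinite_cp1 by (metis Compl_partition2 finite_UnI sup_commute)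
  then obtain G where G: "finite G" "card G = L" "G \<subseteq> good"
    using infinite_arbitrarily_large by metis
  have "\<forall>x\<in>G. \<exists>S. finite S \<and> card S \<le> k \<and> (\<forall>t. X t = x \<longrightarrow> Y t \<in> S)"
    using G(3) by (auto simp: good_def)
  then obtain S where S: "\<forall>x\<in>G. finite (S x) \<and> card (S x) \<le> k \<and> (\<forall>t. X t = x \<longrightarrow> Y t \<in> S x)"
    by metis
  define Eq where "Eq = (SIGMA x:G. S x)"
  have finEq: "finite Eq" unfolding Eq_def using G(1) S by auto
  have "card Eq = (\<Sum>x\<in>G. card (S x))" unfolding Eq_def using G(1) S by (subst card_SigmaI) auto
  also have "\<dots> \<le> (\<Sum>x\<in>G. k)" using S by (intro sum_mono) auto
  also have "\<dots> = L * k" using G(2) by simp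
  also have "\<dots> < (M + 1) * (k + 1)" by (simp add: L_def M_def algebra_simps)
  also have "\<dots> = card ({..M} \<times> {..k})" by simp
  finally have cardEq: "card Eq < card ({..M} \<times> {..k})" .
  define f where "f = (\<lambda>P :: cp1 \<times> cp1. \<lambda>(i, j). let (x0, x1) = hom_coords (fst P); (y0, y1) = hom_coords (snd P)
     in x0 ^ i * x1 ^ (M - i) * y0 ^ j * y1 ^ (k - j))"
  obtain c' where c': "\<exists>u\<in>{..M} \<times> {..k}. c' u \<noteq> 0" "\<forall>P\<in>Eq. (\<Sum>u\<in>{..M} \<times> {..k}. f P u * c' u) = 0"
    using homogeneous_system_nontrivial[OF finEq _ cardEq, of f] by auto
  define c where "c = (\<lambda>i j. c' (i, j))"
  have bih: "bihom_eval M k c P = (\<Sum>u\<in>{..M} \<times> {..k}. f P u * c' u)" for P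
    unfolding bihom_eval_def f_def c_def
    by (simp add: sum.cartesian_product case_prod_unfold Let_def mult_ac)
  let ?H = "pull_poly M k c p q r w"
  have "?H = 0"
  proof (rule ccontr)
    assume H0: "?H \<noteq> 0"
    have dH: "degree ?H \<le> M * ?e + k * ?e'"
      using degree_pull_poly rep_degrees[OF rX] rep_degrees[OF rY] by auto
    define Z where "Z = (\<Union>x\<in>G. {t. X t = x})"
    have "card Z = (\<Sum>x\<in>G. card {t. X t = x})"
      unfolding Z_def using fibre_card_le[OF X] G(1) by (intro card_UN_disjoint) auto
    also have "\<dots> = (\<Sum>x\<in>G. ?e)" using G(3) by (intro sum.cong) (auto simp: good_def)
    finally have cardZ: "card Z = L * ?e" using G(2) by simp
    have sub: "Z \<subseteq> Fin ` {z. poly ?H z = 0}"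
    proof
      fix t assume t: "t \<in> Z"
      then have tG: "X t \<in> G" by (auto simp: Z_def)
      have "t \<noteq> Infty" using tG G(3) by (auto simp: good_def)
      then obtain z where z: "t = Fin z" using cp1.exhaust by auto
      have "(X t, Y t) \<in> Eq" using S tG by (auto simp: Eq_def)
      then have "bihom_eval M k c (X t, Y t) = 0" using c'(2) bih by simp
      then have "heval ?H (M * ?e + k * ?e') z 1 = 0"
        using bihom_eval_curve[OF rX rY, of z 1 M k c] by (simp add: z Fin_eq_proj)
      then show "t \<in> Fin ` {z. poly ?H z = 0}" using dH z by (simp add: heval_1)
    qed
    have "card Z \<le> card (Fin ` {z. poly ?H z = 0})"
      by (rule card_mono[OF _ sub]) (simp add: poly_roots_finite H0)
    also have "\<dots> \<le> degree ?H" using card_poly_roots_bound[OF H0] by (simp add: card_image inj_Fin)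
    finally have "L * ?e \<le> M * ?e + k * ?e'" using dH cardZ by simp
    moreover have "k * ?e' \<le> k * ?e' * ?e" using X(2) by simp
    moreover have "L * ?e = M * ?e + ?e + k * ?e' * ?e" by (simp add: L_def algebra_simps)
    ultimately show False using X(2) by linarith
  qed
  then have "bihom_eval M k c (X t, Y t) = 0" for t
  proof -
    obtain a b where t: "t = proj_point a b" "a \<noteq> 0 \<or> b \<noteq> 0" by (rule cp1_proj_cases)
    show ?thesis unfolding t using bihom_eval_curve[OF rX rY t(2), of M k c] \<open>?H = 0\<close> by simp
  qed
  moreover have "\<exists>i\<le>M. \<exists>j\<le>k. c i j \<noteq> 0" using c'(1) by (auto simp: c_def)
  ultimately show ?thesis by blast
qed

section \<open>Functions that are constant on the fibres of a rational map\<close>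

lemma reduce_fraction:
  assumes "b \<noteq> 0"
  obtains R where "rational_fun R" "rat_degree R \<le> max (degree a) (degree b)"
    "\<And>z. poly a z \<noteq> 0 \<or> poly b z \<noteq> 0 \<Longrightarrow> R (Fin z) = proj_point (poly a z) (poly b z)"
proof -
  define g where "g = gcd a b"
  have g0: "g \<noteq> 0" using assms by (simp add: g_def)
  obtain a' b' where ab: "a = g * a'" "b = g * b'" unfolding g_def by (meson dvd_def gcd_dvd1 gcd_dvd2)
  have b'0: "b' \<noteq> 0" using ab assms by auto
  have cop: "coprime a' b'"
  proof -
    have "a' = a div g" "b' = b div g" using ab g0 by auto
    then show ?thesis using div_gcd_coprime[of a b] assms by (simp add: g_def)
  qed
  have "degree a' \<le> degree a" using ab(1) g0 by (cases "a' = 0") (auto simp: degree_mult_eq)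
  moreover have "degree b' \<le> degree b" using ab(2) g0 b'0 by (auto simp: degree_mult_eq)
  ultimately have "rat_degree (quot_map a' b') \<le> max (degree a) (degree b)"
    using rat_degree_quot_map[OF cop b'0] by auto
  moreover have "rational_fun (quot_map a' b')" using cop b'0 unfolding rational_fun_def by blast
  moreover have "quot_map a' b' (Fin z) = proj_point (poly a z) (poly b z)"
    if "poly a z \<noteq> 0 \<or> poly b z \<noteq> 0" for z
  proof -
    have "poly g z \<noteq> 0" using that ab by auto
    then show ?thesis using ab by (simp add: proj_point_scale)
  qed
  ultimately show ?thesis using that by blast
qed

lemma eventually_ne_Infty: 
  assumes "rational_fun X"
  shows "\<forall>\<^sub>F t in cofinite. X t \<noteq> Infty"
proof (cases "1 \<le> rat_degree X")
  case True
  then show ?thesis using fibre_card_le[OF assms True, of Infty] by (simp add: eventually_cofinite)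
next
  case False
  then have "rat_degree X = 0" by simp
  then have "X t \<noteq> Infty" for t
    using rational_fun_const[OF assms] rational_fun_not_Infty[OF assms] by metis
  then show ?thesis by simp
qed

lemma cofinite_cp1_bot: "cofinite \<noteq> (bot :: cp1 filter)"
  using infinite_cp1 by simp

lemma eventually_poly_nonzero: "p \<noteq> 0 \<Longrightarrow> \<forall>\<^sub>F z in cofinite. poly p z \<noteq> 0"
  for p :: "complex poly"
  using poly_roots_finite by (simp add: eventually_cofinite)

text \<open>Over a generic value of \<open>T\<close> the function \<open>X\<close> takes a single
  value, so interpolation with \<open>k = 1\<close> yields a relation
  \<open>a(T) + b(T) X = 0\<close> that is linear in \<open>X\<close>. Here \<open>b\<close> cannot
  vanish, since \<open>a(T)\<close> would then vanish generically, and \<open>X\<close> is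
  \<open>- a / b\<close> composed with \<open>T\<close>.\<close>

lemma descent:
  assumes T: "rational_fun T" "1 \<le> rat_degree T" and X: "rational_fun X"
    and const: "\<forall>\<^sub>F t in cofinite. \<forall>s. T s = T t \<longrightarrow> X s = X t"
  shows "\<exists>X'. rational_fun X' \<and> X = X' \<circ> T"
proof -
  have "\<forall>\<^sub>F x in cofinite. \<exists>S. finite S \<and> card S \<le> Suc 0 \<and> (\<forall>t. T t = x \<longrightarrow> X t \<in> S)"
    using eventually_push[OF const, of T]
  proof eventually_elim
    case (elim x)
    obtain t where "T t = x" using rational_fun_surj[OF T] by blast
    with elim have "\<forall>t'. T t' = x \<longrightarrow> X t' \<in> {X t}" by (metis singletonI)
    then show ?case by (intro exI[of _ "{X t}"]) auto
  qed
  from interpolation[OF T X this] obtain M c where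
    c: "\<exists>i\<le>M. \<exists>j\<le>Suc 0. c i j \<noteq> 0" "\<And>t. bihom_eval M (Suc 0) c (T t, X t) = 0" by blast
  define a where "a = (\<Sum>i\<le>M. monom (c i 0) i)"
  define b where "b = (\<Sum>i\<le>M. monom (c i (Suc 0)) i)"
  have coeffs: "coeff a i = c i 0" "coeff b i = c i (Suc 0)" if "i \<le> M" for i
    using that by (simp_all add: a_def b_def coeff_sum if_distrib cong: if_cong)
  have da: "degree a \<le> M" unfolding a_def by (intro degree_sum_le) (auto intro: le_trans[OF degree_monom_le])
  have db: "degree b \<le> M" unfolding b_def by (intro degree_sum_le) (auto intro: le_trans[OF degree_monom_le])
  have form: "biform M (Suc 0) c x0 x1 y0 y1 = heval a M x0 x1 * y1 + heval b M x0 x1 * y0" for x0 x1 y0 y1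
  proof -
    have "biform M (Suc 0) c x0 x1 y0 y1 =
        (\<Sum>i\<le>M. coeff a i * x0 ^ i * x1 ^ (M - i) * y1 + coeff b i * x0 ^ i * x1 ^ (M - i) * y0)"
      unfolding biform_def by (intro sum.cong) (auto simp: coeffs)
    then show ?thesis by (simp add: heval_def sum_distrib_right sum.distrib)
  qed
  have rel: "poly a x * y1 + poly b x * y0 = 0"
    if "T t = Fin x" "X t = proj_point y0 y1" "y0 \<noteq> 0 \<or> y1 \<noteq> 0" for t x y0 y1
    using c(2)[of t] bihom_eval_proj[of x 1 y0 y1 M "Suc 0" c] that da db
    by (simp add: form Fin_eq_proj heval_1)
  have Tfin: "\<forall>\<^sub>F t in cofinite. T t \<noteq> Infty" by (rule eventually_ne_Infty[OF T(1)])
  have pull: "\<forall>\<^sub>F t in cofinite. \<forall>x. T t = Fin x \<longrightarrow> poly h x \<noteq> 0" if "h \<noteq> 0" for h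
  proof (rule eventually_pull[OF T])
    have "\<forall>\<^sub>F z in cofinite. \<forall>x. Fin z = Fin x \<longrightarrow> poly h x \<noteq> 0"
      using eventually_poly_nonzero[OF that] by simp
    then show "\<forall>\<^sub>F y in cofinite. \<forall>x. y = Fin x \<longrightarrow> poly h x \<noteq> 0"
      by (subst (asm) eventually_Fin)
  qed
  have b0: "b \<noteq> 0"
  proof
    assume "b = 0"
    then have "a \<noteq> 0" using c(1) coeffs by (metis coeff_0 le_Suc_eq le_zero_eq)
    have "\<forall>\<^sub>F t in cofinite. X t \<noteq> X t"
      using pull[OF \<open>a \<noteq> 0\<close>] Tfin eventually_ne_Infty[OF X]
    proof eventually_elim
      case (elim t)
      then obtain x y where xy: "T t = Fin x" "X t = Fin y" by (meson cp1.exhaust)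
      then show ?case using rel[of t x y 1] elim \<open>b = 0\<close> by (simp add: Fin_eq_proj)
    qed
    then show False using cofinite_cp1_bot by simp
  qed
  obtain R where R: "rational_fun R"
    "\<And>z. poly (- a) z \<noteq> 0 \<or> poly b z \<noteq> 0 \<Longrightarrow> R (Fin z) = proj_point (poly (- a) z) (poly b z)"
    using reduce_fraction[OF b0, of "- a"] by blast
  have "\<forall>\<^sub>F t in cofinite. X t = (R \<circ> T) t"
    using pull[OF b0] Tfin eventually_ne_Infty[OF X]
  proof eventually_elim
    case (elim t)
    then obtain x y where xy: "T t = Fin x" "X t = Fin y" by (meson cp1.exhaust)
    have bx: "poly b x \<noteq> 0" using elim xy by simp
    have "poly a x + poly b x * y = 0" using rel[of t x y 1] xy by (simp add: Fin_eq_proj)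
    then have "y = - poly a x / poly b x" using bx by (simp add: field_simps add_eq_0_iff)
    then show ?case using R(2)[of x] bx xy by (simp add: proj_point_def)
  qed
  then have "X = R \<circ> T"
    using rational_fun_comp(1)[OF R(1) T] cofinite_cp1_bot
    by (intro rational_fun_eqI[OF X]) (auto intro: eventually_frequently)
  then show ?thesis using R(1) by blast
qed

subsection \<open>Elimination and Lueroth's theorem\<close>

text \<open>A greatest common divisor over the fraction field, obtained without leaving the domain:
  \<open>D\<close> has least degree in the ideal of \<open>P\<close> and \<open>Q\<close>, and
  pseudo-division shows that \<open>D\<close> divides each of them after multiplication by a nonzero
  scalar.\<close>

lemma elimination_ideal:
  fixes P Q :: "'a :: idom poly"
  assumes "P \<noteq> 0"
  obtains D u v c a b where "D \<noteq> 0" "D = u * P + v * Q" "c \<noteq> 0" "smult c P = D * a" "smult c Q = D * b"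
proof -
  define J where "J = {D. D \<noteq> 0 \<and> (\<exists>u v. D = u * P + v * Q)}"
  have "P \<in> J" unfolding J_def using assms by (auto intro: exI[of _ 1] exI[of _ 0])
  define D where "D = arg_min degree (\<lambda>D. D \<in> J)"
  have DJ: "D \<in> J" unfolding D_def by (rule arg_min_natI[of "\<lambda>D. D \<in> J" P, OF \<open>P \<in> J\<close>])
  have Dmin: "degree D \<le> degree E" if "E \<in> J" for E
    unfolding D_def by (rule arg_min_nat_le[of "\<lambda>D. D \<in> J" E, OF that])
  obtain u v where D0: "D \<noteq> 0" and Duv: "D = u * P + v * Q" using DJ unfolding J_def by blast
  have div: "\<exists>c a. c \<noteq> 0 \<and> smult c (x * P + y * Q) = D * a" for x y
  proof -
    let ?f = "x * P + y * Q"
    obtain q r where qr: "pseudo_divmod ?f D = (q, r)" by fastforce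
    define c where "c = coeff D (degree D) ^ (Suc (degree ?f) - degree D)"
    have c0: "c \<noteq> 0" using D0 by (simp add: c_def)
    have eq: "smult c ?f = D * q + r" using pseudo_divmod(1)[OF D0 qr] by (simp add: c_def)
    have "r = 0"
    proof (rule ccontr)
      assume "r \<noteq> 0"
      have "r = smult c ?f - D * q" using eq by simp
      also have "\<dots> = ([:c:] * x - q * u) * P + ([:c:] * y - q * v) * Q"
        by (simp add: Duv algebra_simps smult_add_right)
      finally have "r \<in> J" unfolding J_def using \<open>r \<noteq> 0\<close> by blast
      then show False using Dmin[of r] pseudo_divmod(2)[OF D0 qr] \<open>r \<noteq> 0\<close> by simp
    qed
    then show ?thesis using eq c0 by auto
  qed
  obtain c1 a where c1: "c1 \<noteq> 0" "smult c1 P = D * a" using div[of 1 0] by auto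
  obtain c2 b where c2: "c2 \<noteq> 0" "smult c2 Q = D * b" using div[of 0 1] by auto
  have eqs: "smult (c1 * c2) P = D * smult c2 a" "smult (c1 * c2) Q = D * smult c1 b"
    using c1(2) c2(2) by (metis mult.commute mult_smult_right smult_smult)+
  then show ?thesis using c1(1) c2(1) by (intro that[OF D0 Duv _ eqs]) auto
qed

text \<open>A polynomial over polynomials is read as \<open>D(t, s)\<close> with \<open>s\<close> as
  the outer variable. \<open>sec D t\<close> fixes \<open>t\<close> and leaves a polynomial in
  \<open>s\<close>, whereas \<open>poly D [:s:]\<close> fixes \<open>s\<close> and leaves a
  polynomial in \<open>t\<close>.\<close>

definition sec :: "complex poly poly \<Rightarrow> complex \<Rightarrow> complex poly" where
  "sec D t = map_poly (\<lambda>c. poly c t) D"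

lemma coeff_sec [simp]: "coeff (sec D t) i = poly (coeff D i) t"
  by (simp add: sec_def coeff_map_poly)

lemma sec_pCons: "sec (pCons a D) t = pCons (poly a t) (sec D t)"
  by (rule poly_eqI) (simp add: coeff_pCons split: nat.split)

lemma poly_sec: "poly (sec D t) s = poly (poly D [:s:]) t"
proof (induction D)
  case 0
  then show ?case by (simp add: sec_def)
next
  case (pCons a D)
  then show ?case by (simp add: sec_pCons)
qed

lemma sec_mult: "sec (P * Q) t = sec P t * sec Q t"
  by (rule poly_eq_poly_eq_iff[THEN iffD1], rule ext) (simp add: poly_sec)

lemma sec_add: "sec (P + Q) t = sec P t + sec Q t"
  by (rule poly_eqI) simp

lemma sec_diff: "sec (P - Q) t = sec P t - sec Q t"
  by (rule poly_eqI) simp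

lemma sec_smult: "sec (smult c P) t = smult (poly c t) (sec P t)"
  by (rule poly_eqI) simp

lemma degree_sec: "poly (lead_coeff D) t \<noteq> 0 \<Longrightarrow> degree (sec D t) = degree D"
  by (rule antisym) (auto intro: degree_le le_degree simp: coeff_eq_0)

definition lift :: "complex poly \<Rightarrow> complex poly poly" where
  "lift p = map_poly (\<lambda>c. [:c:]) p"

lemma sec_lift [simp]: "sec (lift p) t = p"
  by (rule poly_eqI) (simp add: lift_def coeff_map_poly)

lemma poly_lift: "poly (lift p) [:s:] = [:poly p s:]"
  unfolding lift_def by (induction p) (simp_all add: map_poly_pCons)

text \<open>With \<open>F = p / q\<close> and \<open>G = u / v\<close> this is the numerator of
  \<open>F(t) - G(s)\<close>.\<close>

definition corr :: "complex poly \<Rightarrow> complex poly \<Rightarrow> complex poly \<Rightarrow> complex poly \<Rightarrow> complex poly poly" where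
  "corr p q u v = smult p (lift v) - smult q (lift u)"

lemma sec_corr: "sec (corr p q u v) t = smult (poly p t) v - smult (poly q t) u"
  by (simp add: corr_def sec_diff sec_smult)

lemma poly_corr: "poly (corr p q u v) [:s:] = smult (poly v s) p - smult (poly u s) q"
  by (simp add: corr_def poly_lift)

lemma corr_zero_iff:
  assumes "rep F p q n" "rep G u v m"
  shows "G (Fin s) = F (Fin t) \<longleftrightarrow> poly (sec (corr p q u v) t) s = 0"
  using rep_Fin_eq_iff[OF assms, of t s] by (auto simp: sec_corr mult.commute)

text \<open>Since \<open>p\<close> and \<open>q\<close> do not both vanish at \<open>t\<close>, a
  multiple root is a zero of the Wronskian. It lies in the fibre through \<open>t\<close>, so
  \<open>t\<close> is confined to the fibres through the finitely many zeros of the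
  Wronskian.\<close>

lemma generic_rsquarefree:
  assumes F: "rep F p q n" and n: "1 \<le> n"
  shows "\<forall>\<^sub>F t in cofinite. rsquarefree (smult (poly p t) q - smult (poly q t) p)"
proof -
  define w where "w = p * pderiv q - pderiv p * q"
  have w0: "w \<noteq> 0" unfolding w_def by (rule wronskian_nonzero[OF F n])
  have ratF: "rational_fun F" "1 \<le> rat_degree F"
    using F n rational_fun_rep rat_degree_rep by auto
  have "\<forall>\<^sub>F z in cofinite. \<forall>y. Fin z = Fin y \<longrightarrow> poly w y \<noteq> 0"
    using eventually_poly_nonzero[OF w0] by simp
  then have "\<forall>\<^sub>F x in cofinite. \<forall>y. x = Fin y \<longrightarrow> poly w y \<noteq> 0" by (subst (asm) eventually_Fin)
  then have "\<forall>\<^sub>F t in cofinite. \<forall>s. F s = F (Fin t) \<longrightarrow> (\<forall>y. s = Fin y \<longrightarrow> poly w y \<noteq> 0)"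
    using eventually_fibre[OF ratF] eventually_Fin[of "\<lambda>x. \<forall>s. F s = F x \<longrightarrow> (\<forall>y. s = Fin y \<longrightarrow> poly w y \<noteq> 0)"]
    by blast
  then show ?thesis
  proof eventually_elim
    case (elim t)
    show ?case
      unfolding rsquarefree_roots
    proof (intro allI notI)
      fix z
      assume z: "poly (smult (poly p t) q - smult (poly q t) p) z = 0 \<and>
        poly (pderiv (smult (poly p t) q - smult (poly q t) p)) z = 0"
      then have e1: "poly p t * poly q z = poly q t * poly p z"
        and e2: "poly p t * poly (pderiv q) z = poly q t * poly (pderiv p) z"
        by (auto simp: pderiv_diff pderiv_smult)
      have nz: "poly p t \<noteq> 0 \<or> poly q t \<noteq> 0"
        using rep_nonzero[OF F, of t 1] rep_degrees[OF F] by (simp add: heval_1)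
      have "poly p t * poly w z = 0" "poly q t * poly w z = 0"
        using e1 e2 unfolding w_def poly_diff poly_mult by algebra+
      then have "poly w z = 0" using nz by auto
      moreover have "F (Fin z) = F (Fin t)"
        using e1 by (simp add: rep_Fin_eq_iff[OF F F] mult.commute)
      ultimately show False using elim by blast
    qed
  qed
qed

lemma rsquarefree_uminus: "rsquarefree (- p) \<longleftrightarrow> rsquarefree (p :: complex poly)"
  by (simp add: rsquarefree_roots pderiv_minus)

text \<open>A double root of \<open>D\<close> is a double root of \<open>c * P\<close>, and
  therefore of \<open>P\<close>, because \<open>c\<close> does not vanish there.\<close>

lemma rsquarefree_factor:
  fixes D a P :: "complex poly"
  assumes "D * a = c * P" "rsquarefree P" "\<And>t. poly D t = 0 \<Longrightarrow> poly c t \<noteq> 0"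
  shows "rsquarefree D"
  unfolding rsquarefree_roots
proof (intro allI notI)
  fix t assume t: "poly D t = 0 \<and> poly (pderiv D) t = 0"
  have "poly c t * poly P t = 0" using t assms(1) by (metis mult_zero_left poly_mult)
  then have P: "poly P t = 0" using t assms(3) by auto
  have "poly (pderiv (D * a)) t = 0" using t by (simp add: pderiv_mult)
  then have "poly c t * poly (pderiv P) t = 0" using P assms(1) by (simp add: pderiv_mult)
  then have "poly (pderiv P) t = 0" using t assms(3) by auto
  then show False using P assms(2) unfolding rsquarefree_roots by blast
qed

lemma primitive_sec_nonzero:
  fixes D :: "complex poly poly"
  assumes "content D = 1"
  shows "sec D t \<noteq> 0"
proof
  assume "sec D t = 0"
  then have "poly (coeff D i) t = 0" for i by (metis coeff_0 coeff_sec)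
  then have "[:-t, 1:] dvd coeff D i" for i by (simp add: poly_eq_0_iff_dvd)
  then have "[:[:-t, 1:]:] dvd D" by (simp add: const_poly_dvd_iff)
  then have "[:-t, 1:] dvd content D" by (simp add: const_poly_dvd_iff_dvd_content)
  then show False using assms by (simp add: is_unit_iff_degree)
qed

text \<open>\<open>D\<close> is the greatest common divisor of the numerators of
  \<open>X(s) - X(t)\<close> and \<open>Y(s) - Z(t)\<close> as polynomials in \<open>s\<close> over
  the rational functions of \<open>t\<close>; the scalars \<open>c\<close> and \<open>k\<close> of
  the division cause only finitely many bad \<open>t\<close>. Taking the primitive part removes
  vertical lines, so no section vanishes identically. This gives the last property, where the
  variables change roles: over each of the finitely many zeros of \<open>c\<close> there are
  finitely many \<open>s\<close>, and a generic \<open>s\<close> avoids all of them.\<close>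

lemma elimination:
  assumes X: "rational_fun X" "1 \<le> rat_degree X" and Y: "rational_fun Y" and Z: "rational_fun Z"
  obtains D where "\<forall>t. sec D t \<noteq> 0"
    "\<forall>\<^sub>F t in cofinite. degree (sec D t) = degree D \<and> rsquarefree (sec D t) \<and>
       (\<forall>s. poly (sec D t) s = 0 \<longleftrightarrow> X (Fin s) = X (Fin t) \<and> Y (Fin s) = Z (Fin t))"
    "\<forall>\<^sub>F s in cofinite. rsquarefree (poly D [:s:]) \<and>
       (\<forall>t. poly (poly D [:s:]) t = 0 \<longrightarrow> X (Fin s) = X (Fin t) \<and> Y (Fin s) = Z (Fin t))"
proof -
  let ?n = "rat_degree X"
  obtain p q where rX: "rep X p q ?n" using obtain_rep[OF X(1)] .
  obtain r w where rY: "rep Y r w (rat_degree Y)" using obtain_rep[OF Y] .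
  obtain r' w' where rZ: "rep Z r' w' (rat_degree Z)" using obtain_rep[OF Z] .
  define P where "P = corr p q p q"
  define Q where "Q = corr r' w' r w"
  have Pz: "X (Fin s) = X (Fin t) \<longleftrightarrow> poly (sec P t) s = 0" for s t
    unfolding P_def by (rule corr_zero_iff[OF rX rX])
  have Qz: "Y (Fin s) = Z (Fin t) \<longleftrightarrow> poly (sec Q t) s = 0" for s t
    unfolding Q_def by (rule corr_zero_iff[OF rZ rY])
  have gen: "\<forall>\<^sub>F t in cofinite. rsquarefree (smult (poly p t) q - smult (poly q t) p)"
    by (rule generic_rsquarefree[OF rX X(2)])
  then have Psq: "\<forall>\<^sub>F t in cofinite. rsquarefree (sec P t)" by (simp add: P_def sec_corr)
  have Psq': "\<forall>\<^sub>F s in cofinite. rsquarefree (poly P [:s:])"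
    using gen
  proof eventually_elim
    case (elim t)
    then show ?case
      using rsquarefree_uminus[of "smult (poly p t) q - smult (poly q t) p"]
      by (simp add: P_def poly_corr)
  qed
  have "P \<noteq> 0"
  proof
    assume "P = 0"
    moreover obtain t where "rsquarefree (sec P t)"
      using eventually_happens'[OF _ Psq] infinite_UNIV_char_0[where 'a = complex] by auto
    ultimately show False by (simp add: sec_def rsquarefree_def)
  qed
  then obtain D1 u v c a1 b1 where D1: "D1 \<noteq> 0" "D1 = u * P + v * Q" "c \<noteq> 0"
    "smult c P = D1 * a1" "smult c Q = D1 * b1" using elimination_ideal by metis
  define k where "k = content D1"
  define D where "D = primitive_part D1"
  have k0: "k \<noteq> 0" using D1(1) by (simp add: k_def)
  have D1k: "D1 = smult k D" by (simp add: k_def D_def)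
  define a b where "a = smult k a1" and "b = smult k b1"
  have cP: "smult c P = D * a" and cQ: "smult c Q = D * b"
    using D1(4,5) by (simp_all add: a_def b_def D1k)
  have kD: "smult k D = u * P + v * Q" using D1(2) by (simp add: D1k)
  have "content D = 1" using D1(1) by (simp add: D_def)
  then have prim: "sec D t \<noteq> 0" for t by (rule primitive_sec_nonzero)
  have D0: "D \<noteq> 0" using D1(1) by (simp add: D_def)
  have zeros: "poly (sec D t) s = 0 \<Longrightarrow> X (Fin s) = X (Fin t) \<and> Y (Fin s) = Z (Fin t)"
    if "poly c t \<noteq> 0" for s t
  proof -
    assume "poly (sec D t) s = 0"
    moreover have "smult (poly c t) (sec P t) = sec D t * sec a t"
      "smult (poly c t) (sec Q t) = sec D t * sec b t"
      using cP cQ by (metis sec_smult sec_mult)+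
    ultimately have "poly c t * poly (sec P t) s = 0" "poly c t * poly (sec Q t) s = 0"
      by (metis mult_zero_left poly_mult poly_smult)+
    then show ?thesis using that by (simp add: Pz Qz)
  qed
  have "\<forall>\<^sub>F t in cofinite. degree (sec D t) = degree D \<and> rsquarefree (sec D t) \<and>
       (\<forall>s. poly (sec D t) s = 0 \<longleftrightarrow> X (Fin s) = X (Fin t) \<and> Y (Fin s) = Z (Fin t))"
    using eventually_poly_nonzero[OF k0] eventually_poly_nonzero[OF D1(3)] Psq
      eventually_poly_nonzero[of "lead_coeff D", unfolded leading_coeff_0_iff, OF D0]
  proof eventually_elim
    case (elim t)
    have "smult (poly c t) (sec P t) = sec D t * sec a t" using cP by (metis sec_smult sec_mult)
    then have "sec D t * sec a t = [:poly c t:] * sec P t" by simp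
    then have "rsquarefree (sec D t)"
      by (rule rsquarefree_factor[OF _ elim(3)]) (use elim(2) in simp)
    moreover have "poly (sec D t) s = 0" if "X (Fin s) = X (Fin t) \<and> Y (Fin s) = Z (Fin t)" for s
    proof -
      have "smult (poly k t) (sec D t) = sec u t * sec P t + sec v t * sec Q t"
        using kD by (metis sec_add sec_mult sec_smult)
      then have "poly k t * poly (sec D t) s = poly (sec u t * sec P t + sec v t * sec Q t) s"
        by (metis poly_smult)
      then show ?thesis using that elim(1) by (simp add: Pz Qz)
    qed
    ultimately show ?case using zeros[OF elim(2)] degree_sec[OF elim(4)] by blast
  qed
  moreover have "\<forall>\<^sub>F s in cofinite. rsquarefree (poly D [:s:]) \<and>
       (\<forall>t. poly (poly D [:s:]) t = 0 \<longrightarrow> X (Fin s) = X (Fin t) \<and> Y (Fin s) = Z (Fin t))"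
  proof -
    have "\<forall>\<^sub>F s in cofinite. \<forall>t\<in>{t. poly c t = 0}. poly (sec D t) s \<noteq> 0"
      using poly_roots_finite[OF D1(3)] prim
      by (intro eventually_ball_finite) (auto intro: eventually_poly_nonzero)
    with Psq' show ?thesis
    proof eventually_elim
      case (elim s)
      have ct: "poly c t \<noteq> 0" if "poly (poly D [:s:]) t = 0" for t
        using elim(2) that by (auto simp: poly_sec)
      have "poly D [:s:] * poly a [:s:] = c * poly P [:s:]"
        using cP by (metis poly_mult poly_smult)
      then have "rsquarefree (poly D [:s:])" by (rule rsquarefree_factor[OF _ elim(1) ct])
      then show ?case using zeros[OF ct] by (auto simp: poly_sec)
    qed
  qed
  ultimately show ?thesis using that prim by blast
qed

lemma rsquarefree_same_roots:
  fixes f g :: "complex poly"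
  assumes "rsquarefree f" "rsquarefree g" "\<And>z. poly f z = 0 \<longleftrightarrow> poly g z = 0"
  obtains k where "k \<noteq> 0" "f = smult k g"
proof -
  let ?m = "\<Prod>z | poly g z = 0. [:- z, 1:]"
  have f0: "f \<noteq> 0" "g \<noteq> 0" using assms(1,2) by (auto simp: rsquarefree_def)
  have "f = smult (lead_coeff f) ?m"
    using complex_poly_decompose_rsquarefree[OF assms(1)] assms(3) by simp
  moreover have "g = smult (lead_coeff g) ?m"
    using complex_poly_decompose_rsquarefree[OF assms(2)] by simp
  ultimately have "f = smult (lead_coeff f / lead_coeff g) g"
    using f0 by (metis (no_types, lifting) leading_coeff_0_iff nonzero_eq_divide_eq smult_smult)
  then show ?thesis using that[of "lead_coeff f / lead_coeff g"] f0 by simp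
qed

text \<open>Lueroth's theorem for the field generated by \<open>X\<close> and \<open>Y\<close>: if \<open>D(t, s)\<close> cuts out the pairs that
  \<open>X\<close> and \<open>Y\<close> do not separate, then \<open>T(t) = D(t, s0) / D(t, s1)\<close> is constant on the classes and its
  degree is at most the size of a class, so \<open>X\<close> and \<open>Y\<close> factor through \<open>T\<close>.\<close>

lemma generically_injective:
  assumes X: "rational_fun X" "1 \<le> rat_degree X" and Y: "rational_fun Y"
    and nf: "no_common_right_factor X Y"
  shows "\<forall>\<^sub>F t in cofinite. \<forall>s. X s = X t \<and> Y s = Y t \<longrightarrow> s = t"
proof -
  define E where "E = (\<lambda>z. {s. X (Fin s) = X (Fin z) \<and> Y (Fin s) = Y (Fin z)})"
  obtain D where prim: "\<forall>t. sec D t \<noteq> 0"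
    and g2: "\<forall>\<^sub>F t in cofinite. degree (sec D t) = degree D \<and> rsquarefree (sec D t) \<and>
       (\<forall>s. poly (sec D t) s = 0 \<longleftrightarrow> X (Fin s) = X (Fin t) \<and> Y (Fin s) = Y (Fin t))"
    and g3: "\<forall>\<^sub>F s in cofinite. rsquarefree (poly D [:s:]) \<and>
       (\<forall>t. poly (poly D [:s:]) t = 0 \<longrightarrow> X (Fin s) = X (Fin t) \<and> Y (Fin s) = Y (Fin t))"
    using elimination[OF X Y Y] by blast
  let ?d = "degree D"
  have g2': "\<forall>\<^sub>F t in cofinite. rsquarefree (sec D t) \<and> {s. poly (sec D t) s = 0} = E t \<and> card (E t) = ?d"
    using g2
  proof eventually_elim
    case (elim t)
    then have "{s. poly (sec D t) s = 0} = E t" by (auto simp: E_def)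
    then show ?case using card_roots_rsquarefree[of "sec D t"] elim by auto
  qed
  have ex: "\<exists>t. P t" if "\<forall>\<^sub>F t::complex in cofinite. P t" for P
    using eventually_happens'[OF _ that] infinite_UNIV_char_0[where 'a = complex] by simp
  obtain s0 where s0: "{s. poly (sec D s0) s = 0} = E s0" "card (E s0) = ?d"
    "rsquarefree (poly D [:s0:])"
    "\<And>t. poly (poly D [:s0:]) t = 0 \<Longrightarrow> X (Fin s0) = X (Fin t) \<and> Y (Fin s0) = Y (Fin t)"
    using ex[OF eventually_conj[OF g2' g3]] by blast
  have "\<forall>\<^sub>F x in cofinite. X x \<noteq> X (Fin s0)"
    using fibre_card_le[OF X, of "X (Fin s0)"] by (simp add: eventually_cofinite)
  then have "\<forall>\<^sub>F s in cofinite. X (Fin s) \<noteq> X (Fin s0)" by (subst eventually_Fin)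
  \<comment> \<open>That \<open>X\<close> separates \<open>s0\<close> and \<open>s1\<close> makes
    their classes disjoint; \<open>T\<close> then has a zero at \<open>s0\<close> and a pole at
    \<open>s1\<close> and is not constant.\<close>
  then obtain s1 where s1: "{s. poly (sec D s1) s = 0} = E s1" "card (E s1) = ?d"
    "rsquarefree (poly D [:s1:])"
    "\<And>t. poly (poly D [:s1:]) t = 0 \<Longrightarrow> X (Fin s1) = X (Fin t) \<and> Y (Fin s1) = Y (Fin t)"
    "X (Fin s1) \<noteq> X (Fin s0)"
    using ex[OF eventually_conj[OF eventually_conj[OF g2' g3]]] by blast
  define f0 where "f0 = poly D [:s0:]"
  define f1 where "f1 = poly D [:s1:]"
  have finE: "finite (E t)" for t
  proof -
    have "Fin ` E t \<subseteq> {x. X x = X (Fin t)}" by (auto simp: E_def)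
    then have "finite (Fin ` E t)" using fibre_card_le[OF X] finite_subset by blast
    then show ?thesis by (rule finite_imageD[OF _ inj_Fin])
  qed
  \<comment> \<open>Read as a polynomial in \<open>t\<close>, \<open>D(t, s0)\<close> has simple
    roots, all in the class of \<open>s0\<close>. This bounds the degree of \<open>T\<close> by the
    class size, although \<open>?d\<close> is the degree of \<open>D\<close> in the other
    variable.\<close>
  have "degree f0 \<le> card (E s0)"
    unfolding card_roots_rsquarefree[OF s0(3), folded f0_def, symmetric]
    by (rule card_mono[OF finE]) (use s0(4) in \<open>auto simp: E_def f0_def\<close>)
  moreover have "degree f1 \<le> card (E s1)"
    unfolding card_roots_rsquarefree[OF s1(3), folded f1_def, symmetric]
    by (rule card_mono[OF finE]) (use s1(4) in \<open>auto simp: E_def f1_def\<close>)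
  ultimately have deg: "max (degree f0) (degree f1) \<le> ?d" using s0(2) s1(2) by simp
  have f10: "f1 \<noteq> 0" using s1(3) by (simp add: f1_def rsquarefree_def)
  obtain T where T: "rational_fun T" "rat_degree T \<le> max (degree f0) (degree f1)"
    and Tv: "\<And>z. poly f0 z \<noteq> 0 \<or> poly f1 z \<noteq> 0 \<Longrightarrow> T (Fin z) = proj_point (poly f0 z) (poly f1 z)"
    using reduce_fraction[OF f10, of f0] by blast
  have "s0 \<in> E s0" "s1 \<in> E s1" by (auto simp: E_def)
  then have z0: "poly f0 s0 = 0" "poly f1 s1 = 0"
    using s0(1) s1(1) by (auto simp: f0_def f1_def poly_sec[symmetric])
  have nz: "poly f1 s0 \<noteq> 0" "poly f0 s1 \<noteq> 0"
    using s0(4)[of s1] s1(4)[of s0] s1(5) by (auto simp: f0_def f1_def)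
  have "T (Fin s0) \<noteq> T (Fin s1)"
    using Tv[of s0] Tv[of s1] z0 nz by (simp add: proj_point_def)
  then have T1: "1 \<le> rat_degree T" by (rule rat_degree_pos[OF T(1)])
  define good where "good = (\<lambda>t. rsquarefree (sec D t) \<and> {s. poly (sec D t) s = 0} = E t \<and>
      card (E t) = ?d \<and> poly f1 t \<noteq> 0)"
  have good: "\<forall>\<^sub>F t in cofinite. good t"
    using g2' eventually_poly_nonzero[OF f10] unfolding good_def by eventually_elim simp
  then have "\<forall>\<^sub>F t in cofinite. \<forall>s. Fin t = Fin s \<longrightarrow> good s" by simp
  then have "\<forall>\<^sub>F x in cofinite. \<forall>s. x = Fin s \<longrightarrow> good s" by (subst (asm) eventually_Fin)
  from eventually_fibre[OF X this]
  have good': "\<forall>\<^sub>F x in cofinite. \<forall>y. X y = X x \<longrightarrow> (\<forall>s. y = Fin s \<longrightarrow> good s)" .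
  have Infty: "\<forall>\<^sub>F x in cofinite. X Infty \<noteq> X x"
    by (rule eventually_pull[OF X]) (use generic_fibre[OF X] in eventually_elim, simp)
  have fibT: "\<forall>\<^sub>F x in cofinite. {s. T s = T x} = {s. X s = X x \<and> Y s = Y x}"
    using good' Infty
  proof eventually_elim
    case (elim x)
    obtain t where x: "x = Fin t" using elim(2) cp1.exhaust by metis
    have gt: "good t" using elim(1) x by blast
    have "T (Fin s) = T (Fin t)" if s: "s \<in> E t" for s
    proof -
      have gs: "good s" using elim(1) s x by (auto simp: E_def)
      \<comment> \<open>Equivalent parameters have sections with the same simple roots, hence
        proportional sections, and the factor cancels in the quotient defining
        \<open>T\<close>.\<close>
      have "E s = E t" using s by (auto simp: E_def)
      then have "poly (sec D s) z = 0 \<longleftrightarrow> poly (sec D t) z = 0" for z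
        using gs gt by (auto simp: good_def)
      then obtain k where k: "k \<noteq> 0" "sec D s = smult k (sec D t)"
        using rsquarefree_same_roots[of "sec D s" "sec D t"] gs gt by (auto simp: good_def)
      have "poly f0 s = k * poly f0 t" "poly f1 s = k * poly f1 t"
        unfolding f0_def f1_def poly_sec[symmetric] k(2) by simp_all
      then show ?thesis using Tv[of s] Tv[of t] gs gt k(1) by (simp add: good_def proj_point_scale)
    qed
    then have sub: "Fin ` E t \<subseteq> {s. T s = T x}" by (auto simp: x)
    have "card {s. T s = T x} \<le> rat_degree T" using fibre_card_le[OF T(1) T1, of "T x"] by blast
    also have "\<dots> \<le> ?d" using T(2) deg by linarith
    also have "?d = card (Fin ` E t)" using gt by (simp add: card_image inj_Fin good_def)
    finally have "card {s. T s = T x} \<le> card (Fin ` E t)" .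
    then have "Fin ` E t = {s. T s = T x}"
      using card_seteq[OF _ sub] fibre_card_le[OF T(1) T1, of "T x"] by blast
    moreover have "{s. X s = X x \<and> Y s = Y x} = Fin ` E t"
    proof (rule Set.set_eqI)
      fix y show "y \<in> {s. X s = X x \<and> Y s = Y x} \<longleftrightarrow> y \<in> Fin ` E t"
        using elim(2) by (cases y) (auto simp: E_def x)
    qed
    ultimately show ?case by simp
  qed
  have "\<forall>\<^sub>F t in cofinite. \<forall>s. T s = T t \<longrightarrow> X s = X t" using fibT by eventually_elim blast
  then obtain X' where X': "rational_fun X'" "X = X' \<circ> T" using descent[OF T(1) T1 X(1)] by blast
  have "\<forall>\<^sub>F t in cofinite. \<forall>s. T s = T t \<longrightarrow> Y s = Y t" using fibT by eventually_elim blast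
  then obtain Y' where Y': "rational_fun Y'" "Y = Y' \<circ> T" using descent[OF T(1) T1 Y] by blast
  have dT: "rat_degree T = 1"
    using nf X' Y' T(1) unfolding no_common_right_factor_def by blast
  show ?thesis using fibT
  proof eventually_elim
    case (elim t)
    have "card {s. T s = T t} \<le> 1" "finite {s. T s = T t}"
      using fibre_card_le[OF T(1) T1, of "T t"] dT by auto
    then have "\<forall>s. T s = T t \<longrightarrow> s = t" by (auto simp: card_le_Suc0_iff_eq)
    then show ?case using elim by blast
  qed
qed

text \<open>Exactly one solution \<open>s\<close> for generic \<open>t\<close> means that the
  eliminant is linear in \<open>s\<close>, say \<open>\<beta>(t) + \<alpha>(t) s\<close>, and its
  root \<open>- \<beta> / \<alpha>\<close> is a rational function of \<open>t\<close>.\<close>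

lemma unique_correspondence_rational:
  assumes X: "rational_fun X" "1 \<le> rat_degree X" and Y: "rational_fun Y" and Z: "rational_fun Z"
    and inj: "\<forall>\<^sub>F t in cofinite. \<forall>s. X s = X t \<and> Y s = Y t \<longrightarrow> s = t"
    and ex: "\<forall>\<^sub>F t in cofinite. \<exists>s. X s = X t \<and> Y s = Z t"
  obtains \<sigma> where "rational_fun \<sigma>" "1 \<le> rat_degree \<sigma>" "X \<circ> \<sigma> = X" "Y \<circ> \<sigma> = Z"
proof -
  obtain D where prim: "\<forall>t. sec D t \<noteq> 0"
    and g2: "\<forall>\<^sub>F t in cofinite. degree (sec D t) = degree D \<and> rsquarefree (sec D t) \<and>
       (\<forall>s. poly (sec D t) s = 0 \<longleftrightarrow> X (Fin s) = X (Fin t) \<and> Y (Fin s) = Z (Fin t))"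
    using elimination[OF X Y Z] by blast
  have Infty: "\<forall>\<^sub>F x in cofinite. X Infty \<noteq> X x"
    by (rule eventually_pull[OF X]) (use generic_fibre[OF X] in eventually_elim, simp)
  have uniq: "\<forall>\<^sub>F x in cofinite. \<exists>s. \<forall>z. X (Fin z) = X x \<and> Y (Fin z) = Z x \<longleftrightarrow> z = s"
    using eventually_fibre[OF X inj] ex Infty
  proof eventually_elim
    case (elim x)
    then obtain y where y: "X y = X x" "Y y = Z x" by blast
    obtain s where s: "y = Fin s" using elim(3) y cp1.exhaust by metis
    have "z = s" if z: "X (Fin z) = X x" "Y (Fin z) = Z x" for z
    proof -
      have "Fin z = y" using elim(1)[rule_format, of y "Fin z"] y z by auto
      then show ?thesis using s by simp
    qed
    moreover have "X (Fin s) = X x" "Y (Fin s) = Z x" using y s by simp_all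
    ultimately have "\<forall>z. X (Fin z) = X x \<and> Y (Fin z) = Z x \<longleftrightarrow> z = s" by blast
    then show ?case ..
  qed
  then have uniq': "\<forall>\<^sub>F t in cofinite. \<exists>s. \<forall>z. X (Fin z) = X (Fin t) \<and> Y (Fin z) = Z (Fin t) \<longleftrightarrow> z = s"
    by (subst eventually_Fin)
  have exc: "\<exists>t. P t" if "\<forall>\<^sub>F t::complex in cofinite. P t" for P
    using eventually_happens'[OF _ that] infinite_UNIV_char_0[where 'a = complex] by simp
  have lin: "\<forall>\<^sub>F t in cofinite. degree (sec D t) = 1 \<and> degree D = 1 \<and>
      (\<forall>s. poly (sec D t) s = 0 \<longrightarrow> X (Fin s) = X (Fin t) \<and> Y (Fin s) = Z (Fin t))"
    using g2 uniq'
  proof eventually_elim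
    case (elim t)
    then obtain s where "\<forall>z. poly (sec D t) z = 0 \<longleftrightarrow> z = s" by auto
    then have "{z. poly (sec D t) z = 0} = {s}" by auto
    then show ?case using card_roots_rsquarefree[of "sec D t"] elim(1) by auto
  qed
  then have d1: "degree D = 1" using exc by blast
  define \<alpha> \<beta> where "\<alpha> = coeff D 1" and "\<beta> = coeff D 0"
  have a0: "\<alpha> \<noteq> 0" using d1 by (metis \<alpha>_def leading_coeff_0_iff degree_0 zero_neq_one)
  have secD: "poly (sec D t) s = poly \<beta> t + poly \<alpha> t * s" for t s
    unfolding poly_sec by (simp add: poly_altdef[of D] d1 \<alpha>_def \<beta>_def mult.commute)
  obtain \<sigma> where \<sigma>: "rational_fun \<sigma>"
    "\<And>z. poly (- \<beta>) z \<noteq> 0 \<or> poly \<alpha> z \<noteq> 0 \<Longrightarrow> \<sigma> (Fin z) = proj_point (poly (- \<beta>) z) (poly \<alpha> z)"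
    using reduce_fraction[OF a0, of "- \<beta>"] by blast
  have "\<forall>\<^sub>F t in cofinite. X (\<sigma> (Fin t)) = X (Fin t) \<and> Y (\<sigma> (Fin t)) = Z (Fin t)"
    using lin eventually_poly_nonzero[OF a0]
  proof eventually_elim
    case (elim t)
    have "\<sigma> (Fin t) = Fin (- poly \<beta> t / poly \<alpha> t)" using \<sigma>(2)[of t] elim(2) by (simp add: proj_point_def)
    moreover have "poly (sec D t) (- poly \<beta> t / poly \<alpha> t) = 0" using elim(2) by (simp add: secD)
    ultimately show ?case using elim(1) by auto
  qed
  then have val: "\<forall>\<^sub>F x in cofinite. X (\<sigma> x) = X x \<and> Y (\<sigma> x) = Z x"
    by (subst (asm) eventually_Fin)
  have d\<sigma>: "1 \<le> rat_degree \<sigma>"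
  proof (rule ccontr)
    assume "\<not> 1 \<le> rat_degree \<sigma>"
    then have "rat_degree \<sigma> = 0" by simp
    then have c: "\<sigma> x = \<sigma> Infty" for x using rational_fun_const[OF \<sigma>(1)] by blast
    have "\<forall>\<^sub>F x in cofinite. X x = X (\<sigma> Infty)" using val by eventually_elim (metis c)
    moreover have "\<forall>\<^sub>F x in cofinite. X x \<noteq> X (\<sigma> Infty)"
      using fibre_card_le[OF X, of "X (\<sigma> Infty)"] by (simp add: eventually_cofinite)
    ultimately have "\<forall>\<^sub>F x::cp1 in cofinite. X x \<noteq> X x" by eventually_elim simp
    then show False using cofinite_cp1_bot by simp
  qed
  have "X \<circ> \<sigma> = X"
    by (rule rational_fun_eqI[OF rational_fun_comp(1)[OF X(1) \<sigma>(1) d\<sigma>] X(1)])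
      (use val cofinite_cp1_bot in \<open>auto intro!: eventually_frequently elim: eventually_mono\<close>)
  moreover have "Y \<circ> \<sigma> = Z"
    by (rule rational_fun_eqI[OF rational_fun_comp(1)[OF Y \<sigma>(1) d\<sigma>] Z])
      (use val cofinite_cp1_bot in \<open>auto intro!: eventually_frequently elim: eventually_mono\<close>)
  ultimately show ?thesis using that \<sigma>(1) d\<sigma> by blast
qed

subsection \<open>Automorphisms of the sphere\<close>

definition mob :: "complex \<Rightarrow> complex \<Rightarrow> complex \<Rightarrow> complex \<Rightarrow> cp1 \<Rightarrow> cp1" where
  "mob a b c d = quot_map [:b, a:] [:d, c:]"

lemma rep_mob:
  assumes "a * d - b * c \<noteq> 0"
  shows "rep (mob a b c d) [:b, a:] [:d, c:] 1"
proof -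
  have nz: "a * x + b * y \<noteq> 0 \<or> c * x + d * y \<noteq> 0" if "x \<noteq> 0 \<or> y \<noteq> 0" for x y
  proof (rule ccontr)
    assume n: "\<not> ?thesis"
    then have "a * x + b * y = 0" "c * x + d * y = 0" by auto
    then have "(a * d - b * c) * x = 0" "(a * d - b * c) * y = 0" by algebra+
    then show False using that assms by auto
  qed
  have q0: "[:d, c:] \<noteq> 0" using assms by auto
  have cop: "coprime [:b, a:] [:d, c:]"
    using nz[of _ 1] by (intro coprimeI_roots) (simp add: algebra_simps)
  have "max (degree [:b, a:]) (degree [:d, c:]) = 1" using assms by auto
  then show ?thesis using cop q0 by (simp add: rep_def mob_def)
qed

lemma mob_proj:
  assumes "a * d - b * c \<noteq> 0" "x \<noteq> 0 \<or> y \<noteq> 0"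
  shows "mob a b c d (proj_point x y) = proj_point (a * x + b * y) (c * x + d * y)"
  using rep_value[OF rep_mob[OF assms(1)] assms(2)] by (simp add: heval_def algebra_simps)

lemma mob_nonzero:
  fixes a b c d x y :: complex
  assumes "a * d - b * c \<noteq> 0" "x \<noteq> 0 \<or> y \<noteq> 0"
  shows "a * x + b * y \<noteq> 0 \<or> c * x + d * y \<noteq> 0"
  using rep_nonzero[OF rep_mob[OF assms(1)] assms(2)] by (simp add: heval_def algebra_simps)

lemma mob_comp:
  assumes "a * d - b * c \<noteq> 0" "a' * d' - b' * c' \<noteq> 0"
  shows "mob a b c d \<circ> mob a' b' c' d' =
    mob (a * a' + b * c') (a * b' + b * d') (c * a' + d * c') (c * b' + d * d')"
proof
  fix x
  have "(a * a' + b * c') * (c * b' + d * d') - (a * b' + b * d') * (c * a' + d * c') =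
      (a * d - b * c) * (a' * d' - b' * c')" by algebra
  then have det: "(a * a' + b * c') * (c * b' + d * d') - (a * b' + b * d') * (c * a' + d * c') \<noteq> 0"
    using assms by simp
  obtain u v where x: "x = proj_point u v" "u \<noteq> 0 \<or> v \<noteq> 0" by (rule cp1_proj_cases)
  show "(mob a b c d \<circ> mob a' b' c' d') x =
      mob (a * a' + b * c') (a * b' + b * d') (c * a' + d * c') (c * b' + d * d') x"
    unfolding x o_def mob_proj[OF assms(2) x(2)] mob_proj[OF assms(1) mob_nonzero[OF assms(2) x(2)]]
      mob_proj[OF det x(2)] by (simp add: algebra_simps)
qed

lemma mob_scale: "k \<noteq> 0 \<Longrightarrow> mob (k * a) (k * b) (k * c) (k * d) = mob a b c d"
proof
  assume k: "k \<noteq> 0"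
  fix x show "mob (k * a) (k * b) (k * c) (k * d) x = mob a b c d x"
  proof (cases x)
    case (Fin z)
    then show ?thesis using k proj_point_scale[OF k, of "b + z * a" "d + z * c"]
      by (simp add: mob_def algebra_simps)
  next
    case Infty
    have deg: "degree [:k * b, k * a:] = degree [:b, a:]" "degree [:k * d, k * c:] = degree [:d, c:]"
      using k by auto
    have cf: "coeff [:k * b, k * a:] n = k * coeff [:b, a:] n" for a b n
      by (auto simp: coeff_pCons split: nat.split)
    show ?thesis using Infty k by (simp add: mob_def deg cf Let_def proj_point_scale del: degree_pCons_eq_if)
  qed
qed

lemma mob_id: "k \<noteq> 0 \<Longrightarrow> mob k 0 0 k = id"
proof
  assume k: "k \<noteq> 0"
  fix x
  obtain u v where x: "x = proj_point u v" "u \<noteq> 0 \<or> v \<noteq> 0" by (rule cp1_proj_cases)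
  show "mob k 0 0 k x = id x"
    unfolding x using mob_proj[of k k 0 0 u v] x(2) k by (simp add: proj_point_scale)
qed

lemma mob_inverse:
  assumes "a * d - b * c \<noteq> 0"
  shows "mob a b c d \<circ> mob d (-b) (-c) a = id" "mob d (-b) (-c) a \<circ> mob a b c d = id"
  using assms mob_comp[of a d b c d a "-b" "-c"] mob_comp[of d a "-b" "-c" a d b c] mob_id[OF assms]
  by (simp_all add: algebra_simps)

lemma rational_mob: "a * d - b * c \<noteq> 0 \<Longrightarrow> rational_fun (mob a b c d)"
  and degree_mob: "a * d - b * c \<noteq> 0 \<Longrightarrow> rat_degree (mob a b c d) = 1"
  using rep_mob rational_fun_rep rat_degree_rep by blast+

lemma moebius_mob: "moebius F \<longleftrightarrow> (\<exists>a b c d. a * d - b * c \<noteq> 0 \<and> F = mob a b c d)"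
  by (simp add: moebius_def mob_def)

lemma degree_one_moebius:
  assumes "rational_fun F" "rat_degree F = 1"
  shows "moebius F"
proof -
  obtain p q where F: "rep F p q 1" using obtain_rep[OF assms(1)] assms(2) by auto
  define a b c d where "a = coeff p 1" and "b = coeff p 0" and "c = coeff q 1" and "d = coeff q 0"
  have p: "p = [:b, a:]" and q: "q = [:d, c:]"
    using rep_degrees[OF F] by (auto intro!: poly_eqI simp: a_def b_def c_def d_def coeff_pCons coeff_eq_0 split: nat.split)
  have "q \<noteq> 0" using F by (simp add: rep_def)
  then have cd: "d \<noteq> 0 \<or> - c \<noteq> 0" using q by auto
  have "a * d - b * c \<noteq> 0"
    using rep_nonzero[OF F cd] by (simp add: p q heval_def algebra_simps)
  then show ?thesis using F by (auto simp: rep_def moebius_def p q)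
qed

lemma id_rational: "rational_fun id"
  using rational_mob[of 1 1 0 0] mob_id[of 1] by simp

lemma inj_degree_one:
  assumes "rational_fun F" "inj F"
  shows "rat_degree F = 1"
proof -
  have "F Infty \<noteq> F (Fin 0)" using assms(2) by (auto dest: injD)
  then have 1: "1 \<le> rat_degree F" by (rule rat_degree_pos[OF assms(1)])
  obtain y where "card {x. F x = y} = rat_degree F"
    using eventually_happens'[OF cofinite_cp1_bot generic_fibre[OF assms(1) 1]] by blast
  moreover obtain x where "F x = y" using rational_fun_surj[OF assms(1) 1] by blast
  then have "{x. F x = y} = {x}" using assms(2) by (auto dest: injD)
  ultimately show ?thesis by simp
qed

lemma Aut_iff_moebius: "F \<in> Aut_cp1 \<longleftrightarrow> moebius F"
proof
  assume "F \<in> Aut_cp1"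
  then obtain s where s: "rational_fun F" "s \<circ> F = id" by (auto simp: Aut_cp1_def)
  then have "inj F" by (metis inj_on_id inj_on_imageI2)
  then show "moebius F" using s(1) inj_degree_one degree_one_moebius by blast
next
  assume "moebius F"
  then obtain a b c d where F: "a * d - b * c \<noteq> 0" "F = mob a b c d" unfolding moebius_mob by blast
  moreover have "d * a - (- b) * (- c) \<noteq> 0" using F(1) by (simp add: algebra_simps)
  ultimately show "F \<in> Aut_cp1"
    unfolding Aut_cp1_def using rational_mob mob_inverse by blast
qed

lemma Aut_mob: "F \<in> Aut_cp1 \<longleftrightarrow> (\<exists>a b c d. a * d - b * c \<noteq> 0 \<and> F = mob a b c d)"
  using Aut_iff_moebius moebius_mob by simp

lemma Aut_rational: "F \<in> Aut_cp1 \<Longrightarrow> rational_fun F"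
  by (simp add: Aut_cp1_def)

lemma Aut_degree: "F \<in> Aut_cp1 \<Longrightarrow> rat_degree F = 1"
  using Aut_mob degree_mob by metis

lemma Aut_comp:
  assumes "F \<in> Aut_cp1" "G \<in> Aut_cp1"
  shows "F \<circ> G \<in> Aut_cp1"
proof -
  obtain F' where F': "rational_fun F'" "F \<circ> F' = id" "F' \<circ> F = id" "rational_fun F"
    using assms(1) by (auto simp: Aut_cp1_def)
  obtain G' where G': "rational_fun G'" "G \<circ> G' = id" "G' \<circ> G = id" "rational_fun G"
    using assms(2) by (auto simp: Aut_cp1_def)
  have "F' \<in> Aut_cp1" using F' by (auto simp: Aut_cp1_def)
  then have "rational_fun (G' \<circ> F')" using rational_fun_comp(1)[OF G'(1) F'(1)] Aut_degree by simp
  moreover have "rational_fun (F \<circ> G)"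
    using rational_fun_comp(1)[OF F'(4) G'(4)] Aut_degree[OF assms(2)] by simp
  moreover have "(F \<circ> G) \<circ> (G' \<circ> F') = id" "(G' \<circ> F') \<circ> (F \<circ> G) = id"
    using F'(2,3) G'(2,3) by (metis comp_assoc comp_id)+
  ultimately show ?thesis unfolding Aut_cp1_def by blast
qed

lemma Aut_id: "id \<in> Aut_cp1"
  using id_rational unfolding Aut_cp1_def by (auto intro!: exI[of _ id])

lemma Aut_inverse:
  assumes "F \<in> Aut_cp1"
  obtains F' where "F' \<in> Aut_cp1" "F \<circ> F' = id" "F' \<circ> F = id"
  using assms unfolding Aut_cp1_def by blast

lemma Aut_bij: "F \<in> Aut_cp1 \<Longrightarrow> bij F"
  by (metis Aut_inverse o_bij)

lemma Aut_inv: 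
  assumes "F \<in> Aut_cp1"
  shows "inv_into UNIV F \<in> Aut_cp1" "F \<circ> inv_into UNIV F = id" "inv_into UNIV F \<circ> F = id"
  using Aut_inverse[OF assms] Aut_bij[OF assms]
  by (metis inv_unique_comp, simp_all add: bij_is_surj bij_is_inj surj_iff[symmetric] inj_iff[symmetric])

lemma Aut_fix_three:
  assumes "F \<in> Aut_cp1" "F Infty = Infty" "F (Fin 0) = Fin 0" "F (Fin 1) = Fin 1"
  shows "F = id"
proof -
  obtain a b c d where F: "a * d - b * c \<noteq> 0" "F = mob a b c d" using assms(1) Aut_mob by blast
  have "proj_point a c = Infty" "proj_point b d = Fin 0" "proj_point (a + b) (c + d) = Fin 1"
    using assms(2-4) mob_proj[OF F(1), of 1 0] mob_proj[OF F(1), of 0 1] mob_proj[OF F(1), of 1 1]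
    by (simp_all add: F(2) Fin_eq_proj Infty_eq_proj)
  then have "c = 0" "b = 0" "a = d" by (auto simp: proj_point_def split: if_splits)
  then show ?thesis using F mob_id[of d] by simp
qed

lemma rational_comp_Aut:
  assumes "rational_fun F" "\<mu> \<in> Aut_cp1"
  shows "rational_fun (F \<circ> \<mu>)" "rat_degree (F \<circ> \<mu>) = rat_degree F"
  using rational_fun_comp[OF assms(1) Aut_rational[OF assms(2)]] Aut_degree[OF assms(2)] by auto

lemma Aut_comp_rational:
  assumes "\<mu> \<in> Aut_cp1" "rational_fun F" "1 \<le> rat_degree F"
  shows "rational_fun (\<mu> \<circ> F)" "rat_degree (\<mu> \<circ> F) = rat_degree F"
  using rational_fun_comp[OF Aut_rational[OF assms(1)] assms(2,3)] Aut_degree[OF assms(1)] by auto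

section \<open>Deck groups\<close>

definition deck :: "(cp1 \<Rightarrow> cp1) \<Rightarrow> (cp1 \<Rightarrow> cp1) set" where
  "deck F = {\<mu> \<in> Aut_cp1. F \<circ> \<mu> = F}"

lemma carrier_deck_group [simp]: "carrier (deck_group F) = deck F"
  and mult_deck_group [simp]: "x \<otimes>\<^bsub>deck_group F\<^esub> y = x \<circ> y"
  by (simp_all add: deck_group_def deck_def)

definition aut_group :: "(cp1 \<Rightarrow> cp1) set \<Rightarrow> bool" where
  "aut_group G \<longleftrightarrow> G \<subseteq> Aut_cp1 \<and> id \<in> G \<and> (\<forall>f\<in>G. \<forall>g\<in>G. f \<circ> g \<in> G) \<and> (\<forall>f\<in>G. inv_into UNIV f \<in> G)"

lemma aut_group_deck: "aut_group (deck F)"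
  unfolding aut_group_def
proof (intro conjI ballI)
  show "deck F \<subseteq> Aut_cp1" by (auto simp: deck_def)
  show "id \<in> deck F" by (simp add: deck_def Aut_id)
  show "f \<circ> g \<in> deck F" if "f \<in> deck F" "g \<in> deck F" for f g
    using that Aut_comp by (auto simp: deck_def comp_assoc[symmetric])
  show "inv_into UNIV f \<in> deck F" if "f \<in> deck F" for f
  proof -
    have f: "f \<in> Aut_cp1" "F \<circ> f = F" using that by (auto simp: deck_def)
    have "F \<circ> inv_into UNIV f = F \<circ> f \<circ> inv_into UNIV f" using f by simp
    also have "\<dots> = F" using Aut_inv(2)[OF f(1)] by (simp add: comp_assoc)
    finally show ?thesis using Aut_inv(1)[OF f(1)] by (simp add: deck_def)
  qed
qed

text \<open>A Moebius transformation is determined by its values at three points, and a deck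
  transformation keeps each of these values in a finite fibre.\<close>

lemma finite_deck:
  assumes "rational_fun F" "1 \<le> rat_degree F"
  shows "finite (deck F)"
proof -
  let ?f = "\<lambda>\<mu> :: cp1 \<Rightarrow> cp1. (\<mu> Infty, \<mu> (Fin 0), \<mu> (Fin 1))"
  have "?f ` deck F \<subseteq> {x. F x = F Infty} \<times> {x. F x = F (Fin 0)} \<times> {x. F x = F (Fin 1)}"
    by (auto simp: deck_def o_def dest: fun_cong)
  moreover have "finite ({x. F x = F Infty} \<times> {x. F x = F (Fin 0)} \<times> {x. F x = F (Fin 1)})"
    using fibre_card_le[OF assms] by auto
  ultimately have fin: "finite (?f ` deck F)" by (rule finite_subset)
  have "inj_on ?f (deck F)"
  proof (rule inj_onI)
    fix \<mu> \<nu> assume m: "\<mu> \<in> deck F" "\<nu> \<in> deck F" and eq: "?f \<mu> = ?f \<nu>"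
    have A: "\<mu> \<in> Aut_cp1" "\<nu> \<in> Aut_cp1" using m by (auto simp: deck_def)
    note b = Aut_inv[OF A(2)]
    have bb: "inv_into UNIV \<nu> (\<nu> x) = x" for x using Aut_bij[OF A(2)] by (simp add: bij_is_inj)
    have "inv_into UNIV \<nu> \<circ> \<mu> = id"
      by (rule Aut_fix_three) (use eq A b bb in \<open>auto intro: Aut_comp\<close>)
    then have "\<nu> \<circ> (inv_into UNIV \<nu> \<circ> \<mu>) = \<nu>" by simp
    then show "\<mu> = \<nu>" using b(2) by (simp add: comp_assoc[symmetric])
  qed
  then show ?thesis using fin finite_imageD by blast
qed

lemma finite_fixed_points:
  assumes "\<mu> \<in> Aut_cp1" "\<mu> \<noteq> id"
  shows "finite {x. \<mu> x = x}"
  using rational_fun_eqI[OF Aut_rational[OF assms(1)] id_rational] assms(2)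
  by (auto simp: frequently_cofinite)

lemma eventually_free:
  assumes "finite G" "aut_group G"
  shows "\<forall>\<^sub>F t in cofinite. \<forall>\<mu>\<in>G. \<mu> t = t \<longrightarrow> \<mu> = id"
proof (rule eventually_ball_finite[OF assms(1)], rule ballI)
  fix \<mu> assume "\<mu> \<in> G"
  then have "\<mu> \<in> Aut_cp1" using assms(2) by (auto simp: aut_group_def)
  then show "\<forall>\<^sub>F t in cofinite. \<mu> t = t \<longrightarrow> \<mu> = id"
    using finite_fixed_points[of \<mu>] by (cases "\<mu> = id") (auto simp: eventually_cofinite)
qed

subsection \<open>The Zariski topology of the fibre product\<close>

text \<open>The Zariski closure.\<close>

definition zcl :: "(cp1 \<times> cp1) set \<Rightarrow> (cp1 \<times> cp1) set" where
  "zcl S = {P. \<forall>m n c. (\<forall>Q\<in>S. bihom_eval m n c Q = 0) \<longrightarrow> bihom_eval m n c P = 0}"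

lemma zariski_closed_zcl: "zariski_closed (zcl S)"
  unfolding zariski_closed_def
  by (rule exI[of _ "{(m, n, c). \<forall>Q\<in>S. bihom_eval m n c Q = 0}"]) (auto simp: zcl_def)

lemma subset_zcl: "S \<subseteq> zcl S"
  by (auto simp: zcl_def)

lemma zcl_least: "zariski_closed Z \<Longrightarrow> S \<subseteq> Z \<Longrightarrow> zcl S \<subseteq> Z"
  unfolding zariski_closed_def zcl_def by fast

text \<open>The coefficients of the product are convolutions; the double sum over exponents is
  swapped inside and collapses to one term. Products of forms are what makes unions of closed sets
  closed.\<close>

lemma biform_mult:
  obtains c where "\<And>x0 x1 y0 y1. biform (m1 + m2) (n1 + n2) c x0 x1 y0 y1 =
    biform m1 n1 c1 x0 x1 y0 y1 * biform m2 n2 c2 x0 x1 y0 y1"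
proof
  fix x0 x1 y0 y1 :: complex
  let ?I = "{..m1} \<times> {..n1}" and ?J = "{..m2} \<times> {..n2}"
  let ?mon = "\<lambda>i j. x0 ^ i * x1 ^ (m1 + m2 - i) * y0 ^ j * y1 ^ (n1 + n2 - j)"
  let ?c = "\<lambda>k l. \<Sum>u\<in>?I. \<Sum>v\<in>?J. if fst u + fst v = k \<and> snd u + snd v = l
      then c1 (fst u) (snd u) * c2 (fst v) (snd v) else 0"
  have "biform (m1 + m2) (n1 + n2) ?c x0 x1 y0 y1 =
      (\<Sum>w\<in>{..m1 + m2} \<times> {..n1 + n2}. \<Sum>u\<in>?I. \<Sum>v\<in>?J. if (fst u + fst v, snd u + snd v) = w
        then c1 (fst u) (snd u) * c2 (fst v) (snd v) * ?mon (fst w) (snd w) else 0)"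
  proof -
    have "?c k l * x0 ^ k * x1 ^ (m1 + m2 - k) * y0 ^ l * y1 ^ (n1 + n2 - l) =
        (\<Sum>u\<in>?I. \<Sum>v\<in>?J. if (fst u + fst v, snd u + snd v) = (k, l)
          then c1 (fst u) (snd u) * c2 (fst v) (snd v) * ?mon k l else 0)" for k l
      unfolding sum_distrib_right by (intro sum.cong refl) (simp add: mult.assoc)
    then show ?thesis
      unfolding biform_def by (simp only: sum.cartesian_product[of _ "{..n1 + n2}" "{..m1 + m2}"] case_prod_unfold prod.collapse)
  qed
  also have "\<dots> = (\<Sum>u\<in>?I. \<Sum>v\<in>?J. \<Sum>w\<in>{..m1 + m2} \<times> {..n1 + n2}. if (fst u + fst v, snd u + snd v) = w
        then c1 (fst u) (snd u) * c2 (fst v) (snd v) * ?mon (fst w) (snd w) else 0)"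
    by (subst sum.swap, rule sum.cong[OF refl], rule sum.swap)
  also have "\<dots> = (\<Sum>u\<in>?I. \<Sum>v\<in>?J. (c1 (fst u) (snd u) * x0 ^ fst u * x1 ^ (m1 - fst u) * y0 ^ snd u * y1 ^ (n1 - snd u)) *
      (c2 (fst v) (snd v) * x0 ^ fst v * x1 ^ (m2 - fst v) * y0 ^ snd v * y1 ^ (n2 - snd v)))"
  proof (intro sum.cong refl)
    fix u v assume "u \<in> ?I" "v \<in> ?J"
    then have le: "fst u \<le> m1" "snd u \<le> n1" "fst v \<le> m2" "snd v \<le> n2" by auto
    have "m1 + m2 - (fst u + fst v) = (m1 - fst u) + (m2 - fst v)"
      "n1 + n2 - (snd u + snd v) = (n1 - snd u) + (n2 - snd v)" using le by auto
    then have mon: "?mon (fst u + fst v) (snd u + snd v) =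
        (x0 ^ fst u * x1 ^ (m1 - fst u) * y0 ^ snd u * y1 ^ (n1 - snd u)) *
        (x0 ^ fst v * x1 ^ (m2 - fst v) * y0 ^ snd v * y1 ^ (n2 - snd v))"
      by (simp only: power_add) (simp add: mult_ac)
    have "(fst u + fst v, snd u + snd v) \<in> {..m1 + m2} \<times> {..n1 + n2}" using le by auto
    then have "(\<Sum>w\<in>{..m1 + m2} \<times> {..n1 + n2}. if (fst u + fst v, snd u + snd v) = w
        then c1 (fst u) (snd u) * c2 (fst v) (snd v) * ?mon (fst w) (snd w) else 0) =
        c1 (fst u) (snd u) * c2 (fst v) (snd v) * ?mon (fst u + fst v) (snd u + snd v)"
      by (subst sum.delta') auto
    also have "\<dots> = (c1 (fst u) (snd u) * x0 ^ fst u * x1 ^ (m1 - fst u) * y0 ^ snd u * y1 ^ (n1 - snd u)) *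
      (c2 (fst v) (snd v) * x0 ^ fst v * x1 ^ (m2 - fst v) * y0 ^ snd v * y1 ^ (n2 - snd v))"
      unfolding mon by (simp add: mult_ac)
    finally show "(\<Sum>w\<in>{..m1 + m2} \<times> {..n1 + n2}. if (fst u + fst v, snd u + snd v) = w
        then c1 (fst u) (snd u) * c2 (fst v) (snd v) * ?mon (fst w) (snd w) else 0) = \<dots>" .
  qed
  also have "\<dots> = biform m1 n1 c1 x0 x1 y0 y1 * biform m2 n2 c2 x0 x1 y0 y1"
    unfolding biform_def sum.cartesian_product sum_product by (simp add: case_prod_unfold)
  finally show "biform (m1 + m2) (n1 + n2) ?c x0 x1 y0 y1 =
    biform m1 n1 c1 x0 x1 y0 y1 * biform m2 n2 c2 x0 x1 y0 y1" .
qed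

lemma bihom_eval_biform:
  "bihom_eval m n c P = biform m n c (fst (hom_coords (fst P))) (snd (hom_coords (fst P)))
     (fst (hom_coords (snd P))) (snd (hom_coords (snd P)))"
  by (simp add: bihom_eval_def biform_def Let_def case_prod_unfold)

lemma zariski_closed_Un:
  assumes "zariski_closed S" "zariski_closed T"
  shows "zariski_closed (S \<union> T)"
proof -
  obtain E where E: "S = {P. \<forall>(m, n, c) \<in> E. bihom_eval m n c P = 0}"
    using assms(1) unfolding zariski_closed_def by blast
  obtain F where F: "T = {P. \<forall>(m, n, c) \<in> F. bihom_eval m n c P = 0}"
    using assms(2) unfolding zariski_closed_def by blast
  have "zcl (S \<union> T) \<subseteq> S \<union> T"
  proof (rule ccontr)
    assume "\<not> ?thesis"
    then obtain P where P: "P \<in> zcl (S \<union> T)" "P \<notin> S" "P \<notin> T" by blast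
    obtain m1 n1 c1 where 1: "(m1, n1, c1) \<in> E" "bihom_eval m1 n1 c1 P \<noteq> 0" using P(2) E by blast
    obtain m2 n2 c2 where 2: "(m2, n2, c2) \<in> F" "bihom_eval m2 n2 c2 P \<noteq> 0" using P(3) F by blast
    obtain c where c: "\<And>x0 x1 y0 y1. biform (m1 + m2) (n1 + n2) c x0 x1 y0 y1 =
        biform m1 n1 c1 x0 x1 y0 y1 * biform m2 n2 c2 x0 x1 y0 y1" using biform_mult by blast
    have prod: "bihom_eval (m1 + m2) (n1 + n2) c Q = bihom_eval m1 n1 c1 Q * bihom_eval m2 n2 c2 Q" for Q
      by (simp add: bihom_eval_biform c)
    have "bihom_eval (m1 + m2) (n1 + n2) c Q = 0" if "Q \<in> S \<union> T" for Q
      using that 1(1) 2(1) E F prod by auto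
    then have "bihom_eval (m1 + m2) (n1 + n2) c P = 0" using P(1) unfolding zcl_def by blast
    then show False using 1(2) 2(2) prod by simp
  qed
  then have "S \<union> T = zcl (S \<union> T)" using subset_zcl by blast
  then show ?thesis using zariski_closed_zcl by metis
qed

lemma zariski_closed_empty: "zariski_closed {}"
  unfolding zariski_closed_def
  by (rule exI[of _ "{(0, 0, \<lambda>_ _. 1)}"]) (auto simp: bihom_eval_def Let_def case_prod_unfold)

lemma irreducible_finite_union:
  assumes "zariski_irreducible S" "finite I" "\<And>i. i \<in> I \<Longrightarrow> zariski_closed (Z i)" "S \<subseteq> (\<Union>i\<in>I. Z i)"
  shows "\<exists>i\<in>I. S \<subseteq> Z i"
proof -
  have "zariski_closed (\<Union>i\<in>I. Z i) \<and> (S \<subseteq> (\<Union>i\<in>I. Z i) \<longrightarrow> (\<exists>i\<in>I. S \<subseteq> Z i))"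
    using assms(2,3)
  proof (induction I rule: finite_induct)
    case empty
    then show ?case using assms(1) by (auto simp: zariski_irreducible_def zariski_closed_empty)
  next
    case (insert i I)
    then have IH: "zariski_closed (\<Union>i\<in>I. Z i)" "S \<subseteq> (\<Union>i\<in>I. Z i) \<longrightarrow> (\<exists>i\<in>I. S \<subseteq> Z i)" by auto
    have ci: "zariski_closed (Z i)" using insert.prems by simp
    have "\<exists>j\<in>insert i I. S \<subseteq> Z j" if "S \<subseteq> (\<Union>j\<in>insert i I. Z j)"
    proof -
      have "S \<subseteq> Z i \<union> (\<Union>i\<in>I. Z i)" using that by simp
      then have "S \<subseteq> Z i \<or> S \<subseteq> (\<Union>i\<in>I. Z i)"
        using assms(1) ci IH(1) unfolding zariski_irreducible_def by blast
      then show ?thesis using IH(2) by blast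
    qed
    then show ?case using zariski_closed_Un[OF ci IH(1)] by simp
  qed
  then show ?thesis using assms(4) by blast
qed

lemma irreducible_zcl: "zariski_irreducible S \<Longrightarrow> zariski_irreducible (zcl S)"
  unfolding zariski_irreducible_def using subset_zcl[of S] zcl_least by (metis order_trans subset_empty)

text \<open>Zorn's lemma applies because the union of a chain of irreducible sets is irreducible:
  two witnesses against containment lie in a common member of the chain. A maximal set is closed,
  since its closure is irreducible and still inside \<open>W\<close>.\<close>

lemma irreducible_in_component:
  assumes "zariski_irreducible S" "S \<subseteq> W" "zariski_closed W"
  shows "\<exists>Z. irreducible_component W Z \<and> S \<subseteq> Z"
proof -
  define F where "F = {T. zariski_irreducible T \<and> S \<subseteq> T \<and> T \<subseteq> W}"
  have "\<exists>M\<in>F. \<forall>X\<in>F. M \<subseteq> X \<longrightarrow> X = M"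
  proof (rule subset_Zorn_nonempty)
    show "F \<noteq> {}" using assms unfolding F_def by blast
    fix C assume C: "C \<noteq> {}" "subset.chain F C"
    then have CF: "C \<subseteq> F" and lin: "\<And>x y. x \<in> C \<Longrightarrow> y \<in> C \<Longrightarrow> x \<subseteq> y \<or> y \<subseteq> x"
      by (auto simp: subset_chain_def)
    have ne: "\<Union>C \<noteq> {}" using C(1) CF unfolding F_def zariski_irreducible_def by blast
    have "\<Union>C \<subseteq> Z1 \<or> \<Union>C \<subseteq> Z2"
      if Z: "zariski_closed Z1" "zariski_closed Z2" "\<Union>C \<subseteq> Z1 \<union> Z2" for Z1 Z2
    proof (rule ccontr)
      assume "\<not> ?thesis"
      then obtain T1 T2 where T: "T1 \<in> C" "\<not> T1 \<subseteq> Z1" "T2 \<in> C" "\<not> T2 \<subseteq> Z2" by blast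
      define T where "T = (if T1 \<subseteq> T2 then T2 else T1)"
      have "T1 \<subseteq> T" "T2 \<subseteq> T" "T \<in> C" using lin[OF T(1) T(3)] T by (auto simp: T_def)
      then have T3: "T \<in> C" "\<not> T \<subseteq> Z1" "\<not> T \<subseteq> Z2" using T by auto
      then have "zariski_irreducible T" "T \<subseteq> Z1 \<union> Z2" using CF Z(3) by (auto simp: F_def)
      then show False using T3 Z unfolding zariski_irreducible_def by blast
    qed
    then have "zariski_irreducible (\<Union>C)" using ne unfolding zariski_irreducible_def by blast
    moreover have "S \<subseteq> \<Union>C" "\<Union>C \<subseteq> W" using C(1) CF unfolding F_def by blast+
    ultimately show "\<Union>C \<in> F" by (simp add: F_def)
  qed
  then obtain M where M: "M \<in> F" "\<And>X. X \<in> F \<Longrightarrow> M \<subseteq> X \<Longrightarrow> X = M" by blast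
  have irr: "zariski_irreducible M" and SM: "S \<subseteq> M" and MW: "M \<subseteq> W" using M(1) by (auto simp: F_def)
  have "zcl M \<in> F"
    using irreducible_zcl[OF irr] zcl_least[OF assms(3) MW] SM subset_zcl[of M] by (auto simp: F_def)
  then have "zcl M = M" using M(2) subset_zcl by blast
  then have "zariski_closed M" using zariski_closed_zcl by metis
  moreover have "Z' = M" if "M \<subseteq> Z'" "Z' \<subseteq> W" "zariski_irreducible Z'" for Z'
    using M(2)[of Z'] that SM by (auto simp: F_def)
  ultimately have "irreducible_component W M" using irr MW unfolding irreducible_component_def by blast
  then show ?thesis using SM by blast
qed

text \<open>A form pulled back to the parameter is either zero or has finitely many roots, so a
  closed set contains the whole curve or finitely many parameter values only. The sphere is not a
  union of two finite sets.\<close>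

lemma irreducible_curve:
  assumes "rational_fun X" "rational_fun Y"
  shows "zariski_irreducible (range (\<lambda>t. (X t, Y t)))"
proof -
  obtain p q where rX: "rep X p q (rat_degree X)" using obtain_rep[OF assms(1)] .
  obtain r w where rY: "rep Y r w (rat_degree Y)" using obtain_rep[OF assms(2)] .
  have dich: "(\<forall>t. (X t, Y t) \<in> Z) \<or> finite {t. (X t, Y t) \<in> Z}" if "zariski_closed Z" for Z
  proof (rule ccontr)
    assume n: "\<not> ?thesis"
    obtain E where E: "Z = {P. \<forall>(m, n, c) \<in> E. bihom_eval m n c P = 0}"
      using \<open>zariski_closed Z\<close> unfolding zariski_closed_def by blast
    obtain t0 where "(X t0, Y t0) \<notin> Z" using n by blast
    then obtain m n c where mnc: "(m, n, c) \<in> E" "bihom_eval m n c (X t0, Y t0) \<noteq> 0" using E by blast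
    let ?H = "pull_poly m n c p q r w" and ?N = "m * rat_degree X + n * rat_degree Y"
    have H0: "?H \<noteq> 0"
    proof
      assume "?H = 0"
      obtain a b where "t0 = proj_point a b" "a \<noteq> 0 \<or> b \<noteq> 0" by (rule cp1_proj_cases)
      then show False using bihom_eval_curve[OF rX rY, of a b m n c] mnc(2) \<open>?H = 0\<close> by simp
    qed
    have dH: "degree ?H \<le> ?N" using degree_pull_poly rep_degrees[OF rX] rep_degrees[OF rY] by auto
    have "{t. (X t, Y t) \<in> Z} \<subseteq> insert Infty (Fin ` {z. poly ?H z = 0})"
    proof
      fix t assume "t \<in> {t. (X t, Y t) \<in> Z}"
      then have v: "bihom_eval m n c (X t, Y t) = 0" using E mnc(1) by auto
      show "t \<in> insert Infty (Fin ` {z. poly ?H z = 0})"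
      proof (cases t)
        case (Fin z)
        then have "heval ?H ?N z 1 = 0"
          using v bihom_eval_curve[OF rX rY, of z 1 m n c] by (simp add: Fin_eq_proj)
        then show ?thesis using Fin dH by (simp add: heval_1)
      qed simp
    qed
    then have "finite {t. (X t, Y t) \<in> Z}"
      by (rule finite_subset) (simp add: poly_roots_finite H0)
    then show False using n by blast
  qed
  show ?thesis
    unfolding zariski_irreducible_def
  proof (intro conjI allI impI)
    fix Z1 Z2 assume Z: "zariski_closed Z1 \<and> zariski_closed Z2 \<and> range (\<lambda>t. (X t, Y t)) \<subseteq> Z1 \<union> Z2"
    then have "UNIV = {t. (X t, Y t) \<in> Z1} \<union> {t. (X t, Y t) \<in> Z2}" by blast
    then have "\<not> finite {t. (X t, Y t) \<in> Z1} \<or> \<not> finite {t. (X t, Y t) \<in> Z2}"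
      using infinite_cp1 by (metis finite_UnI)
    then show "range (\<lambda>t. (X t, Y t)) \<subseteq> Z1 \<or> range (\<lambda>t. (X t, Y t)) \<subseteq> Z2"
      using dich Z by blast
  qed simp
qed

lemma zariski_closed_fiber_product:
  assumes "rational_fun A" "rational_fun B"
  shows "zariski_closed (fiber_product A B)"
proof -
  let ?m = "rat_degree A" and ?n = "rat_degree B"
  obtain p q where rA: "rep A p q ?m" using obtain_rep[OF assms(1)] .
  obtain r w where rB: "rep B r w ?n" using obtain_rep[OF assms(2)] .
  define c where "c = (\<lambda>i j. coeff p i * coeff w j - coeff q i * coeff r j)"
  have form: "biform ?m ?n c x0 x1 y0 y1 =
      heval p ?m x0 x1 * heval w ?n y0 y1 - heval q ?m x0 x1 * heval r ?n y0 y1" for x0 x1 y0 y1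
    unfolding biform_def heval_def c_def sum_product
    by (simp add: sum_subtractf[symmetric] algebra_simps)
  have "bihom_eval ?m ?n c P = 0 \<longleftrightarrow> P \<in> fiber_product A B" for P
  proof -
    obtain a b where a: "fst P = proj_point a b" "a \<noteq> 0 \<or> b \<noteq> 0" by (rule cp1_proj_cases)
    obtain u v where u: "snd P = proj_point u v" "u \<noteq> 0 \<or> v \<noteq> 0" by (rule cp1_proj_cases)
    have P: "P = (proj_point a b, proj_point u v)" using a(1) u(1) by (metis prod.collapse)
    show ?thesis
      unfolding P bihom_eval_proj[OF a(2) u(2)] form fiber_product_def
      using rep_eq_iff[OF rA rB a(2) u(2)] by (simp add: mult.commute)
  qed
  then show ?thesis
    unfolding zariski_closed_def by (intro exI[of _ "{(?m, ?n, c)}"]) auto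
qed

subsection \<open>Good solutions and equivariance\<close>

lemma frequently_pigeonhole:
  assumes "finite I" "\<forall>\<^sub>F t::cp1 in cofinite. \<exists>i\<in>I. P i t"
  shows "\<exists>i\<in>I. \<exists>\<^sub>F t in cofinite. P i t"
proof (rule ccontr)
  assume "\<not> ?thesis"
  then have "\<forall>i\<in>I. \<forall>\<^sub>F t in cofinite. \<not> P i t" unfolding frequently_def by blast
  then have "\<forall>\<^sub>F t in cofinite. \<forall>i\<in>I. \<not> P i t" using assms(1) by (simp add: eventually_ball_finite)
  then have "\<forall>\<^sub>F t::cp1 in cofinite. t \<noteq> t" using assms(2) by eventually_elim blast
  then show False using cofinite_cp1_bot by simp
qed

text \<open>The number of common solutions is generically the degree of the eliminant in
  \<open>s\<close>, so generically there are none or there is always one.\<close>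

lemma correspondence_dichotomy:
  assumes X: "rational_fun X" "1 \<le> rat_degree X" and Y: "rational_fun Y" and Z: "rational_fun Z"
  shows "(\<forall>\<^sub>F t in cofinite. \<exists>s. X s = X t \<and> Y s = Z t) \<or>
    (\<forall>\<^sub>F t in cofinite. \<forall>s. X s = X t \<longrightarrow> Y s \<noteq> Z t)"
proof -
  obtain D where g2: "\<forall>\<^sub>F t in cofinite. degree (sec D t) = degree D \<and> rsquarefree (sec D t) \<and>
       (\<forall>s. poly (sec D t) s = 0 \<longleftrightarrow> X (Fin s) = X (Fin t) \<and> Y (Fin s) = Z (Fin t))"
    using elimination[OF X Y Z] by blast
  have Infty: "\<forall>\<^sub>F x in cofinite. X Infty \<noteq> X x"
    by (rule eventually_pull[OF X]) (use generic_fibre[OF X] in eventually_elim, simp)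
  show ?thesis
  proof (cases "degree D = 0")
    case True
    have "\<forall>\<^sub>F t in cofinite. \<forall>s. X (Fin s) = X (Fin t) \<longrightarrow> Y (Fin s) \<noteq> Z (Fin t)"
      using g2
    proof eventually_elim
      case (elim t)
      then have "degree (sec D t) = 0" using True by simp
      then obtain k where "sec D t = [:k:]" by (rule degree_eq_zeroE)
      then have "\<forall>s. poly (sec D t) s \<noteq> 0" using elim by (auto simp: rsquarefree_def)
      then show ?case using elim by blast
    qed
    then have "\<forall>\<^sub>F x in cofinite. \<forall>s. X (Fin s) = X x \<longrightarrow> Y (Fin s) \<noteq> Z x"
      by (subst (asm) eventually_Fin)
    then have "\<forall>\<^sub>F t in cofinite. \<forall>s. X s = X t \<longrightarrow> Y s \<noteq> Z t"
      using Infty by eventually_elim (metis cp1.exhaust)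
    then show ?thesis ..
  next
    case False
    have "\<forall>\<^sub>F t in cofinite. \<exists>s. X s = X (Fin t) \<and> Y s = Z (Fin t)"
      using g2
    proof eventually_elim
      case (elim t)
      then have "\<not> constant (poly (sec D t))" using False by (simp add: constant_degree)
      then obtain s where "poly (sec D t) s = 0" using fundamental_theorem_of_algebra by blast
      then show ?case using elim by blast
    qed
    then have "\<forall>\<^sub>F x in cofinite. \<exists>s. X s = X x \<and> Y s = Z x" by (subst (asm) eventually_Fin)
    then show ?thesis ..
  qed
qed

lemma aut_group_inv:
  assumes "aut_group G" "f \<in> G"
  shows "inv_into UNIV f \<in> G" "f (inv_into UNIV f x) = x" "inv_into UNIV f (f x) = x" "bij f"
proof -
  have f: "f \<in> Aut_cp1" using assms by (auto simp: aut_group_def)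
  show "bij f" by (rule Aut_bij[OF f])
  then show "f (inv_into UNIV f x) = x" "inv_into UNIV f (f x) = x"
    by (simp_all add: bij_is_surj surj_f_inv_f bij_is_inj)
  show "inv_into UNIV f \<in> G" using assms by (simp add: aut_group_def)
qed

lemma free_orbit_inj:
  assumes "aut_group G" "\<forall>\<mu>\<in>G. \<mu> t = t \<longrightarrow> \<mu> = id"
  shows "inj_on (\<lambda>\<mu>. \<mu> t) G"
proof (rule inj_onI)
  fix \<mu> \<nu> assume m: "\<mu> \<in> G" "\<nu> \<in> G" and eq: "\<mu> t = \<nu> t"
  let ?k = "inv_into UNIV \<nu> \<circ> \<mu>"
  have "?k \<in> G" using assms(1) m by (simp add: aut_group_def)
  moreover have "?k t = t" using eq aut_group_inv(3)[OF assms(1) m(2)] by simp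
  ultimately have "?k = id" using assms(2) by blast
  then show "\<mu> = \<nu>" using aut_group_inv(2)[OF assms(1) m(2)] by (metis comp_apply id_apply ext)
qed

lemma galois_fibre:
  assumes "galois_covering B" "B x = B y"
  obtains \<mu> where "\<mu> \<in> deck B" "\<mu> x = y"
  using assms unfolding galois_covering_def by auto

lemma deck_apply: "\<mu> \<in> deck F \<Longrightarrow> F (\<mu> x) = F x"
  by (auto simp: deck_def o_def dest: fun_cong)

lemma fiber_product_curve_union:
  assumes X: "rational_fun X" "1 \<le> rat_degree X" and AB: "A \<circ> X = B \<circ> Y" and gal: "galois_covering B"
  shows "fiber_product A B = (\<Union>\<mu>\<in>deck B. range (\<lambda>t. (X t, (\<mu> \<circ> Y) t)))"
proof (intro equalityI subsetI)
  fix P assume "P \<in> fiber_product A B"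
  then obtain x y where P: "P = (x, y)" "A x = B y" by (auto simp: fiber_product_def)
  obtain t where t: "X t = x" using rational_fun_surj[OF X] by blast
  have "B (Y t) = B y" using AB P(2) t by (metis comp_apply)
  then obtain \<mu> where "\<mu> \<in> deck B" "\<mu> (Y t) = y" using galois_fibre[OF gal] by blast
  then show "P \<in> (\<Union>\<mu>\<in>deck B. range (\<lambda>t. (X t, (\<mu> \<circ> Y) t)))" using P(1) t by auto
next
  fix P assume "P \<in> (\<Union>\<mu>\<in>deck B. range (\<lambda>t. (X t, (\<mu> \<circ> Y) t)))"
  then obtain \<mu> t where "\<mu> \<in> deck B" "P = (X t, \<mu> (Y t))" by auto
  moreover have "A (X t) = B (Y t)" using AB by (metis comp_apply)
  ultimately show "P \<in> fiber_product A B" by (simp add: fiber_product_def deck_apply)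
qed

lemma bihom_eval_fixed_first:
  "bihom_eval M k c (Fin z, Fin y) = poly (\<Sum>j\<le>k. monom (poly (\<Sum>i\<le>M. monom (c i j) i) z) j) y"
  by (simp add: bihom_eval_def poly_sum poly_monom sum_distrib_right)
    (subst sum.swap, rule refl)

text \<open>If some translate of the curve by the deck group were different from the curve, then the curve
  would have fewer than \<open>|G|\<close> points over a generic \<open>x\<close>, so interpolation would provide a form whose
  degree in \<open>y\<close> is smaller than the number of points of the irreducible fibre product over \<open>x\<close>.\<close>

lemma irreducible_fiber_product_symmetric:
  assumes X: "rational_fun X" "1 \<le> rat_degree X" and Y: "rational_fun Y" "1 \<le> rat_degree Y"
    and A: "rational_fun A" and B: "rational_fun B" "1 \<le> rat_degree B"
    and AB: "A \<circ> X = B \<circ> Y" and gal: "galois_covering B"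
    and comp: "\<exists>!Z. irreducible_component (fiber_product A B) Z" and \<mu>: "\<mu> \<in> deck B"
  shows "\<forall>\<^sub>F t in cofinite. \<exists>s. X s = X t \<and> Y s = \<mu> (Y t)"
proof (rule ccontr)
  let ?W = "fiber_product A B"
  let ?C = "\<lambda>\<mu>. range (\<lambda>t. (X t, (\<mu> \<circ> Y) t))"
  define G where "G = deck B"
  have G: "finite G" "aut_group G" unfolding G_def using finite_deck[OF B] aut_group_deck by auto
  have GA: "\<mu> \<in> Aut_cp1" if "\<mu> \<in> G" for \<mu> using that by (simp add: G_def deck_def)
  have ratY: "rational_fun (\<mu> \<circ> Y)" if "\<mu> \<in> G" for \<mu>
    using Aut_comp_rational(1)[OF GA[OF that] Y] .
  have W: "?W = (\<Union>\<mu>\<in>G. ?C \<mu>)"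
    unfolding G_def by (rule fiber_product_curve_union[OF X AB gal])
  have closedW: "zariski_closed ?W" by (rule zariski_closed_fiber_product[OF A B(1)])
  obtain Z where Z: "irreducible_component ?W Z" "\<And>Z'. irreducible_component ?W Z' \<Longrightarrow> Z' = Z"
    using comp by blast
  \<comment> \<open>Each translate is irreducible and lies in some component, hence in the only one.
    The fibre product is therefore that component, and being irreducible it lies in the closure of a
    single translate.\<close>
  have "?C \<mu> \<subseteq> Z" if "\<mu> \<in> G" for \<mu>
    using irreducible_in_component[OF irreducible_curve[OF X(1) ratY[OF that]] _ closedW] Z(2) W that by blast
  then have "?W \<subseteq> Z" using W by blast
  then have "Z = ?W" using Z(1) by (auto simp: irreducible_component_def)
  then have irrW: "zariski_irreducible ?W" using Z(1) by (simp add: irreducible_component_def)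
  have "?W \<subseteq> (\<Union>\<mu>\<in>G. zcl (?C \<mu>))" unfolding W using subset_zcl by (intro UN_mono) auto
  then obtain \<mu>0 where \<mu>0: "\<mu>0 \<in> G" "?W \<subseteq> zcl (?C \<mu>0)"
    using irreducible_finite_union[OF irrW G(1), of "\<lambda>\<mu>. zcl (?C \<mu>)"] zariski_closed_zcl by blast
  \<comment> \<open>The deck transformations that map the curve to itself generically. By the
    dichotomy the others generically never join two of its points over the same
    \<open>x\<close>.\<close>
  define G0 where "G0 = {\<mu>\<in>G. \<forall>\<^sub>F t in cofinite. \<exists>s. X s = X t \<and> Y s = \<mu> (Y t)}"
  assume "\<not> ?thesis"
  then have "\<mu> \<notin> G0" unfolding G0_def by blast
  moreover have "G0 \<subseteq> G" "\<mu> \<in> G" using \<mu> by (auto simp: G0_def G_def)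
  ultimately have "G0 \<subset> G" by blast
  then have card: "card G0 < card G" using G(1) psubset_card_mono by blast
  have finG0: "finite G0" using G(1) by (simp add: G0_def)
  have "\<forall>\<^sub>F t in cofinite. \<forall>\<mu>\<in>G - G0. \<forall>s. X s = X t \<longrightarrow> Y s \<noteq> \<mu> (Y t)"
  proof (intro eventually_ball_finite ballI)
    fix \<nu> assume \<nu>: "\<nu> \<in> G - G0"
    show "\<forall>\<^sub>F t in cofinite. \<forall>s. X s = X t \<longrightarrow> Y s \<noteq> \<nu> (Y t)"
      using correspondence_dichotomy[OF X Y(1) ratY[of \<nu>]] \<nu> unfolding G0_def comp_def by blast
  qed (use G(1) in simp)
  then have few: "\<forall>\<^sub>F t in cofinite. \<forall>s. X s = X t \<longrightarrow> Y s \<in> (\<lambda>\<mu>. \<mu> (Y t)) ` G0"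
  proof eventually_elim
    case (elim t)
    show ?case
    proof (intro allI impI)
      fix s assume s: "X s = X t"
      have "B (Y t) = B (Y s)" using AB s by (metis comp_apply)
      then obtain \<nu> where \<nu>: "\<nu> \<in> G" "\<nu> (Y t) = Y s" using galois_fibre[OF gal] unfolding G_def by blast
      then have "\<nu> \<in> G0" using elim[rule_format, of \<nu> s] s by force
      then show "Y s \<in> (\<lambda>\<mu>. \<mu> (Y t)) ` G0" using \<nu>(2) by (metis imageI)
    qed
  qed
  have "\<forall>\<^sub>F x in cofinite. \<exists>S. finite S \<and> card S \<le> card G0 \<and> (\<forall>t. X t = x \<longrightarrow> (\<mu>0 \<circ> Y) t \<in> S)"
    using eventually_push[OF few, of X]
  proof eventually_elim
    case (elim x)
    obtain t where t: "X t = x" using rational_fun_surj[OF X] by blast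
    \<comment> \<open>The interpolation uses the translate by \<open>\<mu>0\<close>, the one whose
      closure contains the fibre product; applying \<open>\<mu>0\<close> does not increase the
      number of points over \<open>x\<close>.\<close>
    let ?S = "\<mu>0 ` (\<lambda>\<mu>. \<mu> (Y t)) ` G0"
    have "card ?S \<le> card G0" using finG0 by (meson card_image_le finite_imageI le_trans)
    moreover have "\<forall>t'. X t' = x \<longrightarrow> (\<mu>0 \<circ> Y) t' \<in> ?S"
      using elim[rule_format, OF t] t by auto
    ultimately show ?case using finG0 by (intro exI[of _ ?S]) auto
  qed
  from interpolation[OF X ratY[OF \<mu>0(1)] this] obtain M c where
    c: "\<exists>i\<le>M. \<exists>j\<le>card G0. c i j \<noteq> 0" "\<forall>t. bihom_eval M (card G0) c (X t, (\<mu>0 \<circ> Y) t) = 0" by blast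
  have "\<forall>Q\<in>?C \<mu>0. bihom_eval M (card G0) c Q = 0" using c(2) by blast
  then have van: "bihom_eval M (card G0) c P = 0" if "P \<in> ?W" for P
    using \<mu>0(2) that unfolding zcl_def by blast
  have free: "\<forall>\<^sub>F t in cofinite. \<forall>\<mu>\<in>G. \<mu> (Y t) = Y t \<longrightarrow> \<mu> = id"
    by (rule eventually_pull[OF Y eventually_free[OF G]])
  have fin: "\<forall>\<^sub>F t in cofinite. \<forall>\<mu>\<in>G. \<mu> (Y t) \<noteq> Infty"
    using eventually_ne_Infty[OF ratY] G(1) by (intro eventually_ball_finite) auto
  have "\<forall>\<^sub>F t in cofinite. \<forall>z. X t = Fin z \<longrightarrow> (\<forall>j\<le>card G0. poly (\<Sum>i\<le>M. monom (c i j) i) z = 0)"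
    using free fin
  proof eventually_elim
    case (elim t)
    show ?case
    proof (intro allI impI)
      fix z j assume z: "X t = Fin z" and j: "j \<le> card G0"
      define h where "h = (\<Sum>j\<le>card G0. monom (poly (\<Sum>i\<le>M. monom (c i j) i) z) j)"
      have dh: "degree h \<le> card G0"
        unfolding h_def by (intro degree_sum_le) (auto intro: le_trans[OF degree_monom_le])
      have sub: "(\<lambda>\<mu>. \<mu> (Y t)) ` G \<subseteq> Fin ` {y. poly h y = 0}"
      proof
        fix P assume "P \<in> (\<lambda>\<mu>. \<mu> (Y t)) ` G"
        then obtain \<nu> where \<nu>: "\<nu> \<in> G" "P = \<nu> (Y t)" by blast
        then obtain y where y: "\<nu> (Y t) = Fin y" using elim(2) cp1.exhaust by metis
        have "(X t, (\<nu> \<circ> Y) t) \<in> ?W" using \<nu>(1) unfolding W by blast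
        then have "bihom_eval M (card G0) c (X t, \<nu> (Y t)) = 0" using van by auto
        then have "poly h y = 0" unfolding z y bihom_eval_fixed_first h_def .
        then show "P \<in> Fin ` {y. poly h y = 0}" using \<nu>(2) y by auto
      qed
      have "h = 0"
      proof (rule ccontr)
        assume h0: "h \<noteq> 0"
        have "card G = card ((\<lambda>\<mu>. \<mu> (Y t)) ` G)"
          using free_orbit_inj[OF G(2) elim(1)] by (simp add: card_image)
        also have "\<dots> \<le> card (Fin ` {y. poly h y = 0})"
          by (rule card_mono[OF _ sub]) (simp add: poly_roots_finite h0)
        also have "\<dots> \<le> degree h" using card_poly_roots_bound[OF h0] by (simp add: card_image inj_Fin)
        finally show False using dh card by simp
      qed
      moreover have "coeff h j = poly (\<Sum>i\<le>M. monom (c i j) i) z"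
        using j by (simp add: h_def coeff_sum)
      ultimately show "poly (\<Sum>i\<le>M. monom (c i j) i) z = 0" by simp
    qed
  qed
  from eventually_push[OF this, of X]
  have "\<forall>\<^sub>F x in cofinite. \<forall>z. x = Fin z \<longrightarrow> (\<forall>j\<le>card G0. poly (\<Sum>i\<le>M. monom (c i j) i) z = 0)"
    by eventually_elim (metis rational_fun_surj[OF X])
  then have zero: "\<forall>\<^sub>F z in cofinite. \<forall>j\<le>card G0. poly (\<Sum>i\<le>M. monom (c i j) i) z = 0"
    using eventually_Fin[of "\<lambda>x. \<forall>z. x = Fin z \<longrightarrow> (\<forall>j\<le>card G0. poly (\<Sum>i\<le>M. monom (c i j) i) z = 0)"]
    by simp
  obtain i j where ij: "i \<le> M" "j \<le> card G0" "c i j \<noteq> 0" using c(1) by blast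
  have "coeff (\<Sum>i\<le>M. monom (c i j) i) i = c i j" using ij(1) by (simp add: coeff_sum)
  then have "(\<Sum>i\<le>M. monom (c i j) i) \<noteq> 0" using ij(3) by (metis coeff_0)
  from eventually_poly_nonzero[OF this] zero
  have "\<forall>\<^sub>F z::complex in cofinite. z \<noteq> z" by eventually_elim (use ij(2) in auto)
  then show False using infinite_UNIV_char_0[where 'a = complex] by (simp add: eventually_cofinite)
qed

text \<open>Everything follows from uniqueness: maps with the same compositions with
  \<open>X\<close> and with \<open>Y\<close> agree by generic injectivity (\<open>eqI\<close>). So
  the lifts of a product and of the identity are the expected ones, and the lifts are invertible.
  For surjectivity, a deck transformation of \<open>X\<close> agrees at each generic point with one
  of finitely many lifts, hence with one fixed lift infinitely often.\<close>

lemma deck_group_isomorphism: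
  assumes X: "rational_fun X" "1 \<le> rat_degree X" and Y: "rational_fun Y" "1 \<le> rat_degree Y"
    and B: "rational_fun B" "1 \<le> rat_degree B"
    and AB: "A \<circ> X = B \<circ> Y" and gal: "galois_covering B"
    and nf: "no_common_right_factor X Y"
    and sym: "\<And>\<mu>. \<mu> \<in> deck B \<Longrightarrow> \<forall>\<^sub>F t in cofinite. \<exists>s. X s = X t \<and> Y s = \<mu> (Y t)"
  obtains \<psi> where "bij_betw \<psi> (deck B) (deck X)"
    "\<And>\<mu> \<nu>. \<mu> \<in> deck B \<Longrightarrow> \<nu> \<in> deck B \<Longrightarrow> \<psi> (\<mu> \<circ> \<nu>) = \<psi> \<mu> \<circ> \<psi> \<nu>"
    "\<And>\<mu>. \<mu> \<in> deck B \<Longrightarrow> Y \<circ> \<psi> \<mu> = \<mu> \<circ> Y"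
    "\<forall>\<^sub>F t in cofinite. \<forall>s. X s = X t \<longrightarrow> (\<exists>\<tau>\<in>deck X. \<tau> t = s)"
proof -
  have inj: "\<forall>\<^sub>F t in cofinite. \<forall>s. X s = X t \<and> Y s = Y t \<longrightarrow> s = t"
    by (rule generically_injective[OF X Y(1) nf])
  have G: "finite (deck B)" "aut_group (deck B)" using finite_deck[OF B] aut_group_deck by auto
  have eqI: "\<sigma> = \<tau>" if \<sigma>: "rational_fun \<sigma>" and \<tau>: "rational_fun \<tau>" "1 \<le> rat_degree \<tau>"
    and "X \<circ> \<sigma> = X \<circ> \<tau>" "Y \<circ> \<sigma> = Y \<circ> \<tau>" for \<sigma> \<tau>
  proof (rule rational_fun_eqI[OF \<sigma> \<tau>(1)], rule eventually_frequently[OF cofinite_cp1_bot])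
    show "\<forall>\<^sub>F t in cofinite. \<sigma> t = \<tau> t"
      using eventually_pull[OF \<tau> inj] by eventually_elim (use that(4,5) in \<open>metis comp_apply\<close>)
  qed
  have "\<exists>\<sigma>. rational_fun \<sigma> \<and> 1 \<le> rat_degree \<sigma> \<and> X \<circ> \<sigma> = X \<and> Y \<circ> \<sigma> = \<mu> \<circ> Y" if "\<mu> \<in> deck B" for \<mu>
  proof -
    have "\<mu> \<in> Aut_cp1" using that by (simp add: deck_def)
    then have r: "rational_fun (\<mu> \<circ> Y)" using Aut_comp_rational(1) Y by blast
    have e: "\<forall>\<^sub>F t in cofinite. \<exists>s. X s = X t \<and> Y s = (\<mu> \<circ> Y) t" using sym[OF that] by simp
    show ?thesis using unique_correspondence_rational[OF X Y(1) r inj e] by blast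
  qed
  then obtain \<psi> where \<psi>: "\<And>\<mu>. \<mu> \<in> deck B \<Longrightarrow> rational_fun (\<psi> \<mu>) \<and> 1 \<le> rat_degree (\<psi> \<mu>) \<and>
      X \<circ> \<psi> \<mu> = X \<and> Y \<circ> \<psi> \<mu> = \<mu> \<circ> Y" by metis
  have clos: "\<mu> \<circ> \<nu> \<in> deck B" if "\<mu> \<in> deck B" "\<nu> \<in> deck B" for \<mu> \<nu>
    using that G(2) by (simp add: aut_group_def)
  have hom: "\<psi> (\<mu> \<circ> \<nu>) = \<psi> \<mu> \<circ> \<psi> \<nu>" if m: "\<mu> \<in> deck B" "\<nu> \<in> deck B" for \<mu> \<nu>
  proof (rule eqI)
    note p = \<psi>[OF m(1)] \<psi>[OF m(2)] \<psi>[OF clos[OF m]]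
    show "rational_fun (\<psi> (\<mu> \<circ> \<nu>))" using p by blast
    show "rational_fun (\<psi> \<mu> \<circ> \<psi> \<nu>)" "1 \<le> rat_degree (\<psi> \<mu> \<circ> \<psi> \<nu>)"
      using rational_fun_comp[of "\<psi> \<mu>" "\<psi> \<nu>"] p by auto
    show "X \<circ> \<psi> (\<mu> \<circ> \<nu>) = X \<circ> (\<psi> \<mu> \<circ> \<psi> \<nu>)" using p by (metis comp_assoc)
    show "Y \<circ> \<psi> (\<mu> \<circ> \<nu>) = Y \<circ> (\<psi> \<mu> \<circ> \<psi> \<nu>)" using p by (metis comp_assoc)
  qed
  have idB: "id \<in> deck B" using G(2) by (simp add: aut_group_def)
  have id: "\<psi> id = id"
  proof (rule eqI)
    have "rat_degree (id :: cp1 \<Rightarrow> cp1) = 1" by (rule inj_degree_one[OF id_rational]) simp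
    then show "1 \<le> rat_degree (id :: cp1 \<Rightarrow> cp1)" by simp
  qed (use \<psi>[OF idB] id_rational in auto)
  have memb: "\<psi> \<mu> \<in> deck X" if m: "\<mu> \<in> deck B" for \<mu>
  proof -
    note i = aut_group_inv[OF G(2) m]
    have "\<mu> \<circ> inv_into UNIV \<mu> = id" "inv_into UNIV \<mu> \<circ> \<mu> = id" using i by auto
    then have "\<psi> \<mu> \<circ> \<psi> (inv_into UNIV \<mu>) = id" "\<psi> (inv_into UNIV \<mu>) \<circ> \<psi> \<mu> = id"
      using hom[OF m i(1)] hom[OF i(1) m] id by auto
    then have "\<psi> \<mu> \<in> Aut_cp1" using \<psi>[OF m] \<psi>[OF i(1)] unfolding Aut_cp1_def by blast
    then show ?thesis using \<psi>[OF m] by (simp add: deck_def)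
  qed
  have injpsi: "inj_on \<psi> (deck B)"
  proof (rule inj_onI)
    fix \<mu> \<nu> assume m: "\<mu> \<in> deck B" "\<nu> \<in> deck B" "\<psi> \<mu> = \<psi> \<nu>"
    then have "\<mu> \<circ> Y = \<nu> \<circ> Y" using \<psi> by metis
    then show "\<mu> = \<nu>" using rational_fun_surj[OF Y] by (metis comp_apply ext)
  qed
  have fib: "\<forall>\<^sub>F t in cofinite. \<forall>s. X s = X t \<longrightarrow> (\<exists>\<mu>\<in>deck B. \<psi> \<mu> t = s)"
    using eventually_fibre[OF X inj]
  proof eventually_elim
    case (elim t)
    show ?case
    proof (intro allI impI)
      fix s assume s: "X s = X t"
      have "B (Y t) = B (Y s)" using AB s by (metis comp_apply)
      then obtain \<mu> where m: "\<mu> \<in> deck B" "\<mu> (Y t) = Y s" using galois_fibre[OF gal] by blast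
      have "X (\<psi> \<mu> t) = X s" "Y (\<psi> \<mu> t) = Y s" using \<psi>[OF m(1)] m(2) s by (metis comp_apply)+
      then have "\<psi> \<mu> t = s" using elim s by metis
      then show "\<exists>\<mu>\<in>deck B. \<psi> \<mu> t = s" using m(1) by blast
    qed
  qed
  have "\<tau> \<in> \<psi> ` deck B" if \<tau>: "\<tau> \<in> deck X" for \<tau>
  proof -
    have "\<forall>\<^sub>F t in cofinite. \<exists>\<mu>\<in>deck B. \<tau> t = \<psi> \<mu> t"
      using fib by eventually_elim (metis deck_apply[OF \<tau>])
    then obtain \<mu> where m: "\<mu> \<in> deck B" "\<exists>\<^sub>F t in cofinite. \<tau> t = \<psi> \<mu> t"
      using frequently_pigeonhole[OF G(1), of "\<lambda>\<mu> t. \<tau> t = \<psi> \<mu> t"] by blast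
    have "rational_fun \<tau>" using \<tau> Aut_rational by (simp add: deck_def)
    then have "\<tau> = \<psi> \<mu>" using rational_fun_eqI[OF _ _ m(2)] \<psi>[OF m(1)] by blast
    then show ?thesis using m(1) by blast
  qed
  then have "bij_betw \<psi> (deck B) (deck X)" using injpsi memb by (auto simp: bij_betw_def)
  moreover have "\<forall>\<^sub>F t in cofinite. \<forall>s. X s = X t \<longrightarrow> (\<exists>\<tau>\<in>deck X. \<tau> t = s)"
    using fib by eventually_elim (metis memb)
  ultimately show ?thesis using that hom \<psi> by metis
qed

lemma Aut_inv_apply:
  assumes "F \<in> Aut_cp1"
  shows "F (inv_into UNIV F x) = x" "inv_into UNIV F (F x) = x"
  using Aut_inv(2,3)[OF assms] by (metis comp_apply id_apply)+

lemma diagram_of_conjugacy: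
  assumes X: "rational_fun X" "1 \<le> rat_degree X" and Y: "rational_fun Y" "1 \<le> rat_degree Y"
    and A: "rational_fun A" "1 \<le> rat_degree A" and B: "rational_fun B" "1 \<le> rat_degree B"
    and AB: "A \<circ> X = B \<circ> Y" and gal: "galois_covering B"
    and \<psi>: "bij_betw \<psi> (deck B) (deck X)"
    and hom: "\<And>\<mu> \<nu>. \<mu> \<in> deck B \<Longrightarrow> \<nu> \<in> deck B \<Longrightarrow> \<psi> (\<mu> \<circ> \<nu>) = \<psi> \<mu> \<circ> \<psi> \<nu>"
    and equi: "\<And>\<mu>. \<mu> \<in> deck B \<Longrightarrow> Y \<circ> \<psi> \<mu> = \<mu> \<circ> Y"
    and fib: "\<forall>\<^sub>F t in cofinite. \<forall>s. X s = X t \<longrightarrow> (\<exists>\<tau>\<in>deck X. \<tau> t = s)"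
    and \<eta>: "\<eta> \<in> Aut_cp1" and conj: "deck B = (\<lambda>\<sigma>. \<eta> \<circ> \<sigma> \<circ> inv_into UNIV \<eta>) ` deck X"
  shows "\<exists>\<eta> \<nu> V C. moebius \<eta> \<and> moebius \<nu> \<and> rational_fun V \<and> rational_fun C \<and>
       X \<circ> V = C \<circ> X \<and> B \<circ> \<eta> = \<nu> \<circ> X \<and> Y = \<eta> \<circ> V \<and> A = \<nu> \<circ> C \<and> equivariant X V"
proof -
  let ?i = "inv_into UNIV \<eta>"
  note ei = Aut_inv[OF \<eta>] and ea = Aut_inv_apply[OF \<eta>]
  note BE = rational_comp_Aut[OF B(1) \<eta>]
  have "\<forall>\<^sub>F t in cofinite. \<forall>s. X s = X t \<longrightarrow> (B \<circ> \<eta>) s = (B \<circ> \<eta>) t"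
    using fib
  proof eventually_elim
    case (elim t)
    show ?case
    proof (intro allI impI)
      fix s assume "X s = X t"
      then obtain \<tau> where \<tau>: "\<tau> \<in> deck X" "\<tau> t = s" using elim by blast
      then have "\<eta> \<circ> \<tau> \<circ> ?i \<in> deck B" unfolding conj by blast
      from deck_apply[OF this, of "\<eta> t"] show "(B \<circ> \<eta>) s = (B \<circ> \<eta>) t" using \<tau>(2) ea by simp
    qed
  qed
  then obtain \<nu> where \<nu>: "rational_fun \<nu>" "B \<circ> \<eta> = \<nu> \<circ> X" using descent[OF X BE(1)] by blast
  have Xc: "X s = X t" if "(B \<circ> \<eta>) s = (B \<circ> \<eta>) t" for s t
  proof -
    obtain \<mu> where "\<mu> \<in> deck B" "\<mu> (\<eta> t) = \<eta> s" using galois_fibre[OF gal, of "\<eta> t" "\<eta> s"] \<open>(B \<circ> \<eta>) s = _\<close> by auto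
    then obtain \<tau> where \<tau>: "\<tau> \<in> deck X" "\<eta> (\<tau> t) = \<eta> s" unfolding conj using ea by auto
    then have "\<tau> t = s" by (metis ea(2))
    then show "X s = X t" using deck_apply[OF \<tau>(1)] by metis
  qed
  have "\<forall>\<^sub>F t in cofinite. \<forall>s. (B \<circ> \<eta>) s = (B \<circ> \<eta>) t \<longrightarrow> X s = X t"
    using Xc by (intro always_eventually allI impI)
  moreover have "1 \<le> rat_degree (B \<circ> \<eta>)" using BE(2) B(2) by simp
  ultimately obtain \<nu>' where \<nu>': "rational_fun \<nu>'" "X = \<nu>' \<circ> (B \<circ> \<eta>)"
    using descent[OF BE(1) _ X(1)] by blast
  \<comment> \<open>\<open>X\<close> and \<open>B \<circ> \<eta>\<close> factor through each other,
    so comparing degrees leaves degree one for both outer factors.\<close>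
  have "rat_degree X = rat_degree \<nu>' * rat_degree B"
    using rational_fun_comp(2)[OF \<nu>'(1) BE(1)] BE(2) B(2) \<nu>'(2) by simp
  moreover have "rat_degree B = rat_degree \<nu> * rat_degree X"
    using rational_fun_comp(2)[OF \<nu>(1) X] BE(2) \<nu>(2) by simp
  ultimately have "rat_degree X = (rat_degree \<nu>' * rat_degree \<nu>) * rat_degree X" by simp
  then have "rat_degree \<nu>' * rat_degree \<nu> = 1" using X(2) by simp
  then have "moebius \<nu>" using degree_one_moebius[OF \<nu>(1)] by simp
  then have \<nu>A: "\<nu> \<in> Aut_cp1" by (simp add: Aut_iff_moebius)
  note ni = Aut_inv[OF \<nu>A] and na = Aut_inv_apply[OF \<nu>A]
  define V C where "V = ?i \<circ> Y" and "C = inv_into UNIV \<nu> \<circ> A"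
  have ratV: "rational_fun V" "rational_fun C"
    unfolding V_def C_def using Aut_comp_rational(1) ei ni Y A by auto
  have YV: "Y = \<eta> \<circ> V" and AC: "A = \<nu> \<circ> C" unfolding V_def C_def using ea na by auto
  have "\<nu> (X (V t)) = \<nu> (C (X t))" for t
    using \<nu>(2) YV AC AB by (metis comp_apply)
  then have XV: "X \<circ> V = C \<circ> X" by (auto simp: fun_eq_iff) (metis na(2))
  \<comment> \<open>A deck transformation of \<open>X\<close> is sent to \<open>deck B\<close> by
    the inverse of \<open>\<psi>\<close> and brought back by conjugation with \<open>\<eta>\<close>.
    The result need not be the original transformation.\<close>
  define \<phi> where "\<phi> = (\<lambda>\<sigma>. ?i \<circ> inv_into (deck B) \<psi> \<sigma> \<circ> \<eta>)"
  have conj': "bij_betw (\<lambda>\<mu>. ?i \<circ> \<mu> \<circ> \<eta>) (deck B) (deck X)"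
  proof (rule bij_betwI[where g = "\<lambda>\<sigma>. \<eta> \<circ> \<sigma> \<circ> ?i"])
    have cancel: "?i \<circ> (\<eta> \<circ> \<sigma> \<circ> ?i) \<circ> \<eta> = \<sigma>" "\<eta> \<circ> (?i \<circ> \<sigma> \<circ> \<eta>) \<circ> ?i = \<sigma>" for \<sigma>
      by (auto simp: ea)
    show "(\<lambda>\<mu>. ?i \<circ> \<mu> \<circ> \<eta>) \<in> deck B \<rightarrow> deck X" unfolding conj using cancel(1) by auto
    show "(\<lambda>\<sigma>. \<eta> \<circ> \<sigma> \<circ> ?i) \<in> deck X \<rightarrow> deck B" unfolding conj by auto
    show "\<eta> \<circ> (?i \<circ> \<sigma> \<circ> \<eta>) \<circ> ?i = \<sigma>" "?i \<circ> (\<eta> \<circ> \<sigma> \<circ> ?i) \<circ> \<eta> = \<sigma>" for \<sigma> by (rule cancel)+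
  qed
  have bij\<phi>: "bij_betw \<phi> (deck X) (deck X)"
    using bij_betw_trans[OF bij_betw_inv_into[OF \<psi>] conj'] by (simp add: \<phi>_def o_def)
  have psi_inv: "inv_into (deck B) \<psi> \<sigma> \<in> deck B" "\<psi> (inv_into (deck B) \<psi> \<sigma>) = \<sigma>" if "\<sigma> \<in> deck X" for \<sigma>
    using that \<psi> by (metis bij_betw_def inv_into_into, metis bij_betw_inv_into_right)
  have clos: "\<sigma> \<circ> \<tau> \<in> deck F" if "\<sigma> \<in> deck F" "\<tau> \<in> deck F" for \<sigma> \<tau> F
    using that aut_group_deck[of F] by (simp add: aut_group_def)
  have hom\<phi>: "\<phi> (\<sigma> \<circ> \<tau>) = \<phi> \<sigma> \<circ> \<phi> \<tau>" if s: "\<sigma> \<in> deck X" "\<tau> \<in> deck X" for \<sigma> \<tau>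
  proof -
    let ?j = "inv_into (deck B) \<psi>"
    have "\<psi> (?j \<sigma> \<circ> ?j \<tau>) = \<sigma> \<circ> \<tau>" using hom psi_inv s by simp
    then have "?j (\<sigma> \<circ> \<tau>) = ?j \<sigma> \<circ> ?j \<tau>"
      using clos psi_inv s \<psi> by (metis bij_betw_inv_into_left)
    then show ?thesis by (auto simp: \<phi>_def ea)
  qed
  have "V \<circ> \<sigma> = \<phi> \<sigma> \<circ> V" if s: "\<sigma> \<in> deck X" for \<sigma>
  proof -
    have "Y \<circ> \<sigma> = inv_into (deck B) \<psi> \<sigma> \<circ> Y" using equi[OF psi_inv(1)[OF s]] psi_inv(2)[OF s] by simp
    then have "Y (\<sigma> t) = inv_into (deck B) \<psi> \<sigma> (Y t)" for t by (metis comp_apply)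
    then show ?thesis by (auto simp: V_def \<phi>_def ea)
  qed
  then have "equivariant X V"
    unfolding equivariant_def using bij\<phi> hom\<phi>
    by (intro bexI[of _ \<phi>]) (auto simp: iso_def hom_def dest: bij_betwE)
  then show ?thesis
    using \<eta> \<nu>A ratV XV \<nu>(2) YV AC by (auto simp: Aut_iff_moebius)
qed

section \<open>From the diagram back to a good solution\<close>

lemma good_solution_of_diagram:
  assumes X: "rational_fun X" "1 \<le> rat_degree X" and Y: "rational_fun Y" "1 \<le> rat_degree Y"
    and A: "rational_fun A" and B: "rational_fun B" and gal: "galois_covering B"
    and \<eta>: "moebius \<eta>" and \<nu>: "moebius \<nu>" and V: "rational_fun V" and C: "rational_fun C"
    and XV: "X \<circ> V = C \<circ> X" and BE: "B \<circ> \<eta> = \<nu> \<circ> X" and YV: "Y = \<eta> \<circ> V" and AC: "A = \<nu> \<circ> C"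
    and equi: "equivariant X V"
  shows "good_solution X Y A B"
proof -
  have \<eta>A: "\<eta> \<in> Aut_cp1" and \<nu>A: "\<nu> \<in> Aut_cp1" using \<eta> \<nu> by (simp_all add: Aut_iff_moebius)
  note ei = Aut_inv_apply[OF \<eta>A] and ni = Aut_inv_apply[OF \<nu>A]
  have app: "X (V t) = C (X t)" "B (\<eta> t) = \<nu> (X t)" "Y t = \<eta> (V t)" "A t = \<nu> (C t)" for t
    using XV BE YV AC by (auto simp: fun_eq_iff)
  have AB: "A \<circ> X = B \<circ> Y" by (simp add: fun_eq_iff app)
  \<comment> \<open>The square \<open>B \<circ> \<eta> = \<nu> \<circ> X\<close> makes
    \<open>X\<close> Galois: conjugating by \<open>\<eta>\<close> turns deck transformations of
    \<open>B\<close> into those of \<open>X\<close>.\<close>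
  have galX: "\<exists>\<mu>\<in>deck X. \<mu> t = s" if st: "X s = X t" for s t
  proof -
    have "B (\<eta> t) = B (\<eta> s)" using st by (simp add: app)
    then obtain \<mu> where m: "\<mu> \<in> deck B" "\<mu> (\<eta> t) = \<eta> s" using galois_fibre[OF gal] by blast
    let ?m = "inv_into UNIV \<eta> \<circ> \<mu> \<circ> \<eta>"
    have "?m \<in> Aut_cp1" using m(1) Aut_inv(1)[OF \<eta>A] \<eta>A by (auto simp: deck_def intro!: Aut_comp)
    moreover have "X (?m x) = X x" for x
    proof -
      have "\<nu> (X (?m x)) = B (\<mu> (\<eta> x))" using app(2)[of "?m x"] ei by simp
      also have "\<dots> = \<nu> (X x)" using deck_apply[OF m(1)] app(2) by simp
      finally show ?thesis by (metis ni(2))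
    qed
    ultimately have "?m \<in> deck X" by (auto simp: deck_def)
    moreover have "?m t = s" using m(2) ei by simp
    ultimately show ?thesis by blast
  qed
  obtain \<phi> where \<phi>: "\<phi> \<in> iso (deck_group X) (deck_group X)" "\<And>\<mu>. \<mu> \<in> deck X \<Longrightarrow> V \<circ> \<mu> = \<phi> \<mu> \<circ> V"
    using equi unfolding equivariant_def by auto
  have bij: "bij_betw \<phi> (deck X) (deck X)" using \<phi>(1) by (simp add: iso_def)
  have hom\<phi>: "\<phi> (\<mu> \<circ> \<nu>) = \<phi> \<mu> \<circ> \<phi> \<nu>" if "\<mu> \<in> deck X" "\<nu> \<in> deck X" for \<mu> \<nu>
    using \<phi>(1) that by (auto simp: iso_def hom_def)
  let ?C = "range (\<lambda>t. (X t, Y t))"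
  have W: "fiber_product A B = ?C"
  proof (intro equalityI subsetI)
    fix P assume "P \<in> fiber_product A B"
    then obtain x y where P: "P = (x, y)" "A x = B y" by (auto simp: fiber_product_def)
    obtain t where t: "X t = x" using rational_fun_surj[OF X] by blast
    let ?w = "inv_into UNIV \<eta> y"
    have "\<nu> (C x) = \<nu> (X ?w)" using P(2) app(2)[of ?w] app(4) ei by simp
    then have "C x = X ?w" by (metis ni(2))
    then have "X ?w = X (V t)" using app(1) t by simp
    then obtain \<mu> where m: "\<mu> \<in> deck X" "\<mu> (V t) = ?w" using galX by blast
    \<comment> \<open>Surjectivity of \<open>\<phi>\<close> replaces a transformation applied after
      \<open>V\<close> by one applied before \<open>V\<close>; the latter moves \<open>t\<close>
      within its fibre of \<open>X\<close>.\<close>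
    then obtain \<mu>' where m': "\<mu>' \<in> deck X" "\<phi> \<mu>' = \<mu>" using bij by (metis bij_betw_def imageE)
    have "V (\<mu>' t) = ?w" using \<phi>(2)[OF m'(1)] m(2) m'(2) by (metis comp_apply)
    then have "Y (\<mu>' t) = y" using app(3) ei by simp
    moreover have "X (\<mu>' t) = x" using deck_apply[OF m'(1)] t by simp
    ultimately have "P = (X (\<mu>' t), Y (\<mu>' t))" using P(1) by simp
    then show "P \<in> ?C" by blast
  next
    fix P assume "P \<in> ?C"
    then show "P \<in> fiber_product A B" using AB by (auto simp: fiber_product_def fun_eq_iff)
  qed
  have irr: "zariski_irreducible (fiber_product A B)" unfolding W by (rule irreducible_curve[OF X(1) Y(1)])
  have clo: "zariski_closed (fiber_product A B)" by (rule zariski_closed_fiber_product[OF A B])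
  have "\<exists>!Z. irreducible_component (fiber_product A B) Z"
  proof (rule ex1I[of _ "fiber_product A B"])
    show "irreducible_component (fiber_product A B) (fiber_product A B)"
      using irr clo unfolding irreducible_component_def by auto
    show "Z = fiber_product A B" if "irreducible_component (fiber_product A B) Z" for Z
      using that irr clo unfolding irreducible_component_def by blast
  qed
  moreover have "no_common_right_factor X Y"
    unfolding no_common_right_factor_def
  proof (intro allI impI, rule ccontr)
    fix X' Y' T
    assume h: "rational_fun X' \<and> rational_fun Y' \<and> rational_fun T \<and> X = X' \<circ> T \<and> Y = Y' \<circ> T"
      and n1: "rat_degree T \<noteq> 1"
    obtain u v where uv: "Y u \<noteq> Y v"
      using rational_fun_surj[OF Y, of Infty] rational_fun_surj[OF Y, of "Fin 0"] by (metis cp1.distinct(1))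
    have Tp: "1 \<le> rat_degree T" using h uv by (intro rat_degree_pos[of T u v]) auto
    then have T2: "2 \<le> rat_degree T" using n1 by simp
    have Vp: "1 \<le> rat_degree V" using uv app(3) by (intro rat_degree_pos[OF V, of u v]) auto
    have ratT: "rational_fun T" using h by blast
    have "\<forall>\<^sub>F t in cofinite. card {x. T x = T t} = rat_degree T"
      by (rule eventually_pull[OF ratT Tp]) (use generic_fibre[OF ratT Tp] in eventually_elim, simp)
    then have "\<forall>\<^sub>F t in cofinite. \<exists>\<mu>\<in>deck X - {id}. T (\<mu> t) = T t"
    proof eventually_elim
      case (elim t)
      \<comment> \<open>A factor \<open>T\<close> of degree at least two has a second point in a
        generic fibre. A deck transformation of \<open>X\<close> joins the two points; by the
        pigeonhole principle one and the same transformation serves for infinitely many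
        \<open>t\<close>, so it preserves \<open>T\<close>.\<close>
      have "\<exists>s. T s = T t \<and> s \<noteq> t"
      proof (rule ccontr)
        assume "\<not> ?thesis"
        then have "{x. T x = T t} = {t}" by blast
        then show False using elim T2 by simp
      qed
      then obtain s where s: "T s = T t" "s \<noteq> t" by blast
      then have "X s = X t" using h by simp
      then obtain \<mu> where "\<mu> \<in> deck X" "\<mu> t = s" using galX by blast
      then show ?case using s by (intro bexI[of _ \<mu>]) auto
    qed
    then obtain \<mu> where m: "\<mu> \<in> deck X" "\<mu> \<noteq> id" and fr: "\<exists>\<^sub>F t in cofinite. T (\<mu> t) = T t"
      using frequently_pigeonhole[of "deck X - {id}" "\<lambda>\<mu> t. T (\<mu> t) = T t"] finite_deck[OF X] by blast
    have mA: "\<mu> \<in> Aut_cp1" using m(1) by (simp add: deck_def)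
    have "T \<circ> \<mu> = T"
      by (rule rational_fun_eqI[OF rational_comp_Aut(1)[OF ratT mA] ratT]) (use fr in simp)
    then have "Y \<circ> \<mu> = Y" using h by (metis comp_assoc)
    then have "V (\<mu> t) = V t" for t using app(3) ei(2) by (metis comp_apply)
    then have "\<phi> \<mu> (V t) = V t" for t using \<phi>(2)[OF m(1)] by (metis comp_apply)
    then have "\<phi> \<mu> = id" using rational_fun_surj[OF V Vp] by (metis eq_id_iff)
    moreover have "\<phi> id = id"
    proof -
      have idX: "id \<in> deck X" using aut_group_deck by (simp add: aut_group_def)
      have "\<phi> id \<circ> \<phi> id = \<phi> id" using hom\<phi>[OF idX idX] by simp
      moreover have "\<phi> id \<in> Aut_cp1" using bij idX by (auto simp: bij_betw_def deck_def)
      ultimately show ?thesis by (metis Aut_inv(3) comp_assoc comp_id id_comp)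
    qed
    ultimately show False using m bij aut_group_deck[of X]
      by (metis aut_group_def bij_betw_imp_inj_on inj_onD)
  qed
  ultimately show ?thesis
    unfolding good_solution_def using X Y A B AB by blast
qed

subsection \<open>Finite groups of automorphisms\<close>

definition stab :: "(cp1 \<Rightarrow> cp1) set \<Rightarrow> cp1 \<Rightarrow> (cp1 \<Rightarrow> cp1) set" where
  "stab G p = {g \<in> G. g p = p}"

definition orb :: "(cp1 \<Rightarrow> cp1) set \<Rightarrow> cp1 \<Rightarrow> cp1 set" where
  "orb G p = (\<lambda>g. g p) ` G"

definition cj :: "(cp1 \<Rightarrow> cp1) \<Rightarrow> (cp1 \<Rightarrow> cp1) \<Rightarrow> cp1 \<Rightarrow> cp1" where
  "cj \<eta> \<sigma> = \<eta> \<circ> \<sigma> \<circ> inv_into UNIV \<eta>"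

lemma aut_groupD:
  assumes "aut_group G"
  shows "id \<in> G" "f \<in> G \<Longrightarrow> g \<in> G \<Longrightarrow> f \<circ> g \<in> G" "f \<in> G \<Longrightarrow> inv_into UNIV f \<in> G"
    "f \<in> G \<Longrightarrow> f \<in> Aut_cp1"
  using assms by (auto simp: aut_group_def)

lemma cj_comp: "\<eta> \<in> Aut_cp1 \<Longrightarrow> cj \<eta> (\<sigma> \<circ> \<tau>) = cj \<eta> \<sigma> \<circ> cj \<eta> \<tau>"
  by (auto simp: cj_def Aut_inv_apply)

lemma cj_id: "\<eta> \<in> Aut_cp1 \<Longrightarrow> cj \<eta> id = id"
  by (simp add: cj_def Aut_inv)

lemma cj_inj: "\<eta> \<in> Aut_cp1 \<Longrightarrow> cj \<eta> \<sigma> = cj \<eta> \<tau> \<Longrightarrow> \<sigma> = \<tau>"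
proof
  fix x assume e: "\<eta> \<in> Aut_cp1" "cj \<eta> \<sigma> = cj \<eta> \<tau>"
  have "cj \<eta> \<sigma> (\<eta> x) = cj \<eta> \<tau> (\<eta> x)" using e by simp
  then show "\<sigma> x = \<tau> x" using e(1) by (simp add: cj_def) (metis Aut_inv_apply(2))
qed

lemma cj_apply: "\<eta> \<in> Aut_cp1 \<Longrightarrow> cj \<eta> \<sigma> (\<eta> x) = \<eta> (\<sigma> x)"
  by (simp add: cj_def Aut_inv_apply)

lemma cj_cj:
  assumes "\<eta> \<in> Aut_cp1" "\<theta> \<in> Aut_cp1"
  shows "cj \<eta> (cj \<theta> \<sigma>) = cj (\<eta> \<circ> \<theta>) \<sigma>"
proof
  fix x
  let ?y = "inv_into UNIV \<theta> (inv_into UNIV \<eta> x)"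
  have "(\<eta> \<circ> \<theta>) ?y = x" using assms by (simp add: Aut_inv_apply)
  then have "inv_into UNIV (\<eta> \<circ> \<theta>) x = ?y"
    using Aut_inv_apply(2)[OF Aut_comp[OF assms], of ?y] by simp
  then show "cj \<eta> (cj \<theta> \<sigma>) x = cj (\<eta> \<circ> \<theta>) \<sigma> x" by (simp add: cj_def)
qed

lemma cj_inv_cancel:
  assumes "\<eta> \<in> Aut_cp1"
  shows "cj (inv_into UNIV \<eta>) (cj \<eta> \<sigma>) = \<sigma>" "cj \<eta> (cj (inv_into UNIV \<eta>) \<sigma>) = \<sigma>"
proof -
  have "cj id \<sigma> = \<sigma>" by (simp add: cj_def)
  then show "cj (inv_into UNIV \<eta>) (cj \<eta> \<sigma>) = \<sigma>" "cj \<eta> (cj (inv_into UNIV \<eta>) \<sigma>) = \<sigma>"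
    using cj_cj[OF Aut_inv(1)[OF assms] assms] cj_cj[OF assms Aut_inv(1)[OF assms]] Aut_inv[OF assms]
    by simp_all
qed

lemma cj_Aut: "\<eta> \<in> Aut_cp1 \<Longrightarrow> \<sigma> \<in> Aut_cp1 \<Longrightarrow> cj \<eta> \<sigma> \<in> Aut_cp1"
  unfolding cj_def by (intro Aut_comp Aut_inv)

lemma cj_inv:
  assumes "\<eta> \<in> Aut_cp1" "\<sigma> \<in> Aut_cp1"
  shows "inv_into UNIV (cj \<eta> \<sigma>) = cj \<eta> (inv_into UNIV \<sigma>)"
proof
  fix x
  have "cj \<eta> \<sigma> (cj \<eta> (inv_into UNIV \<sigma>) x) = x"
    using cj_comp[OF assms(1), of \<sigma> "inv_into UNIV \<sigma>"] Aut_inv(2)[OF assms(2)] cj_id[OF assms(1)]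
    by (metis comp_apply id_apply)
  then show "inv_into UNIV (cj \<eta> \<sigma>) x = cj \<eta> (inv_into UNIV \<sigma>) x"
    using Aut_inv_apply(2)[OF cj_Aut[OF assms]] by metis
qed

lemma aut_group_cj:
  assumes "aut_group G" "\<eta> \<in> Aut_cp1"
  shows "aut_group (cj \<eta> ` G)"
  unfolding aut_group_def
proof (intro conjI ballI)
  show "cj \<eta> ` G \<subseteq> Aut_cp1" using assms by (auto intro: cj_Aut aut_groupD)
  show "id \<in> cj \<eta> ` G" using cj_id[OF assms(2)] aut_groupD(1)[OF assms(1)] by (metis imageI)
  show "f \<circ> g \<in> cj \<eta> ` G" if "f \<in> cj \<eta> ` G" "g \<in> cj \<eta> ` G" for f g
    using that cj_comp[OF assms(2)] aut_groupD(2)[OF assms(1)] by (auto simp: image_iff) metis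
  show "inv_into UNIV f \<in> cj \<eta> ` G" if "f \<in> cj \<eta> ` G" for f
    using that cj_inv[OF assms(2)] aut_groupD(3,4)[OF assms(1)] by auto
qed

lemma card_cj: "\<eta> \<in> Aut_cp1 \<Longrightarrow> card (cj \<eta> ` G) = card G"
  by (intro card_image inj_onI) (rule cj_inj)

lemma cj_funpow: "\<eta> \<in> Aut_cp1 \<Longrightarrow> cj \<eta> (g ^^ n) = cj \<eta> g ^^ n"
  by (induction n) (simp_all add: cj_id cj_comp)

lemma stab_cj:
  assumes "\<eta> \<in> Aut_cp1"
  shows "stab (cj \<eta> ` G) (\<eta> p) = cj \<eta> ` stab G p"
proof -
  have "\<eta> x = \<eta> y \<longleftrightarrow> x = y" for x y using Aut_bij[OF assms] by (metis bij_pointE)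
  then show ?thesis by (auto simp: stab_def cj_apply[OF assms])
qed

lemma orb_refl: "aut_group G \<Longrightarrow> p \<in> orb G p"
  unfolding orb_def by (metis aut_groupD(1) id_apply imageI)

lemma orb_eq:
  assumes "aut_group G" "q \<in> orb G p"
  shows "orb G q = orb G p"
proof -
  obtain h where h: "h \<in> G" "q = h p" using assms(2) by (auto simp: orb_def)
  have "g q \<in> orb G p" if "g \<in> G" for g
  proof -
    have "g q = (g \<circ> h) p" using h(2) by simp
    then show ?thesis unfolding orb_def using aut_groupD(2)[OF assms(1) that h(1)] by blast
  qed
  moreover have "g p \<in> orb G q" if "g \<in> G" for g
  proof -
    have "g p = (g \<circ> inv_into UNIV h) q" using h(2) aut_group_inv(3)[OF assms(1) h(1)] by simp
    then show ?thesis
      unfolding orb_def using aut_groupD(2)[OF assms(1) that aut_groupD(3)[OF assms(1) h(1)]] by blast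
  qed
  ultimately show ?thesis by (auto simp: orb_def)
qed

lemma orbit_stabilizer:
  assumes "aut_group G" "finite G"
  shows "card (orb G p) * card (stab G p) = card G"
proof -
  have "card {g \<in> G. g p = y} = card (stab G p)" if "y \<in> orb G p" for y
  proof -
    obtain h where h: "h \<in> G" "y = h p" using \<open>y \<in> orb G p\<close> by (auto simp: orb_def)
    note i = aut_group_inv[OF assms(1) h(1)]
    have "bij_betw (\<lambda>g. h \<circ> g) (stab G p) {g \<in> G. g p = y}"
    proof (rule bij_betwI[where g = "\<lambda>g. inv_into UNIV h \<circ> g"])
      show "(\<lambda>g. h \<circ> g) \<in> stab G p \<rightarrow> {g \<in> G. g p = y}"
        using h aut_groupD(2)[OF assms(1)] by (auto simp: stab_def)
      show "(\<lambda>g. inv_into UNIV h \<circ> g) \<in> {g \<in> G. g p = y} \<rightarrow> stab G p"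
        using h i aut_groupD(2)[OF assms(1)] by (auto simp: stab_def)
    qed (use i in \<open>auto simp: fun_eq_iff\<close>)
    then show ?thesis by (simp add: bij_betw_same_card)
  qed
  then have "(\<Sum>y\<in>orb G p. card {g \<in> G. g p = y}) = card (orb G p) * card (stab G p)" by simp
  moreover have "card G = (\<Sum>y\<in>orb G p. card {g \<in> G. g p = y})"
    using sum.image_gen[OF assms(2), of "\<lambda>_. 1 :: nat" "\<lambda>g. g p"]
    by (simp only: orb_def card_eq_sum)
  ultimately show ?thesis by simp
qed

lemma stab_card_orb:
  assumes "aut_group G" "finite G" "q \<in> orb G p"
  shows "card (stab G q) = card (stab G p)"
proof -
  have "card (orb G q) > 0" using orb_refl[OF assms(1)] assms(2) by (auto simp: orb_def card_gt_0_iff)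
  then show ?thesis
    using orbit_stabilizer[OF assms(1,2), of q] orbit_stabilizer[OF assms(1,2), of p] orb_eq[OF assms(1,3)]
    by (metis mult_cancel1 not_gr_zero)
qed

section \<open>Stabilizers of a point\<close>

abbreviation "rot a \<equiv> mob a 0 0 1"

lemma mob_Infty: "a * d - b * c \<noteq> 0 \<Longrightarrow> mob a b c d Infty = proj_point a c"
  and mob_Fin: "a * d - b * c \<noteq> 0 \<Longrightarrow> mob a b c d (Fin z) = proj_point (a * z + b) (c * z + d)"
  using mob_proj[of a d b c 1 0] mob_proj[of a d b c z 1] by (simp_all add: Fin_eq_proj Infty_eq_proj)

lemma mob_Aut: "a * d - b * c \<noteq> 0 \<Longrightarrow> mob a b c d \<in> Aut_cp1"
  unfolding Aut_mob by blast

lemma mob_eq_idD: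
  assumes "a * d - b * c \<noteq> 0" "mob a b c d = id"
  shows "b = 0" "c = 0" "a = d"
proof -
  have "proj_point a c = Infty" "proj_point b d = Fin 0" "proj_point (a + b) (c + d) = Fin 1"
    using mob_Infty[OF assms(1)] mob_Fin[OF assms(1), of 0] mob_Fin[OF assms(1), of 1] assms(2)
    by simp_all
  then show "b = 0" "c = 0" "a = d" by (auto simp: proj_point_def split: if_splits)
qed

lemma fixes_Infty:
  assumes "g \<in> Aut_cp1" "g Infty = Infty"
  obtains a b where "a \<noteq> 0" "g = mob a b 0 1"
proof -
  obtain a b c d where g: "a * d - b * c \<noteq> 0" "g = mob a b c d" using assms(1) Aut_mob by blast
  have "c = 0" using assms(2) mob_Infty[OF g(1)] by (simp add: g(2) proj_point_def split: if_splits)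
  then have "d \<noteq> 0" "a \<noteq> 0" using g(1) by auto
  then have "g = mob (a / d) (b / d) 0 1"
    using mob_scale[of "1 / d" a b c d] g(2) \<open>c = 0\<close> by simp
  then show ?thesis using that[of "a / d" "b / d"] \<open>a \<noteq> 0\<close> \<open>d \<noteq> 0\<close> by simp
qed

lemma affine_apply: "a \<noteq> 0 \<Longrightarrow> mob a b 0 1 (Fin z) = Fin (a * z + b)" "a \<noteq> 0 \<Longrightarrow> mob a b 0 1 Infty = Infty"
  using mob_Fin[of a 1 b 0 z] mob_Infty[of a 1 b 0] by (simp_all add: proj_point_def)

lemma affine_comp: "a \<noteq> 0 \<Longrightarrow> a' \<noteq> 0 \<Longrightarrow> mob a b 0 1 \<circ> mob a' b' 0 1 = mob (a * a') (a * b' + b) 0 1"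
  using mob_comp[of a 1 b 0 a' 1 b' 0] by simp

lemma affine_Aut: "a \<noteq> 0 \<Longrightarrow> mob a b 0 1 \<in> Aut_cp1"
  using mob_Aut[of a 1 b 0] by simp

lemma affine_inv: "a \<noteq> 0 \<Longrightarrow> inv_into UNIV (mob a b 0 1) = mob (1 / a) (- b / a) 0 1"
proof
  fix x assume a: "a \<noteq> 0"
  have "mob a b 0 1 (mob (1 / a) (- b / a) 0 1 x) = x"
    using affine_comp[of a "1 / a" b "- b / a"] a mob_id[of 1] by (simp add: fun_eq_iff)
  then show "inv_into UNIV (mob a b 0 1) x = mob (1 / a) (- b / a) 0 1 x"
    using Aut_inv_apply(2)[OF affine_Aut[OF a]] by metis
qed

lemma no_translation:
  assumes "aut_group G" "finite G" "mob 1 b 0 1 \<in> G"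
  shows "b = 0"
proof (rule ccontr)
  assume b: "b \<noteq> 0"
  have "mob 1 (of_nat n * b) 0 1 \<in> G" for n
  proof (induction n)
    case 0
    have "mob 1 (of_nat 0 * b) 0 1 = id" using mob_id[of 1] by (metis mult_zero_left of_nat_0 zero_neq_one)
    then show ?case using aut_groupD(1)[OF assms(1)] by (simp only:)
  next
    case (Suc n)
    then show ?case using aut_groupD(2)[OF assms(1) assms(3) Suc] affine_comp[of 1 1 b "of_nat n * b"]
      by (simp add: algebra_simps)
  qed
  then have "range (\<lambda>n. mob 1 (of_nat n * b) 0 1) \<subseteq> G" by auto
  moreover have "inj (\<lambda>n. mob 1 (of_nat n * b) 0 1)"
  proof (rule injI)
    fix m n :: nat assume "mob 1 (of_nat m * b) 0 1 = mob 1 (of_nat n * b) 0 1"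
    then have "mob 1 (of_nat m * b) 0 1 (Fin 0) = mob 1 (of_nat n * b) 0 1 (Fin 0)" by simp
    then show "m = n" using b by (simp add: affine_apply)
  qed
  ultimately show False using assms(2) finite_subset finite_imageD by (metis infinite_UNIV_nat)
qed

lemma move_to_Infty_zero:
  assumes "p \<noteq> q"
  obtains \<eta> where "\<eta> \<in> Aut_cp1" "\<eta> p = Infty" "\<eta> q = Fin 0"
proof -
  obtain p0 p1 where p: "p = proj_point p0 p1" "p0 \<noteq> 0 \<or> p1 \<noteq> 0" by (rule cp1_proj_cases)
  obtain q0 q1 where q: "q = proj_point q0 q1" "q0 \<noteq> 0 \<or> q1 \<noteq> 0" by (rule cp1_proj_cases)
  have "p0 * q1 \<noteq> q0 * p1" using assms proj_point_eq_iff[OF p(2) q(2)] p(1) q(1) by simp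
  then have det: "q1 * (- p0) - (- q0) * p1 \<noteq> 0" by (simp add: algebra_simps)
  let ?\<eta> = "mob q1 (- q0) p1 (- p0)"
  have "?\<eta> p = Infty" using mob_proj[OF det p(2)] by (simp add: p(1) proj_point_def algebra_simps)
  moreover have "?\<eta> q = Fin 0" using mob_proj[OF det q(2)] det
    by (simp add: q(1) proj_point_def algebra_simps)
  ultimately show ?thesis using that[of ?\<eta>] det Aut_mob by blast
qed

lemma Aut_has_fixed_point:
  assumes "g \<in> Aut_cp1"
  shows "\<exists>x. g x = x"
proof (cases "g Infty = Infty")
  case False
  obtain a b c d where g: "a * d - b * c \<noteq> 0" "g = mob a b c d" using assms Aut_mob by blast
  have "c \<noteq> 0"
  proof
    assume "c = 0"
    then show False using False mob_Infty[OF g(1)] by (simp add: g(2) proj_point_def)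
  qed
  then have "\<not> constant (poly [:-b, d - a, c:])" by (simp add: constant_degree)
  then obtain z where z: "poly [:-b, d - a, c:] z = 0" using fundamental_theorem_of_algebra by blast
  have "(a * z + b) * 1 = z * (c * z + d * 1)" using z by (simp add: algebra_simps)
  then have "proj_point (a * z + b * 1) (c * z + d * 1) = proj_point z 1"
    using mob_nonzero[OF g(1), of z 1] by (subst proj_point_eq_iff) auto
  then have "g (Fin z) = Fin z" using mob_proj[OF g(1), of z 1] by (simp add: g(2) Fin_eq_proj)
  then show ?thesis by blast
qed auto

text \<open>With \<open>p\<close> moved to \<open>Infty\<close> the stabilizer consists of affine
  maps. Their commutators are translations, hence trivial in a finite group, so every element
  commutes with \<open>g\<close> and fixes its finite fixed point
  \<open>b / (1 - a)\<close>.\<close>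

lemma stab_second_fixed_point:
  assumes G: "aut_group G" "finite G" and g: "g \<in> G" "g \<noteq> id" "g p = p"
  obtains q where "q \<noteq> p" "\<And>h. h \<in> stab G p \<Longrightarrow> h q = q"
proof -
  obtain p' where "p' \<noteq> p" by (metis cp1.distinct(1))
  then obtain \<eta> where \<eta>: "\<eta> \<in> Aut_cp1" "\<eta> p = Infty" using move_to_Infty_zero by metis
  let ?G = "cj \<eta> ` G"
  have G': "aut_group ?G" "finite ?G" using aut_group_cj[OF G(1) \<eta>(1)] G(2) by auto
  have aff: "\<exists>a b. a \<noteq> 0 \<and> cj \<eta> h = mob a b 0 1" if "h \<in> stab G p" for h
  proof -
    have "cj \<eta> h Infty = Infty" using cj_apply[OF \<eta>(1), of h p] that \<eta>(2) by (simp add: stab_def)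
    moreover have "cj \<eta> h \<in> Aut_cp1" using that G(1) cj_Aut[OF \<eta>(1)] by (auto simp: stab_def aut_group_def)
    ultimately show ?thesis using fixes_Infty by metis
  qed
  have gs: "g \<in> stab G p" using g by (simp add: stab_def)
  obtain a b where ab: "a \<noteq> 0" "cj \<eta> g = mob a b 0 1" using aff[OF gs] by blast
  have a1: "a \<noteq> 1"
  proof
    assume "a = 1"
    then have "mob 1 b 0 1 \<in> ?G" using ab(2) g(1) by (metis imageI)
    then have "b = 0" by (rule no_translation[OF G'])
    then have "cj \<eta> g = cj \<eta> id" using ab \<open>a = 1\<close> mob_id[of 1] cj_id[OF \<eta>(1)] by simp
    then show False using cj_inj[OF \<eta>(1)] g(2) by blast
  qed
  define z where "z = b / (1 - a)"
  define q where "q = inv_into UNIV \<eta> (Fin z)"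
  have \<eta>q: "\<eta> q = Fin z" using Aut_inv_apply[OF \<eta>(1)] by (simp add: q_def)
  have "h q = q" if h: "h \<in> stab G p" for h
  proof -
    obtain a' b' where ab': "a' \<noteq> 0" "cj \<eta> h = mob a' b' 0 1" using aff[OF h] by blast
    have hG: "h \<in> G" using h by (simp add: stab_def)
    let ?u = "mob a b 0 1 \<circ> mob a' b' 0 1" and ?v = "mob a' b' 0 1 \<circ> mob a b 0 1"
    have uv: "?u \<in> ?G" "?v \<in> ?G"
      using aut_groupD(2)[OF G'(1)] imageI[OF g(1), of "cj \<eta>"] imageI[OF hG, of "cj \<eta>"] ab(2) ab'(2) by metis+
    have "?u \<circ> inv_into UNIV ?v \<in> ?G"
      by (rule aut_groupD(2)[OF G'(1) uv(1) aut_groupD(3)[OF G'(1) uv(2)]])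
    moreover have "?u \<circ> inv_into UNIV ?v = mob 1 ((a * b' + b) - (a' * b + b')) 0 1"
      using ab(1) ab'(1) by (simp add: affine_comp affine_inv field_simps)
    ultimately have "(a * b' + b) - (a' * b + b') = 0" using no_translation[OF G'] by metis
    then have "a' * z + b' = z" using a1 by (simp add: z_def field_simps)
    then have "cj \<eta> h (\<eta> q) = \<eta> q" using ab' \<eta>q by (simp add: affine_apply)
    then show "h q = q" using cj_apply[OF \<eta>(1), of h q] Aut_inv_apply(2)[OF \<eta>(1)] by metis
  qed
  moreover have "q \<noteq> p" using \<eta>q \<eta>(2) by auto
  ultimately show ?thesis using that by blast
qed

lemma fixes_Infty_zero:
  assumes "g \<in> Aut_cp1" "g Infty = Infty" "g (Fin 0) = Fin 0"
  obtains a where "a \<noteq> 0" "g = rot a"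
proof -
  obtain a b where ab: "a \<noteq> 0" "g = mob a b 0 1" using fixes_Infty[OF assms(1,2)] .
  then have "b = 0" using assms(3) by (simp add: affine_apply)
  then show ?thesis using that ab by simp
qed

lemma Aut_two_fixed_points:
  assumes "g \<in> Aut_cp1" "g \<noteq> id" "p \<noteq> q" "g p = p" "g q = q"
  shows "{x. g x = x} = {p, q}"
proof -
  obtain \<eta> where \<eta>: "\<eta> \<in> Aut_cp1" "\<eta> p = Infty" "\<eta> q = Fin 0" using move_to_Infty_zero[OF assms(3)] .
  have "cj \<eta> g Infty = Infty" "cj \<eta> g (Fin 0) = Fin 0"
    using cj_apply[OF \<eta>(1), of g] assms(4,5) \<eta>(2,3) by metis+
  then obtain a where a: "a \<noteq> 0" "cj \<eta> g = rot a" using fixes_Infty_zero cj_Aut[OF \<eta>(1) assms(1)] by metis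
  have a1: "a \<noteq> 1"
  proof
    assume "a = 1"
    then have "cj \<eta> g = cj \<eta> id" using a(2) mob_id[of 1] cj_id[OF \<eta>(1)] by simp
    then show False using cj_inj[OF \<eta>(1)] assms(2) by blast
  qed
  have ij: "\<eta> x = \<eta> y \<longleftrightarrow> x = y" for x y using Aut_bij[OF \<eta>(1)] by (metis bij_pointE)
  have "x = p \<or> x = q" if "g x = x" for x
  proof -
    have "rot a (\<eta> x) = \<eta> x" using cj_apply[OF \<eta>(1), of g x] that a(2) by simp
    then have "\<eta> x = Infty \<or> \<eta> x = Fin 0" using a(1) a1 by (cases "\<eta> x") (auto simp: affine_apply)
    then show ?thesis using \<eta>(2,3) ij by metis
  qed
  then show ?thesis using assms(4,5) by auto
qed

text \<open>The second fixed point \<open>q\<close> is applied to itself: the point \<open>r\<close>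
  that it produces for the stabilizer of \<open>q\<close> is fixed by \<open>g\<close>, hence equals
  \<open>p\<close>, and the two stabilizers contain each other.\<close>

lemma stab_two_points:
  assumes G: "aut_group G" "finite G" and g: "g \<in> stab G p" "g \<noteq> id"
  obtains q where "q \<noteq> p" "stab G q = stab G p" "\<And>h. h \<in> stab G p \<Longrightarrow> h \<noteq> id \<Longrightarrow> {x. h x = x} = {p, q}"
proof -
  have gG: "g \<in> G" "g p = p" using g(1) by (auto simp: stab_def)
  obtain q where q: "q \<noteq> p" "\<And>h. h \<in> stab G p \<Longrightarrow> h q = q"
    using stab_second_fixed_point[OF G gG(1) g(2) gG(2)] by blast
  have fixes_pq: "{x. h x = x} = {p, q}" if h: "h \<in> stab G p" "h \<noteq> id" for h
    using Aut_two_fixed_points[of h p q] h q aut_groupD(4)[OF G(1)] by (auto simp: stab_def)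
  have gq: "g q = q" using q(2) g(1) by blast
  obtain r where r: "r \<noteq> q" "\<And>h. h \<in> stab G q \<Longrightarrow> h r = r"
    using stab_second_fixed_point[OF G gG(1) g(2) gq] by blast
  have "g r = r" using r(2) gG(1) gq by (simp add: stab_def)
  then have "r = p" using fixes_pq[OF g] r(1) by blast
  then have "stab G q = stab G p" using q(2) r(2) by (auto simp: stab_def)
  then show ?thesis using that q(1) fixes_pq by blast
qed

text \<open>The multipliers form a finite set \<open>S\<close> closed under multiplication.
  Multiplying by \<open>a\<close> permutes \<open>S\<close>, so comparing the products over
  \<open>S\<close> gives that \<open>a\<close> to the power \<open>card S\<close> is one; counting
  shows that all such roots of unity occur.\<close>

lemma stab_roots_of_unity:
  assumes G: "aut_group G" "finite G" and fix0: "\<And>h. h \<in> stab G Infty \<Longrightarrow> h (Fin 0) = Fin 0"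
  shows "stab G Infty = rot ` {z. z ^ card (stab G Infty) = 1}"
proof -
  let ?m = "card (stab G Infty)"
  define S where "S = {a. a \<noteq> 0 \<and> rot a \<in> G}"
  have eq: "stab G Infty = rot ` S"
  proof (intro equalityI subsetI)
    fix h assume h: "h \<in> stab G Infty"
    then obtain a where "a \<noteq> 0" "h = rot a"
      using fixes_Infty_zero[of h] fix0 aut_groupD(4)[OF G(1)] by (auto simp: stab_def)
    then show "h \<in> rot ` S" using h by (auto simp: S_def stab_def)
  qed (auto simp: S_def stab_def affine_apply)
  have inj: "inj_on rot S"
  proof (rule inj_onI)
    fix a b assume "a \<in> S" "b \<in> S" "rot a = rot b"
    then have "rot a (Fin 1) = rot b (Fin 1)" "a \<noteq> 0" "b \<noteq> 0" by (auto simp: S_def)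
    then show "a = b" by (simp add: affine_apply)
  qed
  have m: "?m = card S" unfolding eq by (rule card_image[OF inj])
  have "finite (stab G Infty)" using G(2) by (simp add: stab_def)
  then have "finite (rot ` S)" by (simp only: eq)
  then have finS: "finite S" using inj finite_imageD by blast
  have S1: "1 \<in> S" using aut_groupD(1)[OF G(1)] mob_id[of 1] by (simp add: S_def)
  then have mpos: "?m > 0" using finS m by (auto simp: card_gt_0_iff)
  have mult: "a * b \<in> S" if "a \<in> S" "b \<in> S" for a b
    using that aut_groupD(2)[OF G(1), of "rot a" "rot b"] affine_comp[of a b 0 0] by (simp add: S_def)
  have root: "a ^ ?m = 1" if a: "a \<in> S" for a
  proof -
    have "a \<noteq> 0" using a by (simp add: S_def)
    then have inja: "inj_on (\<lambda>s. a * s) S" by (auto intro: inj_onI)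
    have "(\<lambda>s. a * s) ` S \<subseteq> S" using mult[OF a] by auto
    then have img: "(\<lambda>s. a * s) ` S = S" using inja finS by (metis card_image card_subset_eq)
    have "(\<Prod>s\<in>S. s) = (\<Prod>s\<in>S. a * s)"
      using prod.reindex[OF inja, of "\<lambda>s. s"] img by simp
    also have "\<dots> = a ^ ?m * (\<Prod>s\<in>S. s)" by (simp add: prod.distrib m)
    finally show ?thesis using finS by (auto simp: S_def)
  qed
  have "S = {z. z ^ ?m = 1}"
  proof (rule card_subset_eq)
    show "finite {z::complex. z ^ ?m = 1}" using mpos by (simp add: finite_roots_unity)
    show "card S = card {z::complex. z ^ ?m = 1}" using card_roots_unity_eq[OF mpos] m by simp
  qed (use root in auto)
  then show ?thesis using eq by metis
qed

lemma normal_form: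
  assumes G: "aut_group G" "finite G" and m: "2 \<le> card (stab G p)"
  obtains \<eta> q where "\<eta> \<in> Aut_cp1" "\<eta> p = Infty" "\<eta> q = Fin 0" "q \<noteq> p" "stab G q = stab G p"
    "\<forall>h\<in>stab G p. h \<noteq> id \<longrightarrow> {x. h x = x} = {p, q}"
    "stab (cj \<eta> ` G) Infty = rot ` {z. z ^ card (stab G p) = 1}"
proof -
  have "\<exists>g\<in>stab G p. g \<noteq> id"
  proof (rule ccontr)
    assume "\<not> ?thesis"
    then have "stab G p \<subseteq> {id}" by auto
    then have "card (stab G p) \<le> 1" by (metis card.empty card.insert card_mono empty_iff finite.emptyI finite.insertI One_nat_def)
    then show False using m by simp
  qed
  then obtain g where g: "g \<in> stab G p" "g \<noteq> id" by blast
  obtain q where q: "q \<noteq> p" "stab G q = stab G p" "\<forall>h\<in>stab G p. h \<noteq> id \<longrightarrow> {x. h x = x} = {p, q}"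
    by (rule stab_two_points[OF G g]) blast
  obtain \<eta> where \<eta>: "\<eta> \<in> Aut_cp1" "\<eta> p = Infty" "\<eta> q = Fin 0"
    using move_to_Infty_zero[of p q] q(1) by metis
  have st: "stab (cj \<eta> ` G) Infty = cj \<eta> ` stab G p" using stab_cj[OF \<eta>(1), of G p] \<eta>(2) by simp
  have "h (Fin 0) = Fin 0" if h: "h \<in> stab (cj \<eta> ` G) Infty" for h
  proof -
    obtain k where k: "h = cj \<eta> k" "k \<in> stab G p" using h unfolding st by (rule imageE)
    moreover have "k q = q" using k(2) unfolding q(2)[symmetric] by (simp add: stab_def)
    ultimately show ?thesis using cj_apply[OF \<eta>(1), of k q] \<eta>(3) by simp
  qed
  then have "stab (cj \<eta> ` G) Infty = rot ` {z. z ^ card (stab (cj \<eta> ` G) Infty) = 1}"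
    using G aut_group_cj[OF G(1) \<eta>(1)] by (intro stab_roots_of_unity) auto
  moreover have "card (stab (cj \<eta> ` G) Infty) = card (stab G p)" unfolding st by (rule card_cj[OF \<eta>(1)])
  ultimately have fin: "stab (cj \<eta> ` G) Infty = rot ` {z. z ^ card (stab G p) = 1}" by simp
  show ?thesis by (rule that[OF \<eta> q fin])
qed

lemma stab_exists_order:
  assumes G: "aut_group G" "finite G" and m: "2 \<le> card (stab G p)"
  shows "\<exists>g\<in>stab G p. \<forall>j. 0 < j \<and> j < card (stab G p) \<longrightarrow> g ^^ j \<noteq> id"
proof -
  let ?m = "card (stab G p)"
  obtain \<eta> q where \<eta>: "\<eta> \<in> Aut_cp1" "\<eta> p = Infty" "\<eta> q = Fin 0" "q \<noteq> p" "stab G q = stab G p"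
    "\<forall>h\<in>stab G p. h \<noteq> id \<longrightarrow> {x. h x = x} = {p, q}"
    and st: "stab (cj \<eta> ` G) Infty = rot ` {z. z ^ ?m = 1}" using normal_form[OF G m] by blast
  define w where "w = cis (2 * pi / ?m)"
  have w: "w ^ ?m = 1" using m by (simp add: w_def DeMoivre)
  have w0: "w \<noteq> 0" by (simp add: w_def)
  have pow: "rot w ^^ j = rot (w ^ j)" for j
  proof (induction j)
    case 0
    then show ?case using mob_id[of 1] by simp
  next
    case (Suc j)
    then show ?case using affine_comp[of w "w ^ j" 0 0] w0 by simp
  qed
  have "rot w ^^ j \<noteq> id" if j: "0 < j" "j < ?m" for j
  proof
    assume "rot w ^^ j = id"
    then have "rot (w ^ j) (Fin 1) = Fin 1" using pow by simp
    then have "w ^ j = 1" using w0 by (simp add: affine_apply)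
    then have "cis (2 * pi * real j / real ?m) = cis (2 * pi * real 0 / real ?m)"
      by (simp add: w_def DeMoivre algebra_simps)
    moreover have "inj_on (\<lambda>k. cis (2 * pi * real k / real ?m)) {..<?m}"
      using bij_betw_roots_unity[of ?m] m by (simp add: bij_betw_def)
    ultimately have "j = 0" using j by (elim inj_onD[rotated]) auto
    then show False using j by simp
  qed
  moreover have "rot w \<in> stab (cj \<eta> ` G) (\<eta> p)" unfolding \<eta>(2) st using w by (intro imageI) simp
  then obtain g where g: "rot w = cj \<eta> g" "g \<in> stab G p"
    unfolding stab_cj[OF \<eta>(1)] by (rule imageE)
  ultimately have "cj \<eta> (g ^^ j) \<noteq> id" if "0 < j" "j < ?m" for j
    using that cj_funpow[OF \<eta>(1)] by metis
  then have "g ^^ j \<noteq> id" if "0 < j" "j < ?m" for j using that cj_id[OF \<eta>(1)] by metis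
  then show ?thesis using g(2) by blast
qed

abbreviation invo :: "cp1 \<Rightarrow> cp1" where "invo \<equiv> mob 0 1 1 0"

section \<open>Counting exceptional orbits\<close>

lemma id_in_stab: "aut_group G \<Longrightarrow> id \<in> stab G p"
  by (simp add: stab_def aut_groupD)

lemma card_stab_ge_2:
  assumes "aut_group G" "finite G"
  shows "2 \<le> card (stab G p) \<longleftrightarrow> (\<exists>g\<in>G. g \<noteq> id \<and> g p = p)"
proof
  assume c: "2 \<le> card (stab G p)"
  show "\<exists>g\<in>G. g \<noteq> id \<and> g p = p"
  proof (rule ccontr)
    assume "\<not> ?thesis"
    then have "stab G p \<subseteq> {id}" by (auto simp: stab_def)
    then have "card (stab G p) \<le> card {id :: cp1 \<Rightarrow> cp1}" by (intro card_mono) auto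
    then show False using c by simp
  qed
next
  assume "\<exists>g\<in>G. g \<noteq> id \<and> g p = p"
  then obtain g where g: "g \<in> stab G p" "g \<noteq> id" by (auto simp: stab_def)
  have "card {id, g} \<le> card (stab G p)"
    using assms(2) g id_in_stab[OF assms(1)] by (intro card_mono) (auto simp: stab_def)
  then show "2 \<le> card (stab G p)" using g(2) by simp
qed

lemma card_fixed_points:
  assumes G: "aut_group G" "finite G" and g: "g \<in> G" "g \<noteq> id"
  shows "card {x. g x = x} = 2"
proof -
  obtain p where p: "g p = p" using Aut_has_fixed_point aut_groupD(4)[OF G(1) g(1)] by blast
  then have gs: "g \<in> stab G p" using g by (simp add: stab_def)
  obtain q where q: "q \<noteq> p" "\<And>h. h \<in> stab G p \<Longrightarrow> h \<noteq> id \<Longrightarrow> {x. h x = x} = {p, q}"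
    by (rule stab_two_points[OF G gs g(2)]) blast
  show ?thesis using q(2)[OF gs g(2)] q(1) by simp
qed

text \<open>Double counting of the pairs of a nontrivial \<open>g\<close> and a point fixed by it:
  every \<open>g\<close> has two fixed points, and an orbit of size \<open>o\<close> contributes
  \<open>o * (card G / o - 1)\<close>. It is the Riemann-Hurwitz formula for the quotient of the
  sphere by \<open>G\<close>.\<close>

lemma orbit_equation:
  assumes G: "aut_group G" "finite G"
  defines "P \<equiv> {p. 2 \<le> card (stab G p)}"
  shows "finite P" "(\<Sum>O'\<in>orb G ` P. card G - card O') = 2 * (card G - 1)"
proof -
  have P: "P = (\<Union>g\<in>G - {id}. {x. g x = x})"
    unfolding P_def card_stab_ge_2[OF G] by blast
  have "finite {x. g x = x}" if "g \<in> G - {id}" for g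
    using card_fixed_points[OF G, of g] that card.infinite by fastforce
  then show finP: "finite P" unfolding P using G(2) by blast
  have stab1: "card (stab G p) - 1 = card {g \<in> G - {id}. g p = p}" for p
  proof -
    have "{g \<in> G - {id}. g p = p} = stab G p - {id}" by (auto simp: stab_def)
    then show ?thesis using id_in_stab[OF G(1)] by simp
  qed
  have "(\<Sum>p\<in>P. card {g \<in> G - {id}. g p = p}) = 2 * card (G - {id})"
  proof (rule sum_multicount[OF finP])
    show "\<forall>g\<in>G - {id}. card {p \<in> P. g p = p} = 2"
    proof
      fix g assume g: "g \<in> G - {id}"
      then have "{p \<in> P. g p = p} = {x. g x = x}" unfolding P by blast
      then show "card {p \<in> P. g p = p} = 2" using card_fixed_points[OF G, of g] g by simp
    qed
  qed (use G(2) in simp)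
  moreover have "card (G - {id}) = card G - 1" using aut_groupD(1)[OF G(1)] by simp
  ultimately have dc: "(\<Sum>p\<in>P. card (stab G p) - 1) = 2 * (card G - 1)"
    by (simp only: stab1)
  have orbP: "{x \<in> P. orb G x = orb G p} = orb G p" if "p \<in> P" for p
  proof (intro equalityI subsetI)
    fix x assume "x \<in> {x \<in> P. orb G x = orb G p}"
    then show "x \<in> orb G p" using orb_refl[OF G(1), of x] by simp
  next
    fix x assume x: "x \<in> orb G p"
    then show "x \<in> {x \<in> P. orb G x = orb G p}"
      using orb_eq[OF G(1) x] stab_card_orb[OF G x] that by (simp add: P_def)
  qed
  have "(\<Sum>p\<in>P. card (stab G p) - 1) = (\<Sum>O'\<in>orb G ` P. \<Sum>x\<in>{x \<in> P. orb G x = O'}. card (stab G x) - 1)"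
    by (rule sum.image_gen[OF finP])
  also have "\<dots> = (\<Sum>O'\<in>orb G ` P. card G - card O')"
  proof (rule sum.cong[OF refl])
    fix O' assume "O' \<in> orb G ` P"
    then obtain p where p: "p \<in> P" "O' = orb G p" by blast
    have "(\<Sum>x\<in>{x \<in> P. orb G x = O'}. card (stab G x) - 1) = (\<Sum>x\<in>orb G p. card (stab G p) - 1)"
      unfolding p(2) orbP[OF p(1)] by (rule sum.cong) (auto simp: stab_card_orb[OF G])
    also have "\<dots> = card G - card O'"
      using orbit_stabilizer[OF G, of p] by (simp add: p(2) algebra_simps diff_mult_distrib2)
    finally show "(\<Sum>x\<in>{x \<in> P. orb G x = O'}. card (stab G x) - 1) = card G - card O'" .
  qed
  finally show "(\<Sum>O'\<in>orb G ` P. card G - card O') = 2 * (card G - 1)" using dc by simp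
qed

text \<open>The equation \<open>1/m1 + 1/m2 + 1/m3 = 1 + 2/N\<close> without fractions. If all
  \<open>mi\<close> were at least \<open>3\<close>, or two of them at least \<open>4\<close>, the
  left side would be at most one. For \<open>(2, 3, m3)\<close> it gives
  \<open>6 * o3 = N + 12\<close>, hence \<open>m3 < 6\<close>.\<close>

lemma orbit_arithmetic:
  fixes N :: nat
  assumes "o1 + o2 + o3 = N + 2" "o1 * m1 = N" "o2 * m2 = N" "o3 * m3 = N" "2 \<le> m1" "m1 \<le> m2" "m2 \<le> m3"
  shows "2 * m3 = N \<or> (m1 = 2 \<and> m2 = 3 \<and> (m3, N) \<in> {(3, 12), (4, 24), (5, 60)})"
proof -
  have mono: "o1 * k \<le> N" if "k \<le> m1" for k using assms(2) that by (metis mult_le_mono2)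
  have mono2: "o2 * k \<le> N" if "k \<le> m2" for k using assms(3) that by (metis mult_le_mono2)
  have mono3: "o3 * k \<le> N" if "k \<le> m3" for k using assms(4) that by (metis mult_le_mono2)
  have m1: "m1 = 2"
  proof (rule ccontr)
    assume "m1 \<noteq> 2"
    then have "3 \<le> m1" using assms(5) by simp
    then show False using mono[of 3] mono2[of 3] mono3[of 3] assms by simp
  qed
  have m2: "m2 < 4"
  proof (rule ccontr)
    assume "\<not> m2 < 4"
    then show False using mono2[of 4] mono3[of 4] assms m1 by simp
  qed
  show ?thesis
  proof (cases "m2 = 2")
    case True
    then have "o3 = 2" using assms m1 by simp
    then show ?thesis using assms(4) by simp
  next
    case False
    then have m2: "m2 = 3" using m2 m1 assms(6) by simp
    then have o3: "6 * o3 = N + 12" using assms m1 by simp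
    have "m3 < 6"
    proof (rule ccontr)
      assume "\<not> m3 < 6"
      then show False using mono3[of 6] o3 by simp
    qed
    then have "m3 = 3 \<or> m3 = 4 \<or> m3 = 5" using assms(7) m2 by auto
    then show ?thesis using assms(4) o3 m1 m2 by auto
  qed
qed

text \<open>An exceptional orbit has between \<open>1\<close> and \<open>N/2\<close> points, so it
  contributes between \<open>N/2\<close> and \<open>N - 1\<close> to the total
  \<open>2 * (N - 1)\<close>; there are two or three orbits. Two orbits must be single points, which
  is the cyclic case.\<close>

lemma orbit_types:
  assumes G: "aut_group G" "finite G" and N: "2 \<le> card G"
  obtains p where "card (stab G p) = card G"
  | p where "2 * card (stab G p) = card G" "2 \<le> card (stab G p)"
  | k p2 p3 pk where "(k, card G) \<in> {(3, 12), (4, 24), (5, 60)}"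
    "card (stab G p2) = 2" "card (stab G p3) = 3" "card (stab G pk) = k"
    "\<And>p. 2 \<le> card (stab G p) \<Longrightarrow> p \<in> orb G p2 \<union> orb G p3 \<union> orb G pk"
proof -
  define P where "P = {p. 2 \<le> card (stab G p)}"
  define Om where "Om = orb G ` P"
  let ?N = "card G"
  have finOm: "finite Om" using orbit_equation(1)[OF G] by (simp add: Om_def P_def)
  have eq: "(\<Sum>O'\<in>Om. ?N - card O') = 2 * (?N - 1)"
    using orbit_equation(2)[OF G] by (simp add: Om_def P_def)
  define f where "f = (\<lambda>O' :: cp1 set. ?N div card O')"
  have Om: "\<exists>p. p \<in> P \<and> O' = orb G p \<and> card (stab G p) = f O' \<and> card O' * f O' = ?N \<and> 2 \<le> f O' \<and> 1 \<le> card O' \<and> 2 * card O' \<le> ?N"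
    if O': "O' \<in> Om" for O'
  proof -
    obtain p where p: "p \<in> P" "O' = orb G p" using O' by (auto simp: Om_def)
    have os: "card O' * card (stab G p) = ?N" using orbit_stabilizer[OF G] p(2) by simp
    have pos: "1 \<le> card O'" using os N by (cases "card O'") auto
    then have f: "card (stab G p) = f O'" unfolding f_def os[symmetric] by simp
    have st: "2 \<le> card (stab G p)" using p(1) by (simp add: P_def)
    then have "card O' * 2 \<le> ?N" using os by (metis mult_le_mono2)
    then show ?thesis using p f st os pos by (intro exI[of _ p]) auto
  qed
  have "(\<Sum>O'\<in>Om. ?N - card O') \<le> (\<Sum>O'\<in>Om. ?N - 1)"
    using Om by (intro sum_mono diff_le_mono2) blast
  then have "2 * (?N - 1) \<le> card Om * (?N - 1)" using eq by simp
  then have ge2: "2 \<le> card Om" using N by simp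
  have "(\<Sum>O'\<in>Om. ?N) \<le> (\<Sum>O'\<in>Om. 2 * (?N - card O'))"
  proof (rule sum_mono)
    fix O' assume "O' \<in> Om"
    then show "?N \<le> 2 * (?N - card O')" using Om by fastforce
  qed
  then have "card Om * ?N \<le> 4 * (?N - 1)" using eq by (simp add: sum_distrib_left[symmetric])
  moreover have "4 * (?N - 1) < 4 * ?N" using N by simp
  ultimately have "card Om * ?N < 4 * ?N" by linarith
  then have le3: "card Om < 4" by simp
  obtain xs0 where xs0: "set xs0 = Om" "distinct xs0" using finite_distinct_list[OF finOm] by blast
  \<comment> \<open>Sorting by the order of the stabilizer provides the inequalities that
    \<open>orbit_arithmetic\<close> expects.\<close>
  define xs where "xs = sort_key f xs0"
  have xs: "set xs = Om" "distinct xs" "sorted (map f xs)" "length xs = card Om"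
    using xs0 distinct_card[OF xs0(2)] by (simp_all add: xs_def)
  have "length xs = 2 \<or> length xs = 3" using ge2 le3 xs(4) by linarith
  then show thesis
  proof
    assume "length xs = 2"
    then obtain A B where ab: "xs = [A, B]" by (auto simp: length_Suc_conv numeral_eq_Suc)
    then have Omab: "Om = {A, B}" "A \<noteq> B" using xs(1,2) by auto
    obtain p where p: "card (stab G p) = f A" "card A * f A = ?N" "1 \<le> card A" "2 * card A \<le> ?N"
      using Om[of A] Omab by blast
    have "1 \<le> card B" "2 * card B \<le> ?N" using Om[of B] Omab by blast+
    moreover have "(?N - card A) + (?N - card B) = 2 * (?N - 1)" using eq Omab by simp
    ultimately have "card A = 1" using p(3,4) by linarith
    then show thesis using that(1) p by simp
  next
    assume "length xs = 3"
    then obtain A B C where abc: "xs = [A, B, C]" by (auto simp: length_Suc_conv numeral_eq_Suc)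
    then have Omab: "Om = {A, B, C}" "A \<noteq> B" "A \<noteq> C" "B \<noteq> C" using xs(1,2) by auto
    have srt: "f A \<le> f B" "f B \<le> f C" using xs(3) abc by auto
    obtain a where a: "A = orb G a" "card (stab G a) = f A" "card A * f A = ?N" "2 \<le> f A" "2 * card A \<le> ?N"
      using Om[of A] Omab by blast
    obtain b where b: "B = orb G b" "card (stab G b) = f B" "card B * f B = ?N" "2 * card B \<le> ?N"
      using Om[of B] Omab by blast
    obtain c where c: "C = orb G c" "card (stab G c) = f C" "card C * f C = ?N" "2 \<le> f C" "2 * card C \<le> ?N"
      using Om[of C] Omab by blast
    have "(?N - card A) + ((?N - card B) + (?N - card C)) = 2 * (?N - 1)" using eq Omab by simp
    then have sum: "card A + card B + card C = ?N + 2" using a b c N by linarith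
    from orbit_arithmetic[OF sum a(3) b(3) c(3) a(4) srt] show thesis
    proof
      assume "2 * f C = ?N"
      then show thesis using that(2)[of c] c by simp
    next
      assume h: "f A = 2 \<and> f B = 3 \<and> (f C, ?N) \<in> {(3, 12), (4, 24), (5, 60)}"
      have "p \<in> orb G a \<union> orb G b \<union> orb G c" if "2 \<le> card (stab G p)" for p
      proof -
        have "orb G p \<in> Om" using that by (simp add: Om_def P_def)
        then show ?thesis using Omab(1) orb_refl[OF G(1), of p] a(1) b(1) c(1) by blast
      qed
      then show thesis using that(3)[of "f C" a b c] h a(2) b(2) c(2) by simp
    qed
  qed
qed

text \<open>An element \<open>s\<close> taking \<open>p\<close> to the other end \<open>q\<close> of
  the axis conjugates the common stabilizer into itself, so it must exchange \<open>p\<close> and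
  \<open>q\<close>. In normal position it is of the form \<open>b / (c z)\<close>, and a dilation,
  which commutes with all rotations about the axis, turns it into \<open>1 / z\<close>.\<close>

lemma normal_form_swap:
  assumes G: "aut_group G" "finite G" and m: "2 \<le> card (stab G p)"
    and orb: "\<And>q. q \<noteq> p \<Longrightarrow> stab G q = stab G p \<Longrightarrow> q \<in> orb G p"
  obtains \<eta> where "\<eta> \<in> Aut_cp1" "stab (cj \<eta> ` G) Infty = rot ` {z. z ^ card (stab G p) = 1}"
    "invo \<in> cj \<eta> ` G"
proof -
  obtain \<eta> q where \<eta>: "\<eta> \<in> Aut_cp1" "\<eta> p = Infty" "\<eta> q = Fin 0" and q: "q \<noteq> p" "stab G q = stab G p"
    and fp: "\<forall>h\<in>stab G p. h \<noteq> id \<longrightarrow> {x. h x = x} = {p, q}"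
    and st: "stab (cj \<eta> ` G) Infty = rot ` {z. z ^ card (stab G p) = 1}"
    using normal_form[OF G m] by blast
  obtain s where s: "s \<in> G" "s p = q" using orb[OF q] by (auto simp: orb_def)
  obtain h where h: "h \<in> G" "h \<noteq> id" "h p = p" using m card_stab_ge_2[OF G] by blast
  then have hs: "h \<in> stab G p" by (simp add: stab_def)
  have hq: "h q = q" using fp hs h(2) by blast
  note si = aut_group_inv[OF G(1) s(1)]
  let ?k = "inv_into UNIV s \<circ> h \<circ> s"
  have kG: "?k \<in> G" using aut_groupD(2)[OF G(1)] si(1) h(1) s(1) by simp
  have "?k p = p" using s(2) hq si(3) by (metis comp_apply)
  moreover have "?k \<noteq> id"
  proof
    assume k: "?k = id"
    have "h x = x" for x
    proof -
      have "s (?k (inv_into UNIV s x)) = x" using k si(2) by simp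
      then show ?thesis using si(2) by simp
    qed
    then show False using h(2) by auto
  qed
  moreover have "?k \<in> stab G p" unfolding stab_def using kG \<open>?k p = p\<close> by blast
  ultimately have "{x. ?k x = x} = {p, q}" using fp by blast
  then have "?k q = q" by blast
  then have "h (s q) = s q" using si(2) by (metis comp_apply)
  then have "s q = p \<or> s q = q" using fp hs h(2) by blast
  moreover have "s q \<noteq> q" using s(2) q(1) si(4) by (metis bij_pointE)
  ultimately have sq: "s q = p" by blast
  let ?s = "cj \<eta> s"
  have sA: "?s \<in> Aut_cp1" using cj_Aut[OF \<eta>(1) aut_groupD(4)[OF G(1) s(1)]] .
  obtain a b c d where abcd: "a * d - b * c \<noteq> 0" "?s = mob a b c d" using sA Aut_mob by blast
  have "?s Infty = Fin 0" "?s (Fin 0) = Infty"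
    using cj_apply[OF \<eta>(1), of s] s(2) sq \<eta>(2,3) by metis+
  then have ad: "a = 0" "d = 0"
    using abcd mob_Infty[OF abcd(1)] mob_Fin[OF abcd(1), of 0] by (auto simp: proj_point_def split: if_splits)
  then have bc: "b \<noteq> 0" "c \<noteq> 0" using abcd(1) by auto
  \<comment> \<open>Conjugating \<open>b / (c z)\<close> by multiplication with
    \<open>\<kappa>\<close> multiplies it by the square of \<open>\<kappa>\<close>.\<close>
  define \<kappa> where "\<kappa> = csqrt (c / b)"
  have \<kappa>2: "\<kappa> * \<kappa> = c / b" unfolding \<kappa>_def by (metis power2_csqrt power2_eq_square)
  then have \<kappa>0: "\<kappa> \<noteq> 0" using bc by auto
  have rA: "rot \<kappa> \<in> Aut_cp1" by (rule affine_Aut[OF \<kappa>0])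
  have ri: "inv_into UNIV (rot \<kappa>) = rot (1 / \<kappa>)" using affine_inv[OF \<kappa>0, of 0] by simp
  have "cj (rot \<kappa>) ?s = rot \<kappa> \<circ> mob 0 b c 0 \<circ> rot (1 / \<kappa>)"
    using abcd(2) ad by (simp only: cj_def[of "rot \<kappa>"] ri)
  then have "cj (rot \<kappa>) ?s = mob 0 (\<kappa> * b) (c / \<kappa>) 0"
    using bc \<kappa>0 mob_comp[of \<kappa> 1 0 0 0 0 b c] mob_comp[of 0 0 "\<kappa> * b" c "1 / \<kappa>" 1 0 0]
    by simp
  moreover have "c / \<kappa> = \<kappa> * b" using \<kappa>2 \<kappa>0 bc by (simp add: field_simps)
  ultimately have inv: "cj (rot \<kappa>) ?s = invo"
    using mob_scale[of "\<kappa> * b" 0 1 1 0] \<kappa>0 bc by simp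
  let ?\<eta> = "rot \<kappa> \<circ> \<eta>"
  have A: "?\<eta> \<in> Aut_cp1" by (rule Aut_comp[OF rA \<eta>(1)])
  have img: "cj ?\<eta> ` G = cj (rot \<kappa>) ` cj \<eta> ` G" unfolding image_image cj_cj[OF rA \<eta>(1)] ..
  have comm: "cj (rot \<kappa>) (rot z) = rot z" if "z \<noteq> 0" for z
    unfolding cj_def ri using \<kappa>0 that by (simp add: affine_comp)
  have "stab (cj ?\<eta> ` G) Infty = stab (cj (rot \<kappa>) ` cj \<eta> ` G) (rot \<kappa> Infty)"
    unfolding img using \<kappa>0 by (simp add: affine_apply)
  also have "\<dots> = cj (rot \<kappa>) ` rot ` {z. z ^ card (stab G p) = 1}" unfolding stab_cj[OF rA] st ..
  also have "\<dots> = rot ` {z. z ^ card (stab G p) = 1}"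
  proof -
    have "z \<noteq> 0" if "z ^ card (stab G p) = 1" for z :: complex using that m by (auto simp: power_0_left)
    then show ?thesis unfolding image_image using comm by (intro image_cong) auto
  qed
  finally have "stab (cj ?\<eta> ` G) Infty = rot ` {z. z ^ card (stab G p) = 1}" .
  moreover have "invo \<in> cj ?\<eta> ` G" unfolding img inv[symmetric] using s(1) by blast
  ultimately show thesis using that A by blast
qed

text \<open>Some element has order at least \<open>card G / r\<close>. Phrased by powers, this is
  visibly invariant under isomorphism; \<open>r = 1\<close> detects the cyclic groups, and
  \<open>r = 2\<close> then detects the dihedral ones.\<close>

definition has_element_of_large_order :: "nat \<Rightarrow> (cp1 \<Rightarrow> cp1) set \<Rightarrow> bool" where
  "has_element_of_large_order r G \<longleftrightarrow> (\<exists>g\<in>G. \<forall>j. 0 < j \<and> r * j < card G \<longrightarrow> g ^^ j \<noteq> id)"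

lemma stab_card_ge:
  assumes G: "aut_group G" "finite G" and g: "g \<in> stab G p" "\<And>j. 0 < j \<Longrightarrow> j < k \<Longrightarrow> g ^^ j \<noteq> id"
  shows "k \<le> card (stab G p)"
proof -
  have gG: "g \<in> G" "g p = p" using g(1) by (auto simp: stab_def)
  have injg: "inj (g ^^ i)" for i using aut_group_inv(4)[OF G(1) gG(1)] by (simp add: bij_is_inj inj_fn)
  have powG: "g ^^ j \<in> stab G p" for j
  proof (induction j)
    case 0
    then show ?case using id_in_stab[OF G(1)] by (simp only: funpow.simps(1))
  next
    case (Suc j)
    then have j: "g ^^ j \<in> G" "(g ^^ j) p = p" by (auto simp: stab_def)
    have "g \<circ> g ^^ j \<in> G" by (rule aut_groupD(2)[OF G(1) gG(1) j(1)])
    moreover have "(g \<circ> g ^^ j) p = p" using gG(2) j(2) by simp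
    ultimately show ?case unfolding stab_def funpow.simps by blast
  qed
  have lt: False if ij: "i < j" "j < k" "g ^^ i = g ^^ j" for i j
  proof -
    have "g ^^ j = g ^^ i \<circ> g ^^ (j - i)" using ij(1) funpow_add[of i "j - i" g] by simp
    then have "(g ^^ i) ((g ^^ (j - i)) x) = (g ^^ i) x" for x using ij(3) by (metis comp_apply)
    then have "(g ^^ (j - i)) x = x" for x using injg[of i] by (metis injD)
    then have "g ^^ (j - i) = id" by (simp add: fun_eq_iff)
    then show False using g(2)[of "j - i"] ij by simp
  qed
  have "inj_on (\<lambda>j. g ^^ j) {..<k}"
  proof (rule inj_onI)
    fix i j assume "i \<in> {..<k}" "j \<in> {..<k}" "g ^^ i = g ^^ j"
    then show "i = j" using lt[of i j] lt[of j i] by (metis lessThan_iff linorder_neqE_nat)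
  qed
  then have "card ((\<lambda>j. g ^^ j) ` {..<k}) = k" by (simp add: card_image)
  moreover have "card ((\<lambda>j. g ^^ j) ` {..<k}) \<le> card (stab G p)"
    using powG G(2) by (intro card_mono) (auto simp: stab_def)
  ultimately show ?thesis by simp
qed

section \<open>Cyclic and dihedral groups\<close>

definition cyclic_std :: "nat \<Rightarrow> (cp1 \<Rightarrow> cp1) set" where
  "cyclic_std m = rot ` {z. z ^ m = 1}"

lemma conjugate_cyclic:
  assumes G: "aut_group G" "finite G" and N: "2 \<le> card G" and p: "card (stab G p) = card G"
  shows "\<exists>\<eta>\<in>Aut_cp1. cj \<eta> ` G = cyclic_std (card G)"
proof -
  have "2 \<le> card (stab G p)" using N p by simp
  then obtain \<eta> q where \<eta>: "\<eta> \<in> Aut_cp1" "\<eta> p = Infty" and "\<eta> q = Fin 0" "q \<noteq> p" "stab G q = stab G p"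
    "\<forall>h\<in>stab G p. h \<noteq> id \<longrightarrow> {x. h x = x} = {p, q}"
    and st: "stab (cj \<eta> ` G) Infty = rot ` {z. z ^ card (stab G p) = 1}"
    using normal_form[OF G, of p] by blast
  have "stab G p = G" using card_subset_eq[OF G(2), of "stab G p"] p by (auto simp: stab_def)
  then have "stab (cj \<eta> ` G) Infty = cj \<eta> ` G" using stab_cj[OF \<eta>(1), of G p] \<eta>(2) by simp
  then show ?thesis using \<eta>(1) st p by (auto simp: cyclic_std_def)
qed

text \<open>The orbit of \<open>p\<close> has two points, and the stabilizer fixes the other one as
  well. Hence both ends of the axis lie in one orbit, the swap exists, and the rotations with their
  products by \<open>invo\<close> exhaust the group by counting.\<close>

lemma conjugate_dihedral:
  assumes G: "aut_group G" "finite G" and p: "2 * card (stab G p) = card G" "2 \<le> card (stab G p)"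
  shows "\<exists>\<eta>\<in>Aut_cp1. cj \<eta> ` G =
    cyclic_std (card G div 2) \<union> (\<lambda>g. g \<circ> invo) ` cyclic_std (card G div 2)"
proof -
  define m where "m = card (stab G p)"
  note p = p[folded m_def]
  have os: "card (orb G p) * m = card G" unfolding m_def by (rule orbit_stabilizer[OF G])
  then have "card (orb G p) * m = 2 * m" using p by simp
  then have orb2: "card (orb G p) = 2" using p(2) by simp
  then have "\<exists>r. orb G p = {p, r} \<and> r \<noteq> p"
  proof -
    obtain x y where "orb G p = {x, y}" "x \<noteq> y" using orb2 by (auto simp: card_2_iff)
    then show ?thesis using orb_refl[OF G(1), of p] by auto
  qed
  then obtain r where r: "orb G p = {p, r}" "r \<noteq> p" by blast
  have fr: "g r = r" if g: "g \<in> stab G p" for g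
  proof -
    have gG: "g \<in> G" "g p = p" using g by (auto simp: stab_def)
    have "g r \<in> orb G r" using gG(1) by (auto simp: orb_def)
    then have "g r \<in> {p, r}" using orb_eq[OF G(1), of r p] r(1) by simp
    moreover have "g r \<noteq> p" using gG r(2) aut_group_inv(4)[OF G(1) gG(1)] by (metis bij_pointE)
    ultimately show ?thesis by blast
  qed
  obtain g where g: "g \<in> G" "g \<noteq> id" "g p = p" using p(2) card_stab_ge_2[OF G] unfolding m_def by blast
  then have gs: "g \<in> stab G p" by (simp add: stab_def)
  have "q \<in> orb G p" if "q \<noteq> p" "stab G q = stab G p" for q
  proof -
    have "g q = q" using gs that(2) by (auto simp: stab_def)
    then have "{x. g x = x} = {p, q}"
      using Aut_two_fixed_points[OF aut_groupD(4)[OF G(1) g(1)] g(2) _ g(3)] that(1) by metis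
    then show ?thesis using fr[OF gs] r by blast
  qed
  then obtain \<eta> where \<eta>: "\<eta> \<in> Aut_cp1" "stab (cj \<eta> ` G) Infty = rot ` {z. z ^ m = 1}"
    "invo \<in> cj \<eta> ` G" using normal_form_swap[OF G p(2)[unfolded m_def]] unfolding m_def by metis
  let ?G = "cj \<eta> ` G" and ?R = "cyclic_std m"
  have G': "aut_group ?G" "finite ?G" using aut_group_cj[OF G(1) \<eta>(1)] G(2) by auto
  have R: "?R = stab ?G Infty" using \<eta>(2) by (simp add: cyclic_std_def)
  have cR: "card ?R = m"
  proof -
    have "inj_on rot {z. z ^ m = 1}"
    proof (rule inj_onI)
      fix a b assume "a \<in> {z. z ^ m = 1}" "b \<in> {z. z ^ m = 1}" and e: "rot a = rot b"
      then have "a \<noteq> 0" "b \<noteq> 0" using p(2) by (auto simp: power_0_left)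
      then show "a = b" using fun_cong[OF e, of "Fin 1"] by (simp add: affine_apply)
    qed
    then show ?thesis using card_roots_unity_eq[of m] p(2) by (simp add: cyclic_std_def card_image)
  qed
  have invI: "invo Infty = Fin 0" "invo (Fin 0) = Infty" "invo \<circ> invo = id"
    using mob_Infty[of 0 0 1 1] mob_Fin[of 0 0 1 1 0] mob_comp[of 0 0 1 1 0 0 1 1] mob_id[of 1]
    by (simp_all add: proj_point_def)
  have "inj_on (\<lambda>g. g \<circ> invo) ?R"
  proof (rule inj_onI)
    fix a b assume "a \<circ> invo = b \<circ> invo"
    then show "a = b" using invI(3) by (metis comp_assoc comp_id)
  qed
  then have cR2: "card ((\<lambda>g. g \<circ> invo) ` ?R) = m" using cR by (simp add: card_image)
  have disj: "?R \<inter> (\<lambda>g. g \<circ> invo) ` ?R = {}"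
  proof -
    have "(g \<circ> invo) Infty \<noteq> Infty" if "g \<in> ?R" for g
    proof -
      have "g Infty = Infty" "bij g" using that aut_group_inv(4)[OF G'(1)] by (auto simp: R stab_def)
      then show ?thesis using invI(1) by (metis bij_pointE comp_apply cp1.distinct(1))
    qed
    moreover have "g Infty = Infty" if "g \<in> ?R" for g using that by (simp add: R stab_def)
    ultimately show ?thesis by blast
  qed
  have finR: "finite ?R" using G'(2) by (simp add: R stab_def)
  have "?R \<union> (\<lambda>g. g \<circ> invo) ` ?R \<subseteq> ?G"
    using aut_groupD(2)[OF G'(1) _ \<eta>(3)] by (auto simp: R stab_def)
  moreover have "card (?R \<union> (\<lambda>g. g \<circ> invo) ` ?R) = card ?G"
    using card_Un_disjoint[OF finR _ disj] finR cR cR2 p(1) card_cj[OF \<eta>(1), of G] by simp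
  ultimately have "?R \<union> (\<lambda>g. g \<circ> invo) ` ?R = ?G" using G'(2) by (intro card_subset_eq)
  moreover have "card G div 2 = m" using p(1) by simp
  ultimately show ?thesis using \<eta>(1) by metis
qed

text \<open>The dictionary between isomorphism invariants and orbit types: every element fixes a
  point, and an element of order \<open>m\<close> forces at least \<open>m\<close> elements in the
  stabilizer of that point.\<close>

lemma cyclic_dihedral_orbit_types:
  assumes G: "aut_group G" "finite G" and N: "2 \<le> card G"
  shows "has_element_of_large_order 1 G \<Longrightarrow> \<exists>p. card (stab G p) = card G"
    and "\<not> has_element_of_large_order 1 G \<Longrightarrow> has_element_of_large_order 2 G \<Longrightarrow>
      \<exists>p. 2 * card (stab G p) = card G \<and> 2 \<le> card (stab G p)"
    and "card (stab G p) = card G \<Longrightarrow> has_element_of_large_order 1 G"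
    and "2 * card (stab G p) = card G \<Longrightarrow> 2 \<le> card (stab G p) \<Longrightarrow> has_element_of_large_order 2 G"
proof -
  show c1: "has_element_of_large_order 1 G" if "card (stab G p) = card G" for p
    using stab_exists_order[OF G, of p] N that by (auto simp: has_element_of_large_order_def stab_def)
  show "has_element_of_large_order 2 G" if h: "2 * card (stab G p) = card G" "2 \<le> card (stab G p)"
  proof -
    obtain g where g: "g \<in> stab G p" "\<forall>j. 0 < j \<and> j < card (stab G p) \<longrightarrow> g ^^ j \<noteq> id"
      using stab_exists_order[OF G h(2)] by blast
    then have "\<forall>j. 0 < j \<and> 2 * j < card G \<longrightarrow> g ^^ j \<noteq> id" using h(1) by auto
    then show ?thesis using g(1) unfolding has_element_of_large_order_def stab_def by blast
  qed
  have le: "card (stab G p) \<le> card G" for p using G(2) by (intro card_mono) (auto simp: stab_def)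
  have fixp: "\<exists>p. g \<in> stab G p" if "g \<in> G" for g
    using Aut_has_fixed_point[OF aut_groupD(4)[OF G(1) that]] that by (auto simp: stab_def)
  show "\<exists>p. card (stab G p) = card G" if h: "has_element_of_large_order 1 G"
  proof -
    obtain g where g: "g \<in> G" "\<And>j. 0 < j \<Longrightarrow> j < card G \<Longrightarrow> g ^^ j \<noteq> id"
      using h by (auto simp: has_element_of_large_order_def)
    obtain p where "g \<in> stab G p" using fixp[OF g(1)] by blast
    then show ?thesis using stab_card_ge[OF G _ g(2), of p "card G"] le[of p] by (intro exI[of _ p]) auto
  qed
  show "\<exists>p. 2 * card (stab G p) = card G \<and> 2 \<le> card (stab G p)"
    if n1: "\<not> has_element_of_large_order 1 G" and h: "has_element_of_large_order 2 G"
  proof -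
    obtain g where g: "g \<in> G" "\<And>j. 0 < j \<Longrightarrow> 2 * j < card G \<Longrightarrow> g ^^ j \<noteq> id"
      using h by (auto simp: has_element_of_large_order_def)
    obtain p where p: "g \<in> stab G p" using fixp[OF g(1)] by blast
    have ge: "(card G + 1) div 2 \<le> card (stab G p)" by (rule stab_card_ge[OF G p g(2)]) auto
    have os: "card (orb G p) * card (stab G p) = card G" by (rule orbit_stabilizer[OF G])
    have "card (orb G p) \<noteq> 1" using os c1[of p] n1 by auto
    moreover have "card (orb G p) \<noteq> 0"
    proof
      assume "card (orb G p) = 0"
      then show False using os N by simp
    qed
    ultimately have o2: "2 \<le> card (orb G p)" by simp
    have "2 * card (stab G p) \<le> card G" using os o2 by (metis mult_le_mono1)
    then have eq: "2 * card (stab G p) = card G" using ge by linarith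
    \<comment> \<open>A trivial stabilizer would mean a group of order two, which is cyclic.\<close>
    have "card (stab G p) \<noteq> 1"
    proof
      assume "card (stab G p) = 1"
      then have N2: "card G = 2" using eq by simp
      have "\<exists>g\<in>G. g \<noteq> id"
      proof (rule ccontr)
        assume "\<not> ?thesis"
        then have "G \<subseteq> {id}" by auto
        then have "card G \<le> card {id :: cp1 \<Rightarrow> cp1}" by (intro card_mono) auto
        then show False using N2 by simp
      qed
      then obtain h where "h \<in> G" "h \<noteq> id" by blast
      moreover have "h ^^ j \<noteq> id" if "0 < j" "j < 2" for j
      proof -
        have "j = 1" using that by simp
        then show ?thesis using \<open>h \<noteq> id\<close> by simp
      qed
      ultimately show False using n1 N2 by (auto simp: has_element_of_large_order_def)
    qed
    moreover have "card (stab G p) \<noteq> 0" using eq N by auto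
    ultimately show ?thesis using eq by (intro exI[of _ p]) auto
  qed
qed

subsection \<open>Polyhedral groups in quaternion coordinates\<close>

text \<open>The quaternion \<open>a + b i + c j + d k\<close> acting on the sphere as an element of \<open>SU(2)\<close>, with complex
  coefficients allowed; proportional quaternions act in the same way.\<close>

definition quat :: "complex \<Rightarrow> complex \<Rightarrow> complex \<Rightarrow> complex \<Rightarrow> cp1 \<Rightarrow> cp1" where
  "quat a b c d = mob (a + \<i> * b) (c + \<i> * d) (- c + \<i> * d) (a - \<i> * b)"

abbreviation rquat :: "real \<Rightarrow> real \<Rightarrow> real \<Rightarrow> real \<Rightarrow> cp1 \<Rightarrow> cp1" where
  "rquat a b c d \<equiv> quat (of_real a) (of_real b) (of_real c) (of_real d)"

lemma quat_det: "(a + \<i> * b) * (a - \<i> * b) - (c + \<i> * d) * (- c + \<i> * d) = a\<^sup>2 + b\<^sup>2 + c\<^sup>2 + d\<^sup>2"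
proof -
  have "\<i> * \<i> = (-1 :: complex)" by simp
  then show ?thesis by algebra
qed

lemma quat_comp:
  assumes "a\<^sup>2 + b\<^sup>2 + c\<^sup>2 + d\<^sup>2 \<noteq> 0" "a'\<^sup>2 + b'\<^sup>2 + c'\<^sup>2 + d'\<^sup>2 \<noteq> 0"
  shows "quat a b c d \<circ> quat a' b' c' d' =
    quat (a * a' - b * b' - c * c' - d * d') (a * b' + b * a' + c * d' - d * c')
      (a * c' - b * d' + c * a' + d * b') (a * d' + b * c' - c * b' + d * a')"
proof -
  have i: "\<i> * \<i> = (-1 :: complex)" by simp
  have e: "(a + \<i> * b) * (a' + \<i> * b') + (c + \<i> * d) * (- c' + \<i> * d') =
      (a * a' - b * b' - c * c' - d * d') + \<i> * (a * b' + b * a' + c * d' - d * c')"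
    "(a + \<i> * b) * (c' + \<i> * d') + (c + \<i> * d) * (a' - \<i> * b') =
      (a * c' - b * d' + c * a' + d * b') + \<i> * (a * d' + b * c' - c * b' + d * a')"
    "(- c + \<i> * d) * (a' + \<i> * b') + (a - \<i> * b) * (- c' + \<i> * d') =
      - (a * c' - b * d' + c * a' + d * b') + \<i> * (a * d' + b * c' - c * b' + d * a')"
    "(- c + \<i> * d) * (c' + \<i> * d') + (a - \<i> * b) * (a' - \<i> * b') =
      (a * a' - b * b' - c * c' - d * d') - \<i> * (a * b' + b * a' + c * d' - d * c')"
    using i by algebra+
  have n: "(a + \<i> * b) * (a - \<i> * b) - (c + \<i> * d) * (- c + \<i> * d) \<noteq> 0"
    "(a' + \<i> * b') * (a' - \<i> * b') - (c' + \<i> * d') * (- c' + \<i> * d') \<noteq> 0"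
    unfolding quat_det by (rule assms)+
  show ?thesis unfolding quat_def mob_comp[OF n] e ..
qed

lemma quat_scale: "k \<noteq> 0 \<Longrightarrow> quat (k * a) (k * b) (k * c) (k * d) = quat a b c d"
  using mob_scale[of k "a + \<i> * b" "c + \<i> * d" "- c + \<i> * d" "a - \<i> * b"]
  by (simp add: quat_def algebra_simps)

lemma quat_uminus: "quat (- a) (- b) (- c) (- d) = quat a b c d"
  using quat_scale[of "-1" a b c d] by simp

lemma quat_eq_idD:
  assumes "a\<^sup>2 + b\<^sup>2 + c\<^sup>2 + d\<^sup>2 \<noteq> 0" "quat a b c d = id"
  shows "b = 0" "c = 0" "d = 0"
proof -
  have n: "(a + \<i> * b) * (a - \<i> * b) - (c + \<i> * d) * (- c + \<i> * d) \<noteq> 0"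
    unfolding quat_det by (rule assms)
  have e: "c + \<i> * d = 0" "- c + \<i> * d = 0" "a + \<i> * b = a - \<i> * b"
    using mob_eq_idD[OF n] assms(2) by (simp_all add: quat_def)
  have "2 * (\<i> * d) = (c + \<i> * d) + (- c + \<i> * d)" by simp
  then show "d = 0" using e(1,2) by simp
  then show "c = 0" using e(1) by simp
  show "b = 0" using e(3) by simp
qed

lemma quat_id: "quat 2 0 0 0 = id"
  using mob_id[of 2] by (simp add: quat_def)

lemma Aut_quat:
  assumes "g \<in> Aut_cp1"
  obtains a b c d where "a\<^sup>2 + b\<^sup>2 + c\<^sup>2 + d\<^sup>2 = 4" "g = quat a b c d"
proof -
  obtain p q r s where g: "p * s - q * r \<noteq> 0" "g = mob p q r s" using assms Aut_mob by blast
  define u where "u = csqrt (p * s - q * r)"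
  have uu: "u * u = p * s - q * r" unfolding u_def by (metis power2_csqrt power2_eq_square)
  then have "u \<noteq> 0" using g(1) by auto
  \<comment> \<open>Rescaling the matrix by \<open>2 / u\<close> gives it determinant
    \<open>4\<close>, the norm of twice a unit quaternion.\<close>
  define k where "k = 2 / u"
  have "k * k * (u * u) = 4" using \<open>u \<noteq> 0\<close> by (simp add: k_def)
  then have k2: "k * k * (p * s - q * r) = 4" by (simp only: uu)
  have k0: "k \<noteq> 0" using k2 by auto
  define a b c d where "a = k * (p + s) / 2" and "b = - \<i> * k * (p - s) / 2"
    and "c = k * (q - r) / 2" and "d = - \<i> * k * (q + r) / 2"
  have i: "\<i> * \<i> = (-1 :: complex)" by simp
  have e: "a + \<i> * b = k * p" "a - \<i> * b = k * s" "c + \<i> * d = k * q" "- c + \<i> * d = k * r"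
    unfolding a_def b_def c_def d_def using i by (simp_all add: field_simps)
  have "a\<^sup>2 + b\<^sup>2 + c\<^sup>2 + d\<^sup>2 = 4" unfolding quat_det[symmetric] e using k2 by (simp add: algebra_simps)
  moreover have "g = quat a b c d" unfolding quat_def e g(2) mob_scale[OF k0] ..
  ultimately show ?thesis using that by blast
qed

text \<open>Powers of \<open>a + v\<close> stay in the plane spanned by \<open>1\<close> and \<open>v\<close>, where \<open>v\<close> is the imaginary part.\<close>

lemma quat_power_step:
  assumes n: "a\<^sup>2 + b\<^sup>2 + c\<^sup>2 + d\<^sup>2 = 4" and nz: "x\<^sup>2 + y\<^sup>2 * (4 - a\<^sup>2) \<noteq> 0"
  shows "quat a b c d \<circ> quat x (y * b) (y * c) (y * d) =
      quat (a * x - y * (4 - a\<^sup>2)) ((x + a * y) * b) ((x + a * y) * c) ((x + a * y) * d)"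
    and "(a * x - y * (4 - a\<^sup>2))\<^sup>2 + (x + a * y)\<^sup>2 * (4 - a\<^sup>2) \<noteq> 0"
proof -
  have v: "b\<^sup>2 + c\<^sup>2 + d\<^sup>2 = 4 - a\<^sup>2" using n by (simp add: algebra_simps)
  have n2: "x\<^sup>2 + (y * b)\<^sup>2 + (y * c)\<^sup>2 + (y * d)\<^sup>2 = x\<^sup>2 + y\<^sup>2 * (4 - a\<^sup>2)"
    unfolding v[symmetric] by (simp add: algebra_simps power_mult_distrib)
  have e: "a * x - b * (y * b) - c * (y * c) - d * (y * d) = a * x - y * (4 - a\<^sup>2)"
    unfolding v[symmetric] by (simp add: algebra_simps power2_eq_square)
  have e2: "a * (y * b) + b * x + c * (y * d) - d * (y * c) = (x + a * y) * b"
    "a * (y * c) - b * (y * d) + c * x + d * (y * b) = (x + a * y) * c"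
    "a * (y * d) + b * (y * c) - c * (y * b) + d * x = (x + a * y) * d"
    by (simp_all add: algebra_simps)
  show "quat a b c d \<circ> quat x (y * b) (y * c) (y * d) =
      quat (a * x - y * (4 - a\<^sup>2)) ((x + a * y) * b) ((x + a * y) * c) ((x + a * y) * d)"
  proof -
    have "a\<^sup>2 + b\<^sup>2 + c\<^sup>2 + d\<^sup>2 \<noteq> 0" using n by simp
    moreover have "x\<^sup>2 + (y * b)\<^sup>2 + (y * c)\<^sup>2 + (y * d)\<^sup>2 \<noteq> 0" unfolding n2 by (rule nz)
    ultimately show ?thesis using quat_comp[of a b c d x "y * b" "y * c" "y * d"] unfolding e e2 by blast
  qed
  have "(a * x - y * (4 - a\<^sup>2))\<^sup>2 + (x + a * y)\<^sup>2 * (4 - a\<^sup>2) = 4 * (x\<^sup>2 + y\<^sup>2 * (4 - a\<^sup>2))"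
    by (simp add: power2_eq_square algebra_simps)
  then show "(a * x - y * (4 - a\<^sup>2))\<^sup>2 + (x + a * y)\<^sup>2 * (4 - a\<^sup>2) \<noteq> 0"
    using nz by (metis mult_eq_0_iff zero_neq_numeral)
qed

text \<open>The pair \<open>(x, y)\<close> stands for \<open>x + y v\<close>, and the recursion uses
  that \<open>v\<close> squares to \<open>a\<^sup>2 - 4\<close>. With
  \<open>a = 2 cos \<theta>\<close> the second component is
  \<open>2^n * sin (n \<theta>) / sin \<theta>\<close>, a Chebyshev polynomial in \<open>a\<close>.
  The start is \<open>2\<close>, the identity in norm \<open>4\<close>; powers are not
  renormalized.\<close>

fun qpow :: "complex \<Rightarrow> nat \<Rightarrow> complex \<times> complex" where
  "qpow a 0 = (2, 0)"
| "qpow a (Suc n) = (let (x, y) = qpow a n in (a * x - y * (4 - a\<^sup>2), x + a * y))"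

lemma quat_funpow:
  assumes n: "a\<^sup>2 + b\<^sup>2 + c\<^sup>2 + d\<^sup>2 = 4"
  shows "quat a b c d ^^ n = quat (fst (qpow a n)) (snd (qpow a n) * b) (snd (qpow a n) * c) (snd (qpow a n) * d)
    \<and> (fst (qpow a n))\<^sup>2 + (snd (qpow a n))\<^sup>2 * (4 - a\<^sup>2) \<noteq> 0"
proof (induction n)
  case 0
  show ?case by (simp only: funpow.simps qpow.simps fst_conv snd_conv mult_zero_left quat_id) simp
next
  case (Suc n)
  obtain x y where xy: "qpow a n = (x, y)" by fastforce
  then have nz: "x\<^sup>2 + y\<^sup>2 * (4 - a\<^sup>2) \<noteq> 0"
    and IH: "quat a b c d ^^ n = quat x (y * b) (y * c) (y * d)" using Suc by auto
  have q: "qpow a (Suc n) = (a * x - y * (4 - a\<^sup>2), x + a * y)" using xy by simp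
  show ?case
    unfolding q funpow.simps IH fst_conv snd_conv using quat_power_step[OF n nz] by blast
qed

lemma quat_finite_order:
  assumes n: "a\<^sup>2 + b\<^sup>2 + c\<^sup>2 + d\<^sup>2 = 4" and "quat a b c d ^^ m = id"
  shows "snd (qpow a m) = 0 \<or> a\<^sup>2 = 4"
proof (rule ccontr)
  let ?x = "fst (qpow a m)" and ?y = "snd (qpow a m)"
  assume "\<not> ?thesis"
  then have y: "?y \<noteq> 0" and a: "a\<^sup>2 \<noteq> 4" by auto
  have v: "b\<^sup>2 + c\<^sup>2 + d\<^sup>2 = 4 - a\<^sup>2" using n by (simp add: algebra_simps)
  have "?x\<^sup>2 + (?y * b)\<^sup>2 + (?y * c)\<^sup>2 + (?y * d)\<^sup>2 = ?x\<^sup>2 + ?y\<^sup>2 * (4 - a\<^sup>2)"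
    unfolding v[symmetric] by (simp add: algebra_simps power_mult_distrib)
  then have nz: "?x\<^sup>2 + (?y * b)\<^sup>2 + (?y * c)\<^sup>2 + (?y * d)\<^sup>2 \<noteq> 0"
    using quat_funpow[OF n, of m] by (simp only: not_False_eq_True)
  have "quat ?x (?y * b) (?y * c) (?y * d) = id" using quat_funpow[OF n, of m] assms(2) by simp
  then have "b = 0" "c = 0" "d = 0" using quat_eq_idD[OF nz] y by auto
  then show False using v a by simp
qed

text \<open>The golden ratio \<open>2 * cos (pi / 5)\<close>. The squared traces in order five are
  \<open>gr + 1\<close>, the square of \<open>gr\<close>, and \<open>2 - gr\<close>, the square of
  \<open>gr - 1\<close>.\<close>

definition gr :: real where "gr = (1 + sqrt 5) / 2"

lemma gr_square: "gr * gr = gr + 1"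
  by (simp add: gr_def field_simps)

text \<open>Once squares are reduced by \<open>gr_square\<close>, everything is linear in
  \<open>gr\<close>, and these bounds suffice for linear arithmetic to refute the unwanted
  coincidences.\<close>

lemma gr_bounds: "1.618 < gr" "gr < 1.6181"
proof -
  have "2.236 < sqrt 5" by (rule real_less_rsqrt) (simp add: power2_eq_square)
  then show "1.618 < gr" by (simp add: gr_def)
  have "sqrt 5 < 2.2362" by (rule real_less_lsqrt) (simp_all add: power2_eq_square)
  then show "gr < 1.6181" by (simp add: gr_def)
qed

text \<open>The squared traces of the elements of order dividing \<open>2\<close>, \<open>3\<close> or \<open>k\<close>. For a quaternion of norm
  \<open>4\<close>, that is, twice a unit, the trace of the unit is the first coordinate.\<close>

definition traces :: "nat \<Rightarrow> real set" where
  "traces k = {0, 1, 4} \<union> (if k = 4 then {2} else if k = 5 then {gr + 1, 2 - gr} else {})"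

lemma quat_traces:
  assumes n: "a\<^sup>2 + b\<^sup>2 + c\<^sup>2 + d\<^sup>2 = 4" and k: "k \<in> {3, 4, 5}"
    and g: "g = quat a b c d" "g = id \<or> g ^^ 2 = id \<or> g ^^ 3 = id \<or> g ^^ k = id"
  shows "\<exists>t\<in>traces k. a\<^sup>2 = of_real t"
proof -
  have p1: "qpow a 1 = (2 * a, 2)" by simp
  have p2: "snd (qpow a 2) = 4 * a" by (simp add: numeral_eq_Suc)
  have p3: "snd (qpow a 3) = 8 * (a\<^sup>2 - 1)" by (simp add: numeral_eq_Suc algebra_simps power2_eq_square)
  have p4: "snd (qpow a 4) = 16 * (a * (a\<^sup>2 - 2))" by (simp add: numeral_eq_Suc algebra_simps power2_eq_square)
  have p5: "snd (qpow a 5) = 32 * ((a\<^sup>2)\<^sup>2 - 3 * a\<^sup>2 + 1)" by (simp add: numeral_eq_Suc algebra_simps power2_eq_square)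
  have id4: "a\<^sup>2 = 4" if "g = id"
  proof -
    have "b = 0" "c = 0" "d = 0" using quat_eq_idD[of a b c d] that g(1) n by auto
    then show ?thesis using n by simp
  qed
  have o2: "a\<^sup>2 = 0 \<or> a\<^sup>2 = 4" if "g ^^ 2 = id" using quat_finite_order[OF n, of 2] that g(1) p2 by auto
  have o3: "a\<^sup>2 = 1 \<or> a\<^sup>2 = 4" if "g ^^ 3 = id" using quat_finite_order[OF n, of 3] that g(1) p3 by auto
  have o4: "a\<^sup>2 = 0 \<or> a\<^sup>2 = 2 \<or> a\<^sup>2 = 4" if "g ^^ 4 = id" using quat_finite_order[OF n, of 4] that g(1) p4 by auto
  have o5: "a\<^sup>2 = of_real (gr + 1) \<or> a\<^sup>2 = of_real (2 - gr) \<or> a\<^sup>2 = 4" if "g ^^ 5 = id"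
  proof (cases "a\<^sup>2 = 4")
    case False
    then have "32 * ((a\<^sup>2)\<^sup>2 - 3 * a\<^sup>2 + 1) = 0" using quat_finite_order[OF n, of 5] that g(1) p5 by metis
    then have "(a\<^sup>2)\<^sup>2 - 3 * a\<^sup>2 + 1 = 0" by (metis mult_eq_0_iff zero_neq_numeral)
    \<comment> \<open>The defining equation of \<open>gr\<close> splits the quadratic equation for
      the squared trace into its two roots.\<close>
    moreover have "complex_of_real gr * complex_of_real gr = complex_of_real gr + 1"
      using gr_square by (metis of_real_1 of_real_add of_real_mult)
    ultimately have "(a\<^sup>2 - (complex_of_real gr + 1)) * (a\<^sup>2 - (2 - complex_of_real gr)) = 0" by algebra
    then show ?thesis by auto
  qed simp
  consider "g = id" | "g ^^ 2 = id" | "g ^^ 3 = id" | "k = 4" "g ^^ 4 = id" | "k = 5" "g ^^ 5 = id"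
    using g(2) k by auto
  then show ?thesis
  proof cases
    case 1
    then show ?thesis using id4 by (intro bexI[of _ 4]) (auto simp: traces_def)
  next
    case 2
    then show ?thesis using o2 by (auto simp: traces_def)
  next
    case 3
    then show ?thesis using o3 by (auto simp: traces_def)
  next
    case 4
    then show ?thesis using o4 by (auto simp: traces_def)
  next
    case 5
    then show ?thesis using o5 by (auto simp: traces_def)
  qed
qed

lemma traces_nonneg: "t \<in> traces k \<Longrightarrow> 0 \<le> t"
  using gr_bounds by (auto simp: traces_def split: if_splits)

text \<open>What remains of a group after normalization: its order, the possible orders of its
  elements, and the half turns \<open>- z\<close> and \<open>1 / z\<close>, which as quaternions are
  \<open>i\<close> and \<open>k\<close> and generate the Klein four-group.\<close>

definition polyhedral :: "nat \<Rightarrow> (cp1 \<Rightarrow> cp1) set \<Rightarrow> bool" where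
  "polyhedral k G \<longleftrightarrow> aut_group G \<and> finite G \<and> (k, card G) \<in> {(3, 12), (4, 24), (5, 60)} \<and>
     (\<forall>g\<in>G. g = id \<or> g ^^ 2 = id \<or> g ^^ 3 = id \<or> g ^^ k = id) \<and>
     rquat 0 1 0 0 \<in> G \<and> rquat 0 0 0 1 \<in> G"

lemma polyhedralD:
  assumes "polyhedral k G"
  shows "aut_group G" "finite G" "k \<in> {3, 4, 5}" "(k, card G) \<in> {(3, 12), (4, 24), (5, 60)}"
    "g \<in> G \<Longrightarrow> g = id \<or> g ^^ 2 = id \<or> g ^^ 3 = id \<or> g ^^ k = id"
    "rquat 0 1 0 0 \<in> G" "rquat 0 0 0 1 \<in> G"
  using assms by (auto simp: polyhedral_def)

lemma rquat_norm_nonzero: "a\<^sup>2 + b\<^sup>2 + c\<^sup>2 + d\<^sup>2 = r \<Longrightarrow> r \<noteq> 0 \<Longrightarrow>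
   (complex_of_real a)\<^sup>2 + (complex_of_real b)\<^sup>2 + (complex_of_real c)\<^sup>2 + (complex_of_real d)\<^sup>2 \<noteq> 0"
proof -
  assume "a\<^sup>2 + b\<^sup>2 + c\<^sup>2 + d\<^sup>2 = r" "r \<noteq> 0"
  moreover have "(complex_of_real a)\<^sup>2 + (complex_of_real b)\<^sup>2 + (complex_of_real c)\<^sup>2 + (complex_of_real d)\<^sup>2
      = of_real (a\<^sup>2 + b\<^sup>2 + c\<^sup>2 + d\<^sup>2)" by simp
  ultimately show ?thesis by (simp only: of_real_eq_0_iff not_False_eq_True)
qed

lemma rquat_comp:
  assumes "a\<^sup>2 + b\<^sup>2 + c\<^sup>2 + d\<^sup>2 = r" "r \<noteq> 0" "a'\<^sup>2 + b'\<^sup>2 + c'\<^sup>2 + d'\<^sup>2 = r'" "r' \<noteq> 0"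
  shows "rquat a b c d \<circ> rquat a' b' c' d' =
    rquat (a * a' - b * b' - c * c' - d * d') (a * b' + b * a' + c * d' - d * c')
      (a * c' - b * d' + c * a' + d * b') (a * d' + b * c' - c * b' + d * a')"
  using quat_comp[OF rquat_norm_nonzero[OF assms(1,2)] rquat_norm_nonzero[OF assms(3,4)]] by simp

lemma rquat_scale: "k \<noteq> 0 \<Longrightarrow> rquat (k * a) (k * b) (k * c) (k * d) = rquat a b c d"
  using quat_scale[of "of_real k"] by simp

lemma rquat_uminus: "rquat (- a) (- b) (- c) (- d) = rquat a b c d"
  using quat_uminus by simp

text \<open>Multiplication by \<open>i\<close>, \<open>j\<close> or \<open>k\<close> brings any
  chosen coordinate to the first place up to sign, where it is a trace.\<close>

lemma left_mult:
  assumes "a\<^sup>2 + b\<^sup>2 + c\<^sup>2 + d\<^sup>2 = (4 :: complex)"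
  shows "rquat 0 1 0 0 \<circ> quat a b c d = quat (- b) a (- d) c"
    "rquat 0 0 1 0 \<circ> quat a b c d = quat (- c) d a (- b)"
    "rquat 0 0 0 1 \<circ> quat a b c d = quat (- d) (- c) b a"
  using assms by (simp_all add: quat_comp)

lemma polyhedral_J:
  assumes "polyhedral k G"
  shows "rquat 0 0 1 0 \<in> G"
proof -
  have "rquat 0 0 0 1 \<circ> rquat 0 1 0 0 = rquat 0 0 1 0" by (subst rquat_comp[of _ _ _ _ 1 _ _ _ _ 1]) simp_all
  then show ?thesis using aut_groupD(2)[OF polyhedralD(1,7,6)[OF assms]] by simp
qed

lemma quat_coordinates:
  assumes P: "polyhedral k G" and n: "a\<^sup>2 + b\<^sup>2 + c\<^sup>2 + d\<^sup>2 = 4" and g: "quat a b c d \<in> G"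
  shows "(\<exists>t\<in>traces k. a\<^sup>2 = of_real t) \<and> (\<exists>t\<in>traces k. b\<^sup>2 = of_real t) \<and>
    (\<exists>t\<in>traces k. c\<^sup>2 = of_real t) \<and> (\<exists>t\<in>traces k. d\<^sup>2 = of_real t)"
proof -
  note D = polyhedralD[OF P]
  have tr: "\<exists>t\<in>traces k. x\<^sup>2 = of_real t"
    if "x\<^sup>2 + y\<^sup>2 + z\<^sup>2 + w\<^sup>2 = 4" "quat x y z w \<in> G" for x y z w
    using quat_traces[OF that(1) D(3) refl D(5)[OF that(2)]] .
  have cl: "h \<circ> quat a b c d \<in> G" if "h \<in> G" for h using aut_groupD(2)[OF D(1) that g] .
  have "\<exists>t\<in>traces k. (- b)\<^sup>2 = of_real t"
    by (rule tr[of _ a "- d" c]) (use cl[OF D(6)] left_mult(1)[OF n] n in \<open>simp_all add: algebra_simps\<close>)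
  moreover have "\<exists>t\<in>traces k. (- c)\<^sup>2 = of_real t"
    by (rule tr[of _ d a "- b"]) (use cl[OF polyhedral_J[OF P]] left_mult(2)[OF n] n in \<open>simp_all add: algebra_simps\<close>)
  moreover have "\<exists>t\<in>traces k. (- d)\<^sup>2 = of_real t"
    by (rule tr[of _ "- c" b a]) (use cl[OF D(7)] left_mult(3)[OF n] n in \<open>simp_all add: algebra_simps\<close>)
  ultimately show ?thesis using tr[OF n g] by simp
qed

lemma real_of_square:
  assumes "x\<^sup>2 = complex_of_real t" "0 \<le> t"
  obtains r where "x = of_real r" "r\<^sup>2 = t"
proof -
  have "x\<^sup>2 = (complex_of_real (sqrt t))\<^sup>2" using assms by (simp flip: of_real_power)
  then have "x = of_real (sqrt t) \<or> x = of_real (- sqrt t)" by (auto simp: power2_eq_iff)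
  then show ?thesis using that[of "sqrt t"] that[of "- sqrt t"] assms(2) by auto
qed

lemma polyhedral_coordinates:
  assumes P: "polyhedral k G" and n: "a\<^sup>2 + b\<^sup>2 + c\<^sup>2 + d\<^sup>2 = (4 :: real)" and g: "rquat a b c d \<in> G"
  shows "a\<^sup>2 \<in> traces k" "b\<^sup>2 \<in> traces k" "c\<^sup>2 \<in> traces k" "d\<^sup>2 \<in> traces k"
proof -
  have "(complex_of_real a)\<^sup>2 + (complex_of_real b)\<^sup>2 + (complex_of_real c)\<^sup>2 + (complex_of_real d)\<^sup>2 = 4"
  proof -
    have "(complex_of_real a)\<^sup>2 + (complex_of_real b)\<^sup>2 + (complex_of_real c)\<^sup>2 + (complex_of_real d)\<^sup>2
      = of_real (a\<^sup>2 + b\<^sup>2 + c\<^sup>2 + d\<^sup>2)" by simp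
    then show ?thesis unfolding n by simp
  qed
  from quat_coordinates[OF P this g]
  show "a\<^sup>2 \<in> traces k" "b\<^sup>2 \<in> traces k" "c\<^sup>2 \<in> traces k" "d\<^sup>2 \<in> traces k"
    by (metis of_real_eq_iff of_real_power)+
qed

text \<open>The squares of the complex coordinates belong to a finite set of nonnegative reals, so
  the coordinates are real and the group consists of rotations.\<close>

lemma polyhedral_rquat:
  assumes P: "polyhedral k G" and g: "g \<in> G"
  obtains a b c d where "g = rquat a b c d" "a\<^sup>2 + b\<^sup>2 + c\<^sup>2 + d\<^sup>2 = 4"
    "a\<^sup>2 \<in> traces k" "b\<^sup>2 \<in> traces k" "c\<^sup>2 \<in> traces k" "d\<^sup>2 \<in> traces k"
proof -
  obtain a b c d where n: "a\<^sup>2 + b\<^sup>2 + c\<^sup>2 + d\<^sup>2 = 4" and q: "g = quat a b c d"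
    using Aut_quat aut_groupD(4)[OF polyhedralD(1)[OF P] g] by blast
  have co: "(\<exists>t\<in>traces k. a\<^sup>2 = of_real t) \<and> (\<exists>t\<in>traces k. b\<^sup>2 = of_real t) \<and>
    (\<exists>t\<in>traces k. c\<^sup>2 = of_real t) \<and> (\<exists>t\<in>traces k. d\<^sup>2 = of_real t)"
    using quat_coordinates[OF P n] g q by simp
  have re: "\<exists>r. x = complex_of_real r \<and> r\<^sup>2 \<in> traces k" if "\<exists>t\<in>traces k. x\<^sup>2 = of_real t" for x
    using that real_of_square traces_nonneg by metis
  obtain a' where ra: "a = of_real a'" "a'\<^sup>2 \<in> traces k" using re[of a] co by blast
  obtain b' where rb: "b = of_real b'" "b'\<^sup>2 \<in> traces k" using re[of b] co by blast
  obtain c' where rc: "c = of_real c'" "c'\<^sup>2 \<in> traces k" using re[of c] co by blast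
  obtain d' where rd: "d = of_real d'" "d'\<^sup>2 \<in> traces k" using re[of d] co by blast
  note r = ra(1) rb(1) rc(1) rd(1) ra(2) rb(2) rc(2) rd(2)
  have "complex_of_real (a'\<^sup>2 + b'\<^sup>2 + c'\<^sup>2 + d'\<^sup>2) = of_real 4" using n r by simp
  then have "a'\<^sup>2 + b'\<^sup>2 + c'\<^sup>2 + d'\<^sup>2 = 4" by (simp only: of_real_eq_iff)
  then show ?thesis using that r q by blast
qed

section \<open>Tetrahedral groups\<close>

definition rq :: "real \<times> real \<times> real \<times> real \<Rightarrow> cp1 \<Rightarrow> cp1" where
  "rq = (\<lambda>(a, b, c, d). rquat a b c d)"

text \<open>The lists \<open>std3\<close>, \<open>d8\<close>, \<open>std4\<close> and \<open>ico_list\<close> below contain one quaternion of norm \<open>4\<close> from each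
  pair of opposite ones.\<close>

definition std3 :: "(real \<times> real \<times> real \<times> real) list" where
  "std3 = [(2, 0, 0, 0), (0, 2, 0, 0), (0, 0, 2, 0), (0, 0, 0, 2),
     (1, 1, 1, 1), (1, 1, 1, -1), (1, 1, -1, 1), (1, 1, -1, -1),
     (1, -1, 1, 1), (1, -1, 1, -1), (1, -1, -1, 1), (1, -1, -1, -1)]"

lemma rq_memI:
  assumes "(a, b, c, d) \<in> set L \<or> (- a, - b, - c, - d) \<in> set L"
  shows "rquat a b c d \<in> rq ` set L"
proof -
  have "rquat a b c d = rq (a, b, c, d)" "rquat a b c d = rq (- a, - b, - c, - d)"
    using rquat_uminus[of a b c d] by (simp_all add: rq_def)
  then show ?thesis using assms by (metis imageI)
qed

lemma square_values: "x\<^sup>2 = 0 \<longleftrightarrow> x = 0" "x\<^sup>2 = 1 \<longleftrightarrow> x = 1 \<or> x = -1" "x\<^sup>2 = 4 \<longleftrightarrow> x = 2 \<or> x = -2"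
  for x :: real
proof -
  show "x\<^sup>2 = 4 \<longleftrightarrow> x = 2 \<or> x = -2" using power2_eq_iff[of x 2] by simp
qed (auto simp: power2_eq_1_iff)

lemma std3_memI:
  assumes "(a\<^sup>2, b\<^sup>2, c\<^sup>2, d\<^sup>2) \<in> {(4, 0, 0, 0), (0, 4, 0, 0), (0, 0, 4, 0), (0, 0, 0, 4), (1, 1, 1, 1)}"
  shows "rquat a b c d \<in> rq ` set std3"
proof (rule rq_memI)
  consider "a\<^sup>2 = 4" "b\<^sup>2 = 0" "c\<^sup>2 = 0" "d\<^sup>2 = 0" | "a\<^sup>2 = 0" "b\<^sup>2 = 4" "c\<^sup>2 = 0" "d\<^sup>2 = 0"
    | "a\<^sup>2 = 0" "b\<^sup>2 = 0" "c\<^sup>2 = 4" "d\<^sup>2 = 0" | "a\<^sup>2 = 0" "b\<^sup>2 = 0" "c\<^sup>2 = 0" "d\<^sup>2 = 4"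
    | "a\<^sup>2 = 1" "b\<^sup>2 = 1" "c\<^sup>2 = 1" "d\<^sup>2 = 1"
    using assms unfolding insert_iff prod.inject empty_iff by blast
  then show "(a, b, c, d) \<in> set std3 \<or> (- a, - b, - c, - d) \<in> set std3"
    by cases (unfold square_values, (elim disjE; simp add: std3_def)+)
qed

lemma card_rq_le: "card (rq ` set L) \<le> length L"
  using card_image_le[of "set L" rq] card_length[of L] by simp

text \<open>Four numbers from \<open>{0, 1, 4}\<close> with sum \<open>4\<close> are a single
  \<open>4\<close> or four ones. Up to a common sign this leaves twelve quaternions, as many as the
  group has elements.\<close>

lemma tetrahedral_standard:
  assumes P: "polyhedral 3 G"
  shows "G = rq ` set std3"
proof (rule card_seteq)
  show "G \<subseteq> rq ` set std3"
  proof
    fix g assume "g \<in> G"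
    then obtain a b c d where g: "g = rquat a b c d" and n: "a\<^sup>2 + b\<^sup>2 + c\<^sup>2 + d\<^sup>2 = 4"
      and t: "a\<^sup>2 \<in> traces 3" "b\<^sup>2 \<in> traces 3" "c\<^sup>2 \<in> traces 3" "d\<^sup>2 \<in> traces 3"
      using polyhedral_rquat[OF P] by metis
    have cases: "(A, B, C, D) \<in> {(4, 0, 0, 0), (0, 4, 0, 0), (0, 0, 4, 0), (0, 0, 0, 4), (1, 1, 1, 1)}"
      if "A + B + C + D = (4::real)" "A \<in> {0, 1, 4}" "B \<in> {0, 1, 4}" "C \<in> {0, 1, 4}" "D \<in> {0, 1, 4}" for A B C D
      using that by (elim insertE emptyE) simp_all
    have "traces 3 = {0, 1, 4}" by (simp add: traces_def)
    then show "g \<in> rq ` set std3" unfolding g using t by (intro std3_memI cases[OF n]) simp_all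
  qed
  have "card G = 12" using polyhedralD(4)[OF P] by auto
  then show "card (rq ` set std3) \<le> card G" using card_rq_le[of std3] by (simp add: std3_def)
qed simp

lemma rquat_inverse_mem:
  assumes G: "aut_group G" and n: "a\<^sup>2 + b\<^sup>2 + c\<^sup>2 + d\<^sup>2 = 4" and g: "rquat a b c d \<in> G"
  shows "rquat a (- b) (- c) (- d) \<in> G"
proof -
  let ?f = "rquat a b c d" and ?g = "rquat a (- b) (- c) (- d)"
  have "a * a - b * - b - c * - c - d * - d = 4" using n by (simp add: power2_eq_square)
  moreover have "a\<^sup>2 + (- b)\<^sup>2 + (- c)\<^sup>2 + (- d)\<^sup>2 = 4" using n by simp
  ultimately have "?f \<circ> ?g = rquat 4 0 0 0"
    using rquat_comp[OF n _ \<open>a\<^sup>2 + (- b)\<^sup>2 + (- c)\<^sup>2 + (- d)\<^sup>2 = 4\<close>] by (simp add: algebra_simps)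
  also have "\<dots> = id" using quat_scale[of 2 2 0 0 0] quat_id by simp
  finally have fg: "?f (?g x) = x" for x by (simp add: fun_eq_iff)
  have "?g = inv_into UNIV ?f"
  proof
    fix x
    have "inv_into UNIV ?f (?f (?g x)) = ?g x" by (rule aut_group_inv(3)[OF G g])
    then show "?g x = inv_into UNIV ?f x" using fg by simp
  qed
  then show ?thesis using aut_group_inv(1)[OF G g] by simp
qed

text \<open>The inner product of two quaternions is the first coordinate of the conjugate of one
  times the other. The product has norm \<open>16\<close>; halving returns it to norm
  \<open>4\<close>, where the list of traces applies.\<close>

lemma polyhedral_inner_product:
  assumes P: "polyhedral k G" and x: "a\<^sup>2 + b\<^sup>2 + c\<^sup>2 + d\<^sup>2 = (4::real)" "rquat a b c d \<in> G"
    and y: "a'\<^sup>2 + b'\<^sup>2 + c'\<^sup>2 + d'\<^sup>2 = (4::real)" "rquat a' b' c' d' \<in> G"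
  shows "((a * a' + b * b' + c * c' + d * d') / 2)\<^sup>2 \<in> traces k"
proof -
  note G = polyhedralD(1)[OF P]
  have x': "rquat a (- b) (- c) (- d) \<in> G" by (rule rquat_inverse_mem[OF G x])
  have nx': "a\<^sup>2 + (- b)\<^sup>2 + (- c)\<^sup>2 + (- d)\<^sup>2 = 4" using x(1) by simp
  define p q r s where "p = a * a' - (- b) * b' - (- c) * c' - (- d) * d'"
    and "q = a * b' + (- b) * a' + (- c) * d' - (- d) * c'"
    and "r = a * c' - (- b) * d' + (- c) * a' + (- d) * b'"
    and "s = a * d' + (- b) * c' - (- c) * b' + (- d) * a'"
  have eq: "rquat a (- b) (- c) (- d) \<circ> rquat a' b' c' d' = rquat p q r s"
    unfolding p_def q_def r_def s_def by (rule rquat_comp[OF nx' _ y(1)]) simp_all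
  have "p\<^sup>2 + q\<^sup>2 + r\<^sup>2 + s\<^sup>2 = (a\<^sup>2 + b\<^sup>2 + c\<^sup>2 + d\<^sup>2) * (a'\<^sup>2 + b'\<^sup>2 + c'\<^sup>2 + d'\<^sup>2)"
    unfolding p_def q_def r_def s_def by algebra
  then have "p\<^sup>2 + q\<^sup>2 + r\<^sup>2 + s\<^sup>2 = 16" using x(1) y(1) by simp
  then have n: "(p / 2)\<^sup>2 + (q / 2)\<^sup>2 + (r / 2)\<^sup>2 + (s / 2)\<^sup>2 = 4" by (simp add: power_divide field_simps)
  have "rquat (p / 2) (q / 2) (r / 2) (s / 2) = rquat p q r s"
    using rquat_scale[of "1 / 2" p q r s] by simp
  then have "rquat (p / 2) (q / 2) (r / 2) (s / 2) \<in> G"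
    using aut_groupD(2)[OF G x' y(2)] eq by simp
  then have "(p / 2)\<^sup>2 \<in> traces k" using polyhedral_coordinates(1)[OF P n] by blast
  then show ?thesis by (simp add: p_def)
qed

lemma polyhedral_cj:
  assumes P: "polyhedral k G" and \<theta>: "\<theta> \<in> Aut_cp1"
    and IK: "rquat 0 1 0 0 \<in> cj \<theta> ` G" "rquat 0 0 0 1 \<in> cj \<theta> ` G"
  shows "polyhedral k (cj \<theta> ` G)"
proof -
  note D = polyhedralD[OF P]
  have "g = id \<or> g ^^ 2 = id \<or> g ^^ 3 = id \<or> g ^^ k = id" if gG: "g \<in> cj \<theta> ` G" for g
  proof -
    obtain h where h: "h \<in> G" "g = cj \<theta> h" using gG by blast
    have p: "g ^^ j = cj \<theta> (h ^^ j)" for j using cj_funpow[OF \<theta>] h(2) by simp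
    show ?thesis using D(5)[OF h(1)] p cj_id[OF \<theta>] h(2) by metis
  qed
  then show ?thesis
    using D aut_group_cj[OF D(1) \<theta>] card_cj[OF \<theta>, of G] IK unfolding polyhedral_def by simp
qed

text \<open>In quaternion terms, a rotation about the axis of \<open>i\<close>: it turns the plane
  of \<open>j\<close> and \<open>k\<close> and leaves the first two coordinates alone.\<close>

lemma cj_rotation:
  assumes "u\<^sup>2 + v\<^sup>2 = (1::real)" "a\<^sup>2 + b\<^sup>2 + c\<^sup>2 + d\<^sup>2 = (r::real)" "r \<noteq> 0"
  shows "rot (Complex u v) \<in> Aut_cp1"
    and "cj (rot (Complex u v)) (rquat a b c d) = rquat a b (u * c - v * d) (v * c + u * d)"
proof -
  let ?z = "Complex u v"
  have inv: "?z * Complex u (- v) = 1"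
    using assms(1) by (simp add: complex_eq_iff power2_eq_square algebra_simps)
  then have z0: "?z \<noteq> 0" by auto
  then show "rot ?z \<in> Aut_cp1" by (rule affine_Aut)
  have zi: "1 / ?z = Complex u (- v)" using inv z0 by (simp add: field_simps)
  have ri: "inv_into UNIV (rot ?z) = rot (Complex u (- v))" using affine_inv[OF z0, of 0] zi by simp
  define A B C D where "A = of_real a + \<i> * of_real b" and "B = of_real c + \<i> * of_real d"
    and "C = - of_real c + \<i> * of_real d" and "D = of_real a - \<i> * of_real b"
  have det: "A * D - B * C \<noteq> 0"
    unfolding A_def B_def C_def D_def quat_det by (rule rquat_norm_nonzero[OF assms(2,3)])
  have det2: "(?z * A) * D - (?z * B) * C \<noteq> 0"
  proof -
    have "(?z * A) * D - (?z * B) * C = ?z * (A * D - B * C)" by (simp add: algebra_simps)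
    then show ?thesis using det z0 by simp
  qed
  have w0: "Complex u (- v) \<noteq> 0" using inv by auto
  have "cj (rot ?z) (mob A B C D) = mob (?z * A) (?z * B) C D \<circ> rot (Complex u (- v))"
    unfolding cj_def ri using mob_comp[of ?z 1 0 0 A D B C] z0 det by simp
  also have "\<dots> = mob (?z * A * Complex u (- v)) (?z * B) (C * Complex u (- v)) D"
    using mob_comp[OF det2, of "Complex u (- v)" 1 0 0] w0 by simp
  also have "?z * A * Complex u (- v) = A" using inv by (metis mult.commute mult.left_commute mult_1_right)
  also have "?z * B = of_real (u * c - v * d) + \<i> * of_real (v * c + u * d)"
    by (simp add: B_def complex_eq_iff algebra_simps)
  also have "C * Complex u (- v) = - of_real (u * c - v * d) + \<i> * of_real (v * c + u * d)"
    by (simp add: C_def complex_eq_iff algebra_simps)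
  finally show "cj (rot ?z) (rquat a b c d) = rquat a b (u * c - v * d) (v * c + u * d)"
    unfolding quat_def A_def B_def C_def D_def .
qed

section \<open>Octahedral groups\<close>

abbreviation "sq2 \<equiv> sqrt 2"

lemma square_eq_2: "x\<^sup>2 = 2 \<longleftrightarrow> x = sq2 \<or> x = - sq2" for x :: real
  using power2_eq_iff[of x sq2] by simp

definition d8 :: "(real \<times> real \<times> real \<times> real) list" where
  "d8 = [(2, 0, 0, 0), (0, 2, 0, 0), (0, 0, 2, 0), (0, 0, 0, 2),
     (sq2, sq2, 0, 0), (sq2, - sq2, 0, 0), (0, 0, sq2, sq2), (0, 0, sq2, - sq2)]"

definition std4 :: "(real \<times> real \<times> real \<times> real) list" where
  "std4 = d8 @ [(1, 1, 1, 1), (1, 1, 1, -1), (1, 1, -1, 1), (1, 1, -1, -1),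
     (1, -1, 1, 1), (1, -1, 1, -1), (1, -1, -1, 1), (1, -1, -1, -1),
     (sq2, 0, sq2, 0), (sq2, 0, - sq2, 0), (sq2, 0, 0, sq2), (sq2, 0, 0, - sq2),
     (0, sq2, sq2, 0), (0, sq2, - sq2, 0), (0, sq2, 0, sq2), (0, sq2, 0, - sq2)]"

text \<open>The three sets of squares below belong to the dihedral subgroup of order
  \<open>8\<close>, to the rest of the standard octahedral group, and to the rest of the other
  octahedral group containing that subgroup. An eighth turn of the last two coordinates exchanges
  the last two sets.\<close>

definition oct_d8 :: "(real \<times> real \<times> real \<times> real) set" where
  "oct_d8 = {(4, 0, 0, 0), (0, 4, 0, 0), (0, 0, 4, 0), (0, 0, 0, 4), (2, 2, 0, 0), (0, 0, 2, 2)}"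

definition oct_std :: "(real \<times> real \<times> real \<times> real) set" where
  "oct_std = {(1, 1, 1, 1), (2, 0, 2, 0), (2, 0, 0, 2), (0, 2, 2, 0), (0, 2, 0, 2)}"

definition oct_mixed :: "(real \<times> real \<times> real \<times> real) set" where
  "oct_mixed = {(2, 0, 1, 1), (0, 2, 1, 1), (1, 1, 2, 0), (1, 1, 0, 2)}"

lemma d8_memI:
  assumes "(a\<^sup>2, b\<^sup>2, c\<^sup>2, d\<^sup>2) \<in> oct_d8"
  shows "rquat a b c d \<in> rq ` set d8"
proof (rule rq_memI)
  consider "a\<^sup>2 = 4" "b\<^sup>2 = 0" "c\<^sup>2 = 0" "d\<^sup>2 = 0" | "a\<^sup>2 = 0" "b\<^sup>2 = 4" "c\<^sup>2 = 0" "d\<^sup>2 = 0"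
    | "a\<^sup>2 = 0" "b\<^sup>2 = 0" "c\<^sup>2 = 4" "d\<^sup>2 = 0" | "a\<^sup>2 = 0" "b\<^sup>2 = 0" "c\<^sup>2 = 0" "d\<^sup>2 = 4"
    | "a\<^sup>2 = 2" "b\<^sup>2 = 2" "c\<^sup>2 = 0" "d\<^sup>2 = 0" | "a\<^sup>2 = 0" "b\<^sup>2 = 0" "c\<^sup>2 = 2" "d\<^sup>2 = 2"
    using assms unfolding oct_d8_def insert_iff prod.inject empty_iff by blast
  then show "(a, b, c, d) \<in> set d8 \<or> (- a, - b, - c, - d) \<in> set d8"
    by cases (unfold square_values square_eq_2, (elim disjE; simp add: d8_def)+)
qed

lemma std4_memI:
  assumes "(a\<^sup>2, b\<^sup>2, c\<^sup>2, d\<^sup>2) \<in> oct_std"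
  shows "rquat a b c d \<in> rq ` set std4"
proof (rule rq_memI)
  consider "a\<^sup>2 = 1" "b\<^sup>2 = 1" "c\<^sup>2 = 1" "d\<^sup>2 = 1" | "a\<^sup>2 = 2" "b\<^sup>2 = 0" "c\<^sup>2 = 2" "d\<^sup>2 = 0"
    | "a\<^sup>2 = 2" "b\<^sup>2 = 0" "c\<^sup>2 = 0" "d\<^sup>2 = 2" | "a\<^sup>2 = 0" "b\<^sup>2 = 2" "c\<^sup>2 = 2" "d\<^sup>2 = 0"
    | "a\<^sup>2 = 0" "b\<^sup>2 = 2" "c\<^sup>2 = 0" "d\<^sup>2 = 2"
    using assms unfolding oct_std_def insert_iff prod.inject empty_iff by blast
  then show "(a, b, c, d) \<in> set std4 \<or> (- a, - b, - c, - d) \<in> set std4"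
    by cases (unfold square_values square_eq_2, (elim disjE; simp add: std4_def)+)
qed

lemma octahedral_rotate:
  assumes P: "polyhedral 4 G" and r: "rquat 1 1 0 0 \<in> G"
    and n: "a\<^sup>2 + b\<^sup>2 + c\<^sup>2 + d\<^sup>2 = (4::real)" and g: "rquat a b c d \<in> G"
  shows "rquat ((a - b) / sq2) ((a + b) / sq2) ((c - d) / sq2) ((c + d) / sq2) \<in> G"
    and "((a - b) / sq2)\<^sup>2 + ((a + b) / sq2)\<^sup>2 + ((c - d) / sq2)\<^sup>2 + ((c + d) / sq2)\<^sup>2 = 4"
proof -
  have "rquat 1 1 0 0 \<circ> rquat a b c d = rquat (a - b) (a + b) (c - d) (c + d)"
    using rquat_comp[of 1 1 0 0 2, OF _ _ n] by (simp add: add.commute)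
  also have "\<dots> = rquat ((a - b) / sq2) ((a + b) / sq2) ((c - d) / sq2) ((c + d) / sq2)"
    using rquat_scale[of "1 / sq2" "a - b" "a + b" "c - d" "c + d"] by simp
  finally show "rquat ((a - b) / sq2) ((a + b) / sq2) ((c - d) / sq2) ((c + d) / sq2) \<in> G"
    using aut_groupD(2)[OF polyhedralD(1)[OF P] r g] by simp
  show "((a - b) / sq2)\<^sup>2 + ((a + b) / sq2)\<^sup>2 + ((c - d) / sq2)\<^sup>2 + ((c + d) / sq2)\<^sup>2 = 4"
    using n by (simp add: power_divide power2_eq_square field_simps)
qed

text \<open>Here \<open>A\<close>, \<open>B\<close> are the squares of two coordinates and
  \<open>s\<close>, \<open>t\<close> those after multiplication by the quarter turn. That all four
  belong to the list of traces excludes pairs such as \<open>(1, 0)\<close> and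
  \<open>(2, 1)\<close>.\<close>

lemma octahedral_pair:
  fixes A B s t :: real
  assumes "A \<in> {0, 1, 2, 4}" "B \<in> {0, 1, 2, 4}" "s \<in> {0, 1, 2, 4}" "t \<in> {0, 1, 2, 4}"
    "s + t = A + B" "4 * (s * t) = (A - B)\<^sup>2" "A + B \<le> 4"
  shows "(A, B) \<in> {(0, 0), (4, 0), (0, 4), (2, 2), (2, 0), (0, 2), (1, 1)}"
  using assms by (elim insertE emptyE) simp_all

lemma octahedral_squares:
  assumes P: "polyhedral 4 G" and r: "rquat 1 1 0 0 \<in> G"
    and n: "a\<^sup>2 + b\<^sup>2 + c\<^sup>2 + d\<^sup>2 = (4::real)" and g: "rquat a b c d \<in> G"
  shows "(a\<^sup>2, b\<^sup>2, c\<^sup>2, d\<^sup>2) \<in> oct_d8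
    \<or> (a\<^sup>2, b\<^sup>2, c\<^sup>2, d\<^sup>2) \<in> oct_std
    \<or> (a\<^sup>2, b\<^sup>2, c\<^sup>2, d\<^sup>2) \<in> oct_mixed"
proof -
  have T: "traces 4 = {0, 1, 2, 4}" by (auto simp: traces_def)
  note c1 = polyhedral_coordinates[OF P n g, unfolded T]
  note c2 = polyhedral_coordinates[OF P octahedral_rotate(2,1)[OF P r n g], unfolded T]
  have id: "((x - y) / sq2)\<^sup>2 + ((x + y) / sq2)\<^sup>2 = x\<^sup>2 + y\<^sup>2"
    "4 * (((x - y) / sq2)\<^sup>2 * ((x + y) / sq2)\<^sup>2) = (x\<^sup>2 - y\<^sup>2)\<^sup>2" for x y :: real
    by (simp_all add: power_divide power2_eq_square field_simps)
  have pos: "0 \<le> a\<^sup>2" "0 \<le> b\<^sup>2" "0 \<le> c\<^sup>2" "0 \<le> d\<^sup>2" by simp_all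
  have ab: "(a\<^sup>2, b\<^sup>2) \<in> {(0, 0), (4, 0), (0, 4), (2, 2), (2, 0), (0, 2), (1, 1)}"
    by (rule octahedral_pair[OF c1(1,2) c2(1,2) id]) (use n pos in linarith)
  have cd: "(c\<^sup>2, d\<^sup>2) \<in> {(0, 0), (4, 0), (0, 4), (2, 2), (2, 0), (0, 2), (1, 1)}"
    by (rule octahedral_pair[OF c1(3,4) c2(3,4) id]) (use n pos in linarith)
  have "(A, B, C, D) \<in> oct_d8
    \<or> (A, B, C, D) \<in> oct_std
    \<or> (A, B, C, D) \<in> oct_mixed"
    if "(A, B) \<in> {(0, 0), (4, 0), (0, 4), (2, 2), (2, 0), (0, 2), (1, 1)}"
      "(C, D) \<in> {(0, 0), (4, 0), (0, 4), (2, 2), (2, 0), (0, 2), (1, 1)}" "A + B + C + D = 4" for A B C D :: real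
    using that unfolding insert_iff prod.inject empty_iff oct_d8_def oct_std_def oct_mixed_def
    by (elim disjE conjE FalseE) simp_all
  from this[OF ab cd n] show ?thesis .
qed

lemma octahedral_half_turn_squares:
  fixes x y :: real
  shows "(x\<^sup>2, y\<^sup>2) \<in> {(2, 0), (0, 2)} \<Longrightarrow> ((x - y) / sq2)\<^sup>2 = 1 \<and> ((x + y) / sq2)\<^sup>2 = 1"
    and "(x\<^sup>2, y\<^sup>2) = (1, 1) \<Longrightarrow> (((x - y) / sq2)\<^sup>2, ((x + y) / sq2)\<^sup>2) \<in> {(2, 0), (0, 2)}"
  by (auto simp: power_divide power2_eq_iff square_values square_eq_2)

text \<open>The quarter turn brings the first element to squares \<open>(1, 1, 1, 1)\<close> and the
  second to squares \<open>2\<close>, \<open>0\<close> in some order followed by \<open>1\<close>,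
  \<open>1\<close>. Their inner product is \<open>\<plusminus> sq2\<close> plus one of
  \<open>-2\<close>, \<open>0\<close>, \<open>2\<close>, and the square of its half is none of
  \<open>0\<close>, \<open>1\<close>, \<open>2\<close>, \<open>4\<close>.\<close>

lemma octahedral_exclusion:
  assumes P: "polyhedral 4 G" and r: "rquat 1 1 0 0 \<in> G"
    and x: "rquat x0 x1 x2 x3 \<in> G" "(x0\<^sup>2, x1\<^sup>2, x2\<^sup>2, x3\<^sup>2) \<in> oct_std"
    and y: "rquat y0 y1 y2 y3 \<in> G" "(y0\<^sup>2, y1\<^sup>2, y2\<^sup>2, y3\<^sup>2) \<in> oct_mixed"
  shows False
proof -
  have T: "traces 4 = {0, 1, 2, 4}" by (auto simp: traces_def)
  have nx: "x0\<^sup>2 + x1\<^sup>2 + x2\<^sup>2 + x3\<^sup>2 = 4" and ny: "y0\<^sup>2 + y1\<^sup>2 + y2\<^sup>2 + y3\<^sup>2 = 4"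
    using x(2) y(2) unfolding oct_std_def oct_mixed_def by auto
  obtain a0 a1 a2 a3 where a: "rquat a0 a1 a2 a3 \<in> G" "a0\<^sup>2 = 1" "a1\<^sup>2 = 1" "a2\<^sup>2 = 1" "a3\<^sup>2 = 1"
  proof (cases "(x0\<^sup>2, x1\<^sup>2, x2\<^sup>2, x3\<^sup>2) = (1, 1, 1, 1)")
    case True
    then show thesis using that x(1) by simp
  next
    case False
    then have "(x0\<^sup>2, x1\<^sup>2) \<in> {(2, 0), (0, 2)}" "(x2\<^sup>2, x3\<^sup>2) \<in> {(2, 0), (0, 2)}"
      using x(2) unfolding oct_std_def by auto
    then show thesis using that octahedral_rotate(1)[OF P r nx x(1)] octahedral_half_turn_squares(1) by blast
  qed
  obtain b0 b1 b2 b3 where b: "rquat b0 b1 b2 b3 \<in> G" "(b0\<^sup>2, b1\<^sup>2) \<in> {(2, 0), (0, 2)}" "b2\<^sup>2 = 1" "b3\<^sup>2 = 1"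
  proof (cases "(y2\<^sup>2, y3\<^sup>2) = (1, 1)")
    case True
    then show thesis using that[of y0 y1 y2 y3] y unfolding oct_mixed_def by auto
  next
    case False
    then have "(y0\<^sup>2, y1\<^sup>2) = (1, 1)" "(y2\<^sup>2, y3\<^sup>2) \<in> {(2, 0), (0, 2)}"
      using y(2) unfolding oct_mixed_def by auto
    then show thesis
      using that octahedral_rotate(1)[OF P r ny y(1)] octahedral_half_turn_squares by blast
  qed
  have na: "a0\<^sup>2 + a1\<^sup>2 + a2\<^sup>2 + a3\<^sup>2 = 4" using a by simp
  have nb: "b0\<^sup>2 + b1\<^sup>2 + b2\<^sup>2 + b3\<^sup>2 = 4" using b by auto
  define u v w where "u = a0 * b0 + a1 * b1" and "v = a2 * b2" and "w = a3 * b3"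
  have "((u + v + w) / 2)\<^sup>2 \<in> {0, 1, 2, 4}"
    using polyhedral_inner_product[OF P na a(1) nb b(1)] by (simp add: T u_def v_def w_def)
  then obtain t where t: "t \<in> {0, 1, 2, 4}" "((u + v + w) / 2)\<^sup>2 = t" by blast
  have u2: "u\<^sup>2 = 2" using a b(2) by (auto simp: u_def power_mult_distrib)
  then have u: "u = sq2 \<or> u = - sq2" by (simp only: square_eq_2)
  have "v\<^sup>2 = 1" "w\<^sup>2 = 1" using a b by (simp_all add: v_def w_def power_mult_distrib)
  then have "v + w = 0 \<or> v + w = 2 \<or> v + w = -2" by (auto simp: square_values)
  moreover have "4 * t = u\<^sup>2 + (v + w) * (v + w) + 2 * u * (v + w)"
    unfolding t(2)[symmetric] by (simp add: power2_eq_square algebra_simps)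
  ultimately have t4: "4 * t = 2 \<or> 4 * t = 6 + 4 * u \<or> 4 * t = 6 - 4 * u"
    unfolding u2 by (elim disjE) simp_all
  have s: "7 / 5 < sq2" by (rule real_less_rsqrt) (simp add: power2_eq_square)
  have s': "sq2 < 3 / 2" by (rule real_less_lsqrt) (simp_all add: power2_eq_square)
  have "(7 / 5 < u \<and> u < 3 / 2) \<or> (- (3 / 2) < u \<and> u < - (7 / 5))" using u s s' by auto
  moreover have "t = 0 \<or> t = 1 \<or> t = 2 \<or> t = 4" using t(1) by simp
  ultimately show False using t4 by (elim disjE; linarith)
qed

lemma octahedral_standard_aux:
  assumes P: "polyhedral 4 G" and r: "rquat 1 1 0 0 \<in> G"
    and x: "rquat x0 x1 x2 x3 \<in> G" "(x0\<^sup>2, x1\<^sup>2, x2\<^sup>2, x3\<^sup>2) \<in> oct_std"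
  shows "G = rq ` set std4"
proof (rule card_seteq)
  show "G \<subseteq> rq ` set std4"
  proof
    fix g assume gG: "g \<in> G"
    then obtain a b c d where g: "g = rquat a b c d" and n: "a\<^sup>2 + b\<^sup>2 + c\<^sup>2 + d\<^sup>2 = 4"
      using polyhedral_rquat[OF P] by metis
    have gG': "rquat a b c d \<in> G" using gG g by simp
    have "(a\<^sup>2, b\<^sup>2, c\<^sup>2, d\<^sup>2) \<notin> oct_mixed"
      using octahedral_exclusion[OF P r x gG'] by blast
    then have "(a\<^sup>2, b\<^sup>2, c\<^sup>2, d\<^sup>2) \<in> oct_d8
      \<or> (a\<^sup>2, b\<^sup>2, c\<^sup>2, d\<^sup>2) \<in> oct_std"
      using octahedral_squares[OF P r n gG'] by blast
    moreover have "rq ` set d8 \<subseteq> rq ` set std4" by (auto simp: std4_def)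
    ultimately show "g \<in> rq ` set std4"
      unfolding g using d8_memI[of a b c d] std4_memI[of a b c d] by blast
  qed
  have "card G = 24" using polyhedralD(4)[OF P] by auto
  then show "card (rq ` set std4) \<le> card G" using card_rq_le[of std4] by (simp add: std4_def d8_def)
qed simp

text \<open>The dihedral group of order \<open>8\<close> lies in two octahedral groups, which a rotation by an eighth of a
  turn interchanges.\<close>

lemma octahedral_standard:
  assumes P: "polyhedral 4 G" and r: "rquat 1 1 0 0 \<in> G"
  shows "\<exists>\<theta>\<in>Aut_cp1. cj \<theta> ` G = rq ` set std4"
proof -
  have "\<not> G \<subseteq> rq ` set d8"
  proof
    assume "G \<subseteq> rq ` set d8"
    then have "card G \<le> card (rq ` set d8)" by (intro card_mono) auto
    also have "\<dots> \<le> 8" using card_rq_le[of d8] by (simp add: d8_def)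
    finally show False using polyhedralD(4)[OF P] by auto
  qed
  then obtain g where gG: "g \<in> G" and gd: "g \<notin> rq ` set d8" by blast
  obtain a b c d where g: "g = rquat a b c d" and n: "a\<^sup>2 + b\<^sup>2 + c\<^sup>2 + d\<^sup>2 = 4"
    using polyhedral_rquat[OF P gG] by metis
  have gG': "rquat a b c d \<in> G" using gG g by simp
  show ?thesis
  proof (cases "(a\<^sup>2, b\<^sup>2, c\<^sup>2, d\<^sup>2) \<in> oct_std")
    case True
    have "cj id ` G = G" by (simp add: cj_def)
    then show ?thesis using octahedral_standard_aux[OF P r gG' True] Aut_id by metis
  next
    case False
    then have "(a\<^sup>2, b\<^sup>2, c\<^sup>2, d\<^sup>2) \<in> oct_mixed"
      using octahedral_squares[OF P r n gG'] d8_memI[of a b c d] gd g by blast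
    then have alt: "(a\<^sup>2, b\<^sup>2) \<in> {(2, 0), (0, 2)} \<and> (c\<^sup>2, d\<^sup>2) = (1, 1) \<or>
        (a\<^sup>2, b\<^sup>2) = (1, 1) \<and> (c\<^sup>2, d\<^sup>2) \<in> {(2, 0), (0, 2)}"
      unfolding oct_mixed_def by auto
    let ?u = "1 / sq2" and ?\<theta> = "rot (Complex (1 / sq2) (1 / sq2))"
    have u: "?u\<^sup>2 + ?u\<^sup>2 = 1" by (simp add: power_divide)
    have \<theta>: "?\<theta> \<in> Aut_cp1" using cj_rotation(1)[OF u n] by simp
    have cjr: "cj ?\<theta> (rquat x y z w) = rquat x y ((z - w) / sq2) ((z + w) / sq2)"
      if "x\<^sup>2 + y\<^sup>2 + z\<^sup>2 + w\<^sup>2 = m" "m \<noteq> 0" for x y z w m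
      using cj_rotation(2)[OF u that] by (simp add: diff_divide_distrib add_divide_distrib)
    have "cj ?\<theta> (rquat 0 1 0 0) = rquat 0 1 0 0" "cj ?\<theta> (rquat 1 1 0 0) = rquat 1 1 0 0"
      using cjr[of 0 1 0 0 1] cjr[of 1 1 0 0 2] by simp_all
    then have I: "rquat 0 1 0 0 \<in> cj ?\<theta> ` G" and r': "rquat 1 1 0 0 \<in> cj ?\<theta> ` G"
      using polyhedralD(6)[OF P] r by (metis imageI)+
    \<comment> \<open>The eighth turn does not keep \<open>k\<close> in the group by itself; it is
      the half turn \<open>j + k\<close> of \<open>G\<close> that is carried to \<open>k\<close>, so
      the conjugated group is polyhedral again.\<close>
    have "rquat 1 1 0 0 \<circ> rquat 0 0 1 0 = rquat 0 0 1 1" by (subst rquat_comp[of _ _ _ _ 2 _ _ _ _ 1]) simp_all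
    then have "rquat 0 0 1 1 \<in> G" using aut_groupD(2)[OF polyhedralD(1)[OF P] r polyhedral_J[OF P]] by simp
    moreover have "cj ?\<theta> (rquat 0 0 1 1) = rquat 0 0 0 1"
    proof -
      have "(1 + 1) / sq2 = sq2" by (simp add: real_div_sqrt)
      then show ?thesis using cjr[of 0 0 1 1 2] rquat_scale[of sq2 0 0 0 1] by (simp del: of_real_divide)
    qed
    ultimately have K: "rquat 0 0 0 1 \<in> cj ?\<theta> ` G" by (metis imageI)
    have P': "polyhedral 4 (cj ?\<theta> ` G)" by (rule polyhedral_cj[OF P \<theta> I K])
    have g': "rquat a b ((c - d) / sq2) ((c + d) / sq2) \<in> cj ?\<theta> ` G"
      using gG' cjr[OF n] by (metis imageI zero_neq_numeral)
    have "(a\<^sup>2, b\<^sup>2, ((c - d) / sq2)\<^sup>2, ((c + d) / sq2)\<^sup>2) \<in> oct_std"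
      using alt
    proof
      assume h: "(a\<^sup>2, b\<^sup>2) \<in> {(2, 0), (0, 2)} \<and> (c\<^sup>2, d\<^sup>2) = (1, 1)"
      then have "(((c - d) / sq2)\<^sup>2, ((c + d) / sq2)\<^sup>2) \<in> {(2, 0), (0, 2)}"
        using octahedral_half_turn_squares(2) by blast
      then show ?thesis using h unfolding oct_std_def insert_iff prod.inject empty_iff by argo
    next
      assume h: "(a\<^sup>2, b\<^sup>2) = (1, 1) \<and> (c\<^sup>2, d\<^sup>2) \<in> {(2, 0), (0, 2)}"
      then have "((c - d) / sq2)\<^sup>2 = 1 \<and> ((c + d) / sq2)\<^sup>2 = 1"
        using octahedral_half_turn_squares(1) by blast
      then show ?thesis using h unfolding oct_std_def insert_iff prod.inject empty_iff by argo
    qed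
    then show ?thesis using octahedral_standard_aux[OF P' r' g'] \<theta> by blast
  qed
qed

text \<open>The triples of squares of the nonzero coordinates of the icosians other than the \<open>24\<close> units of the
  Hurwitz order, in even and in odd cyclic arrangement.\<close>

definition ico_even :: "(real \<times> real \<times> real) set" where
  "ico_even = {(1, gr + 1, 2 - gr), (gr + 1, 2 - gr, 1), (2 - gr, 1, gr + 1)}"

definition ico_odd :: "(real \<times> real \<times> real) set" where
  "ico_odd = {(1, 2 - gr, gr + 1), (gr + 1, 1, 2 - gr), (2 - gr, gr + 1, 1)}"

definition hurwitz_squares :: "(real \<times> real \<times> real \<times> real) set" where
  "hurwitz_squares = {(4, 0, 0, 0), (0, 4, 0, 0), (0, 0, 4, 0), (0, 0, 0, 4), (1, 1, 1, 1)}"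

section \<open>Icosahedral groups\<close>

lemma icosahedral_triple_sum_4:
  fixes x y z g :: real
  assumes "x = 0 \<or> x = 1 \<or> x = g + 1 \<or> x = 2 - g" "y = 0 \<or> y = 1 \<or> y = g + 1 \<or> y = 2 - g"
    "z = 0 \<or> z = 1 \<or> z = g + 1 \<or> z = 2 - g" "8 < 5 * g" "50 * g < 81" "x + y + z = 4"
  obtains "x = 1" "y = 2 - g" "z = g + 1"
    | "x = 1" "y = g + 1" "z = 2 - g"
    | "x = 2 - g" "y = 1" "z = g + 1"
    | "x = 2 - g" "y = g + 1" "z = 1"
    | "x = g + 1" "y = 1" "z = 2 - g"
    | "x = g + 1" "y = 2 - g" "z = 1"
  by (insert assms, (elim disjE; ((rule that; assumption) | linarith)))

lemma icosahedral_triple_sum_3: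
  fixes x y z g :: real
  assumes "x = 0 \<or> x = 1 \<or> x = g + 1 \<or> x = 2 - g" "y = 0 \<or> y = 1 \<or> y = g + 1 \<or> y = 2 - g"
    "z = 0 \<or> z = 1 \<or> z = g + 1 \<or> z = 2 - g" "8 < 5 * g" "50 * g < 81" "x + y + z = 3"
  obtains "x = 1" "y = 1" "z = 1"
    | "x = 0" "y = 2 - g" "z = g + 1"
    | "x = 0" "y = g + 1" "z = 2 - g"
    | "x = 2 - g" "y = 0" "z = g + 1"
    | "x = 2 - g" "y = g + 1" "z = 0"
    | "x = g + 1" "y = 0" "z = 2 - g"
    | "x = g + 1" "y = 2 - g" "z = 0"
  by (insert assms, (elim disjE; ((rule that; assumption) | linarith)))

lemma icosahedral_triple_sum_3_minus:
  fixes x y z g :: real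
  assumes "x = 0 \<or> x = 1 \<or> x = g + 1 \<or> x = 2 - g" "y = 0 \<or> y = 1 \<or> y = g + 1 \<or> y = 2 - g"
    "z = 0 \<or> z = 1 \<or> z = g + 1 \<or> z = 2 - g" "8 < 5 * g" "50 * g < 81" "x + y + z = 3 - g"
  obtains "x = 0" "y = 1" "z = 2 - g"
    | "x = 0" "y = 2 - g" "z = 1"
    | "x = 1" "y = 0" "z = 2 - g"
    | "x = 1" "y = 2 - g" "z = 0"
    | "x = 2 - g" "y = 0" "z = 1"
    | "x = 2 - g" "y = 1" "z = 0"
  by (insert assms, (elim disjE; ((rule that; assumption) | linarith)))

lemma icosahedral_triple_sum_2_plus:
  fixes x y z g :: real
  assumes "x = 0 \<or> x = 1 \<or> x = g + 1 \<or> x = 2 - g" "y = 0 \<or> y = 1 \<or> y = g + 1 \<or> y = 2 - g"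
    "z = 0 \<or> z = 1 \<or> z = g + 1 \<or> z = 2 - g" "8 < 5 * g" "50 * g < 81" "x + y + z = 2 + g"
  obtains "x = 0" "y = 1" "z = g + 1"
    | "x = 0" "y = g + 1" "z = 1"
    | "x = 1" "y = 0" "z = g + 1"
    | "x = 1" "y = g + 1" "z = 0"
    | "x = g + 1" "y = 0" "z = 1"
    | "x = g + 1" "y = 1" "z = 0"
  by (insert assms, (elim disjE; ((rule that; assumption) | linarith)))

text \<open>The orders \<open>(A, D, C)\<close>, \<open>(D, A, B)\<close> and
  \<open>(C, B, A)\<close> are those in which multiplication by \<open>i\<close>, \<open>j\<close>
  and \<open>k\<close> arranges the remaining coordinates when it moves the vanishing one to the
  front, as in \<open>left_mult\<close>.\<close>

lemma icosahedral_sums: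
  fixes A B C D :: real
  assumes "A \<in> {0, 1, 4, gr + 1, 2 - gr}" "B \<in> {0, 1, 4, gr + 1, 2 - gr}"
    "C \<in> {0, 1, 4, gr + 1, 2 - gr}" "D \<in> {0, 1, 4, gr + 1, 2 - gr}" "A + B + C + D = 4"
  shows "(A, B, C, D) \<in> hurwitz_squares
    \<or> A = 0 \<and> (B, C, D) \<in> ico_even \<union> ico_odd \<or> B = 0 \<and> (A, D, C) \<in> ico_even \<union> ico_odd
    \<or> C = 0 \<and> (D, A, B) \<in> ico_even \<union> ico_odd \<or> D = 0 \<and> (C, B, A) \<in> ico_even \<union> ico_odd"
proof -
  \<comment> \<open>Once \<open>4\<close> is excluded as a square, the case lemmas on sums of three
    squares treat the golden ratio as an arbitrary real between \<open>1.6\<close> and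
    \<open>1.62\<close>; the four possible values of \<open>A\<close> leave the four sums treated
    there.\<close>
  have b: "8 < 5 * gr" "50 * gr < 81" using gr_bounds by simp_all
  have pos: "0 \<le> x" if "x \<in> {0, 1, 4, gr + 1, 2 - gr}" for x using that b by auto
  have p: "0 \<le> A" "0 \<le> B" "0 \<le> C" "0 \<le> D" using assms pos by blast+
  note defs = hurwitz_squares_def ico_even_def ico_odd_def
  show ?thesis
  proof (cases "A = 4 \<or> B = 4 \<or> C = 4 \<or> D = 4")
    case True
    then have "(A, B, C, D) \<in> hurwitz_squares"
      unfolding hurwitz_squares_def using p assms(5) by (elim disjE) simp_all
    then show ?thesis ..
  next
    case False
    then have v: "A = 0 \<or> A = 1 \<or> A = gr + 1 \<or> A = 2 - gr" "B = 0 \<or> B = 1 \<or> B = gr + 1 \<or> B = 2 - gr"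
      "C = 0 \<or> C = 1 \<or> C = gr + 1 \<or> C = 2 - gr" "D = 0 \<or> D = 1 \<or> D = gr + 1 \<or> D = 2 - gr"
      using assms by auto
    from v(1) show ?thesis
    proof (elim disjE)
      assume A: "A = 0"
      then have "B + C + D = 4" using assms(5) by simp
      from v(2-4) b this show ?thesis
        by (rule icosahedral_triple_sum_4) (simp_all add: A defs)
    next
      assume A: "A = 1"
      then have "B + C + D = 3" using assms(5) by simp
      from v(2-4) b this show ?thesis
        by (rule icosahedral_triple_sum_3) (simp_all add: A defs)
    next
      assume A: "A = gr + 1"
      then have "B + C + D = 3 - gr" using assms(5) by simp
      from v(2-4) b this show ?thesis
        by (rule icosahedral_triple_sum_3_minus) (simp_all add: A defs)
    next
      assume A: "A = 2 - gr"
      then have "B + C + D = 2 + gr" using assms(5) by simp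
      from v(2-4) b this show ?thesis
        by (rule icosahedral_triple_sum_2_plus) (simp_all add: A defs)
    qed
  qed
qed

definition klein_four :: "(cp1 \<Rightarrow> cp1) set" where
  "klein_four = {id, rquat 0 1 0 0, rquat 0 0 1 0, rquat 0 0 0 1}"

lemma klein_four_involutive: "h \<in> klein_four \<Longrightarrow> h \<circ> h = id"
proof -
  have "rquat (-1) 0 0 0 = id" using rquat_scale[of "-2" "1 / 2" 0 0 0] rquat_scale[of 4 "1 / 2" 0 0 0] quat_id
      rquat_scale[of "-1" 1 0 0 0] rquat_scale[of 2 1 0 0 0] by simp
  then show "h \<in> klein_four \<Longrightarrow> h \<circ> h = id"
    unfolding klein_four_def using rquat_comp[of 0 1 0 0 1 0 1 0 0 1] rquat_comp[of 0 0 1 0 1 0 0 1 0 1]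
      rquat_comp[of 0 0 0 1 1 0 0 0 1 1] by auto
qed

lemma polyhedral_klein_four: "polyhedral k G \<Longrightarrow> klein_four \<subseteq> G"
  using polyhedralD(6,7) polyhedral_J aut_groupD(1)[OF polyhedralD(1)] by (auto simp: klein_four_def)

text \<open>An element outside the Hurwitz units has exactly one vanishing coordinate. Some element
  of the Klein four-group moves it to the first place, so the element is a translate of a pure
  quaternion, that is, of a half turn.\<close>

lemma icosahedral_elements:
  assumes P: "polyhedral 5 G" and gG: "g \<in> G"
  shows "g \<in> rq ` set std3 \<or>
    (\<exists>h\<in>klein_four. \<exists>b c d. g = h \<circ> rquat 0 b c d \<and> rquat 0 b c d \<in> G \<and> (b\<^sup>2, c\<^sup>2, d\<^sup>2) \<in> ico_even \<union> ico_odd)"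
proof -
  have T: "traces 5 = {0, 1, 4, gr + 1, 2 - gr}" by (auto simp: traces_def)
  obtain a b c d where g: "g = rquat a b c d" and n: "a\<^sup>2 + b\<^sup>2 + c\<^sup>2 + d\<^sup>2 = 4"
    and t: "a\<^sup>2 \<in> traces 5" "b\<^sup>2 \<in> traces 5" "c\<^sup>2 \<in> traces 5" "d\<^sup>2 \<in> traces 5"
    using polyhedral_rquat[OF P gG] by metis
  have nc: "(complex_of_real a)\<^sup>2 + (complex_of_real b)\<^sup>2 + (complex_of_real c)\<^sup>2 + (complex_of_real d)\<^sup>2 = 4"
  proof -
    have "(complex_of_real a)\<^sup>2 + (complex_of_real b)\<^sup>2 + (complex_of_real c)\<^sup>2 + (complex_of_real d)\<^sup>2
      = of_real (a\<^sup>2 + b\<^sup>2 + c\<^sup>2 + d\<^sup>2)" by simp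
    then show ?thesis unfolding n by simp
  qed
  have res: "\<exists>h\<in>klein_four. \<exists>b c d. g = h \<circ> rquat 0 b c d \<and> rquat 0 b c d \<in> G \<and> (b\<^sup>2, c\<^sup>2, d\<^sup>2) \<in> ico_even \<union> ico_odd"
    if h: "h \<in> klein_four" "h \<circ> g = rquat 0 b' c' d'" "(b'\<^sup>2, c'\<^sup>2, d'\<^sup>2) \<in> ico_even \<union> ico_odd" for h b' c' d'
  proof -
    have "h \<circ> (h \<circ> g) = g" using klein_four_involutive[OF h(1)] by (simp add: comp_assoc[symmetric])
    then have "g = h \<circ> rquat 0 b' c' d'" using h(2) by simp
    moreover have "rquat 0 b' c' d' \<in> G"
      using aut_groupD(2)[OF polyhedralD(1)[OF P] _ gG, of h] h(1,2) polyhedral_klein_four[OF P] by auto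
    ultimately show ?thesis using h(1,3) by blast
  qed
  from icosahedral_sums[OF t[unfolded T] n]
  consider "(a\<^sup>2, b\<^sup>2, c\<^sup>2, d\<^sup>2) \<in> hurwitz_squares" | "a\<^sup>2 = 0" "(b\<^sup>2, c\<^sup>2, d\<^sup>2) \<in> ico_even \<union> ico_odd"
    | "b\<^sup>2 = 0" "(a\<^sup>2, d\<^sup>2, c\<^sup>2) \<in> ico_even \<union> ico_odd" | "c\<^sup>2 = 0" "(d\<^sup>2, a\<^sup>2, b\<^sup>2) \<in> ico_even \<union> ico_odd"
    | "d\<^sup>2 = 0" "(c\<^sup>2, b\<^sup>2, a\<^sup>2) \<in> ico_even \<union> ico_odd" by blast
  then show ?thesis
  proof cases
    case 1
    then show ?thesis using std3_memI[of a b c d] g by (simp add: hurwitz_squares_def)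
  next
    case 2
    have "id \<circ> g = rquat 0 b c d" using 2(1) g by simp
    moreover have "id \<in> klein_four" by (simp add: klein_four_def)
    ultimately show ?thesis using res 2(2) by blast
  next
    case 3
    have "rquat 0 1 0 0 \<circ> g = rquat 0 a (- d) c" using left_mult(1)[OF nc] 3(1) g by simp
    moreover have "rquat 0 1 0 0 \<in> klein_four" by (simp add: klein_four_def)
    moreover have "(a\<^sup>2, (- d)\<^sup>2, c\<^sup>2) \<in> ico_even \<union> ico_odd" using 3(2) by simp
    ultimately show ?thesis using res by blast
  next
    case 4
    have "rquat 0 0 1 0 \<circ> g = rquat 0 d a (- b)" using left_mult(2)[OF nc] 4(1) g by simp
    moreover have "rquat 0 0 1 0 \<in> klein_four" by (simp add: klein_four_def)
    moreover have "(d\<^sup>2, a\<^sup>2, (- b)\<^sup>2) \<in> ico_even \<union> ico_odd" using 4(2) by simp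
    ultimately show ?thesis using res by blast
  next
    case 5
    have "rquat 0 0 0 1 \<circ> g = rquat 0 (- c) b a" using left_mult(3)[OF nc] 5(1) g by simp
    moreover have "rquat 0 0 0 1 \<in> klein_four" by (simp add: klein_four_def)
    moreover have "((- c)\<^sup>2, b\<^sup>2, a\<^sup>2) \<in> ico_even \<union> ico_odd" using 5(2) by simp
    ultimately show ?thesis using res by blast
  qed
qed

lemma gr_square_values: "x\<^sup>2 = gr + 1 \<longleftrightarrow> x = gr \<or> x = - gr" "x\<^sup>2 = 2 - gr \<longleftrightarrow> x = gr - 1 \<or> x = 1 - gr"
proof -
  have "gr + 1 = gr\<^sup>2" "2 - gr = (gr - 1)\<^sup>2" using gr_square by (simp_all add: power2_eq_square algebra_simps)
  then show "x\<^sup>2 = gr + 1 \<longleftrightarrow> x = gr \<or> x = - gr" "x\<^sup>2 = 2 - gr \<longleftrightarrow> x = gr - 1 \<or> x = 1 - gr"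
    by (auto simp: power2_eq_iff)
qed

definition ico_list :: "(real \<times> real \<times> real \<times> real) list" where
  "ico_list = [(0, 1, gr, gr - 1), (0, 1, gr, 1 - gr), (0, 1, - gr, gr - 1), (0, 1, - gr, 1 - gr),
     (0, gr, gr - 1, 1), (0, gr, gr - 1, -1), (0, gr, 1 - gr, 1), (0, gr, 1 - gr, -1),
     (0, gr - 1, 1, gr), (0, gr - 1, 1, - gr), (0, gr - 1, -1, gr), (0, gr - 1, -1, - gr)]"

text \<open>The tetrahedral group and the translates of twelve half turns by the Klein four-group:
  at most \<open>12 + 4 * 12 = 60\<close> elements, which is the order required.\<close>

definition std5 :: "(cp1 \<Rightarrow> cp1) set" where
  "std5 = rq ` set std3 \<union> (\<lambda>(h, z). h \<circ> z) ` (klein_four \<times> rq ` set ico_list)"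

lemma ico_list_memI:
  assumes "(b\<^sup>2, c\<^sup>2, d\<^sup>2) \<in> ico_even"
  shows "rquat 0 b c d \<in> rq ` set ico_list"
proof -
  consider "b\<^sup>2 = 1" "c\<^sup>2 = gr + 1" "d\<^sup>2 = 2 - gr" | "b\<^sup>2 = gr + 1" "c\<^sup>2 = 2 - gr" "d\<^sup>2 = 1"
    | "b\<^sup>2 = 2 - gr" "c\<^sup>2 = 1" "d\<^sup>2 = gr + 1"
    using assms unfolding ico_even_def insert_iff prod.inject empty_iff by blast
  then have "(0, b, c, d) \<in> set ico_list \<or> (- 0, - b, - c, - d) \<in> set ico_list"
    by cases (unfold square_values gr_square_values, (elim disjE; simp add: ico_list_def)+)
  from rq_memI[OF this] show ?thesis by simp
qed

lemma card_std5: "card std5 \<le> 60"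
proof -
  have "card klein_four \<le> 4" unfolding klein_four_def by (simp add: card_insert_if)
  moreover have "card (rq ` set ico_list) \<le> 12" using card_rq_le[of ico_list] by (simp add: ico_list_def)
  ultimately have "card (klein_four \<times> rq ` set ico_list) \<le> 4 * 12" unfolding card_cartesian_product by (rule mult_le_mono)
  moreover have "finite (klein_four \<times> rq ` set ico_list)" by (simp add: klein_four_def)
  then have "card ((\<lambda>(h, z). h \<circ> z) ` (klein_four \<times> rq ` set ico_list)) \<le> card (klein_four \<times> rq ` set ico_list)"
    by (rule card_image_le)
  moreover have "card (rq ` set std3) \<le> 12" using card_rq_le[of std3] by (simp add: std3_def)
  ultimately show ?thesis
    using card_Un_le[of "rq ` set std3" "(\<lambda>(h, z). h \<circ> z) ` (klein_four \<times> rq ` set ico_list)"]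
    by (simp add: std5_def)
qed

lemma square_product_values:
  fixes x y s t :: real
  assumes "x\<^sup>2 = s" "y\<^sup>2 = t" "s * t = v\<^sup>2"
  shows "x * y = v \<or> x * y = - v"
  using assms by (metis power2_eq_iff power_mult_distrib)

lemma icosahedral_exclusion_arith:
  fixes u v w t :: real
  assumes t: "t \<in> {0, 1, 4, gr + 1, 2 - gr}" "4 * t = (u + v + w)\<^sup>2"
    and uvw: "(u = 1 \<or> u = -1) \<and> (v = 1 \<or> v = -1) \<and> (w = 1 \<or> w = -1) \<or>
      (u = gr + 1 \<or> u = - (gr + 1)) \<and> (v = gr - 1 \<or> v = - (gr - 1)) \<and> (w = gr - 1 \<or> w = - (gr - 1)) \<or>
      (u = 2 - gr \<or> u = - (2 - gr)) \<and> (v = gr \<or> v = - gr) \<and> (w = gr \<or> w = - gr)"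
  shows False
proof -
  have b: "8 < 5 * gr" "50 * gr < 81" using gr_bounds by simp_all
  define s where "s = \<bar>u + v + w\<bar>"
  \<comment> \<open>All absolute values of the signed sums in the three patterns. Their squares
    become linear in \<open>gr\<close>, and none of them is four times a squared trace.\<close>
  have s: "s = 1 \<or> s = 3 \<or> s = gr + 1 \<or> s = 3 * gr - 1 \<or> s = 3 - gr \<or> s = 2 - gr \<or> s = gr + 2 \<or> s = 3 * gr - 2"
    unfolding s_def using uvw b by (elim disjE conjE; simp add: abs_if; linarith)
  have ss: "s\<^sup>2 = 4 * t" by (simp add: s_def t(2))
  have sq: "1 ^ 2 = (1::real)" "3 ^ 2 = (9::real)" "(gr + 1)\<^sup>2 = 3 * gr + 2" "(3 * gr - 1)\<^sup>2 = 3 * gr + 10"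
    "(3 - gr)\<^sup>2 = 10 - 5 * gr" "(2 - gr)\<^sup>2 = 5 - 3 * gr" "(gr + 2)\<^sup>2 = 5 * gr + 5" "(3 * gr - 2)\<^sup>2 = 13 - 3 * gr"
    using gr_square by (simp_all add: power2_eq_square algebra_simps)
  have "4 * t \<in> {1, 9, 3 * gr + 2, 3 * gr + 10, 10 - 5 * gr, 5 - 3 * gr, 5 * gr + 5, 13 - 3 * gr}"
    unfolding ss[symmetric] using s sq by auto
  moreover have "t = 0 \<or> t = 1 \<or> t = 4 \<or> t = gr + 1 \<or> t = 2 - gr" using t(1) by simp
  ultimately show False using b unfolding insert_iff empty_iff by (elim disjE FalseE; linarith)
qed

lemma icosahedral_exclusion:
  assumes P: "polyhedral 5 G" and x: "rquat 0 a b c \<in> G" "(a\<^sup>2, b\<^sup>2, c\<^sup>2) \<in> ico_even"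
    and y: "rquat 0 a' b' c' \<in> G" "(a'\<^sup>2, b'\<^sup>2, c'\<^sup>2) \<in> ico_odd"
  shows False
proof -
  have T: "traces 5 = {0, 1, 4, gr + 1, 2 - gr}" by (auto simp: traces_def)
  have nx: "0\<^sup>2 + a\<^sup>2 + b\<^sup>2 + c\<^sup>2 = 4" using x(2) by (auto simp: ico_even_def)
  have ny: "0\<^sup>2 + a'\<^sup>2 + b'\<^sup>2 + c'\<^sup>2 = 4" using y(2) by (auto simp: ico_odd_def)
  have "((0 * 0 + a * a' + b * b' + c * c') / 2)\<^sup>2 \<in> traces 5"
    by (rule polyhedral_inner_product[OF P nx _ ny]) (use x(1) y(1) in simp_all)
  then have "((a * a' + b * b' + c * c') / 2)\<^sup>2 \<in> {0, 1, 4, gr + 1, 2 - gr}"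
    unfolding T by (simp only: mult_zero_left add_0)
  then obtain t where t: "t \<in> {0, 1, 4, gr + 1, 2 - gr}" "((a * a' + b * b' + c * c') / 2)\<^sup>2 = t" by blast
  have t4: "4 * t = (a * a' + b * b' + c * c')\<^sup>2" using t(2) by (simp add: power_divide)
  have pr: "1 * 1 = (1::real)\<^sup>2" "(gr + 1) * (2 - gr) = 1\<^sup>2" "(2 - gr) * (gr + 1) = 1\<^sup>2"
    "(gr + 1) * (gr + 1) = (gr + 1)\<^sup>2" "(2 - gr) * (2 - gr) = (2 - gr)\<^sup>2"
    "1 * (gr + 1) = gr\<^sup>2" "(gr + 1) * 1 = gr\<^sup>2" "1 * (2 - gr) = (gr - 1)\<^sup>2" "(2 - gr) * 1 = (gr - 1)\<^sup>2"
    using gr_square by (simp_all add: power2_eq_square algebra_simps)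
  note sp = square_product_values
  consider "a\<^sup>2 = 1" "b\<^sup>2 = gr + 1" "c\<^sup>2 = 2 - gr" | "a\<^sup>2 = gr + 1" "b\<^sup>2 = 2 - gr" "c\<^sup>2 = 1"
    | "a\<^sup>2 = 2 - gr" "b\<^sup>2 = 1" "c\<^sup>2 = gr + 1"
    using x(2) unfolding ico_even_def insert_iff prod.inject empty_iff by blast
  note X = this
  consider "a'\<^sup>2 = 1" "b'\<^sup>2 = 2 - gr" "c'\<^sup>2 = gr + 1" | "a'\<^sup>2 = gr + 1" "b'\<^sup>2 = 1" "c'\<^sup>2 = 2 - gr"
    | "a'\<^sup>2 = 2 - gr" "b'\<^sup>2 = gr + 1" "c'\<^sup>2 = 1"
    using y(2) unfolding ico_odd_def insert_iff prod.inject empty_iff by blast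
  note Y = this
  let ?u = "a * a'" and ?v = "b * b'" and ?w = "c * c'"
  let ?one = "\<lambda>z::real. z = 1 \<or> z = -1" and ?g1 = "\<lambda>z. z = gr + 1 \<or> z = - (gr + 1)"
    and ?g2 = "\<lambda>z. z = 2 - gr \<or> z = - (2 - gr)" and ?g = "\<lambda>z. z = gr \<or> z = - gr" and ?h = "\<lambda>z. z = gr - 1 \<or> z = - (gr - 1)"
  \<comment> \<open>An even and an odd arrangement agree in none or in exactly one position. With
    none, all products are \<open>\<plusminus> 1\<close>; with one, the products follow one of three
    patterns, and the cyclic positions give the seven cases.\<close>
  have "?one ?u \<and> ?one ?v \<and> ?one ?w \<or> ?g1 ?u \<and> ?h ?v \<and> ?h ?w \<or> ?g2 ?u \<and> ?g ?v \<and> ?g ?w \<or>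
      ?g1 ?v \<and> ?h ?w \<and> ?h ?u \<or> ?g2 ?v \<and> ?g ?w \<and> ?g ?u \<or> ?g1 ?w \<and> ?h ?u \<and> ?h ?v \<or> ?g2 ?w \<and> ?g ?u \<and> ?g ?v"
  proof (rule X)
    assume h: "a\<^sup>2 = 1" "b\<^sup>2 = gr + 1" "c\<^sup>2 = 2 - gr"
    show ?thesis
      by (rule Y) (use sp[OF h(1)] sp[OF h(2)] sp[OF h(3)] pr in \<open>simp_all only: simp_thms\<close>; metis)+
  next
    assume h: "a\<^sup>2 = gr + 1" "b\<^sup>2 = 2 - gr" "c\<^sup>2 = 1"
    show ?thesis
      by (rule Y) (use sp[OF h(1)] sp[OF h(2)] sp[OF h(3)] pr in \<open>simp_all only: simp_thms\<close>; metis)+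
  next
    assume h: "a\<^sup>2 = 2 - gr" "b\<^sup>2 = 1" "c\<^sup>2 = gr + 1"
    show ?thesis
      by (rule Y) (use sp[OF h(1)] sp[OF h(2)] sp[OF h(3)] pr in \<open>simp_all only: simp_thms\<close>; metis)+
  qed
  moreover have "4 * t = (?v + ?w + ?u)\<^sup>2" "4 * t = (?w + ?u + ?v)\<^sup>2" using t4 by (simp_all add: algebra_simps)
  ultimately show False
    using icosahedral_exclusion_arith[OF t(1) t4] icosahedral_exclusion_arith[OF t(1), of ?v ?w ?u]
      icosahedral_exclusion_arith[OF t(1), of ?w ?u ?v] by metis
qed

lemma icosahedral_standard_aux:
  assumes P: "polyhedral 5 G" and x: "rquat 0 a b c \<in> G" "(a\<^sup>2, b\<^sup>2, c\<^sup>2) \<in> ico_even"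
  shows "G = std5"
proof (rule card_seteq)
  show "G \<subseteq> std5"
  proof
    fix g assume gG: "g \<in> G"
    from icosahedral_elements[OF P gG] show "g \<in> std5"
    proof
      assume "g \<in> rq ` set std3"
      then show ?thesis by (simp add: std5_def)
    next
      assume "\<exists>h\<in>klein_four. \<exists>b c d. g = h \<circ> rquat 0 b c d \<and> rquat 0 b c d \<in> G \<and> (b\<^sup>2, c\<^sup>2, d\<^sup>2) \<in> ico_even \<union> ico_odd"
      then obtain h a' b' c' where h: "h \<in> klein_four" "g = h \<circ> rquat 0 a' b' c'" "rquat 0 a' b' c' \<in> G"
        "(a'\<^sup>2, b'\<^sup>2, c'\<^sup>2) \<in> ico_even \<union> ico_odd" by blast
      then have "(a'\<^sup>2, b'\<^sup>2, c'\<^sup>2) \<in> ico_even" using icosahedral_exclusion[OF P x h(3)] by blast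
      then have "rquat 0 a' b' c' \<in> rq ` set ico_list" by (rule ico_list_memI)
      then have "(h, rquat 0 a' b' c') \<in> klein_four \<times> rq ` set ico_list" using h(1) by blast
      from imageI[OF this, of "\<lambda>(h, z). h \<circ> z"] show ?thesis using h(2) by (simp add: std5_def)
    qed
  qed
  show "finite std5" by (simp add: std5_def klein_four_def)
  have "card G = 60" using polyhedralD(4)[OF P] by auto
  then show "card std5 \<le> card G" using card_std5 by simp
qed

text \<open>The Klein four-group lies in two icosahedral groups, which a quarter turn interchanges.\<close>

lemma icosahedral_standard:
  assumes P: "polyhedral 5 G"
  shows "\<exists>\<theta>\<in>Aut_cp1. cj \<theta> ` G = std5"
proof -
  have "\<not> G \<subseteq> rq ` set std3"
  proof
    assume "G \<subseteq> rq ` set std3"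
    then have "card G \<le> card (rq ` set std3)" by (intro card_mono) auto
    also have "\<dots> \<le> 12" using card_rq_le[of std3] by (simp add: std3_def)
    finally show False using polyhedralD(4)[OF P] by auto
  qed
  then obtain b c d where g: "rquat 0 b c d \<in> G" "(b\<^sup>2, c\<^sup>2, d\<^sup>2) \<in> ico_even \<union> ico_odd"
    using icosahedral_elements[OF P] by blast
  show ?thesis
  proof (cases "(b\<^sup>2, c\<^sup>2, d\<^sup>2) \<in> ico_even")
    case True
    have "cj id ` G = G" by (simp add: cj_def)
    then show ?thesis using icosahedral_standard_aux[OF P g(1) True] Aut_id by metis
  next
    case False
    then have odd: "(b\<^sup>2, c\<^sup>2, d\<^sup>2) \<in> ico_odd" using g(2) by blast
    \<comment> \<open>A quarter turn about the axis of \<open>i\<close> exchanges the last two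
      squares and thus turns an odd arrangement into an even one.\<close>
    let ?\<theta> = "rot (Complex 0 1)"
    have one: "0\<^sup>2 + 1\<^sup>2 = (1::real)" by simp
    have cjr: "cj ?\<theta> (rquat x y z w) = rquat x y (- w) z" if "x\<^sup>2 + y\<^sup>2 + z\<^sup>2 + w\<^sup>2 = m" "m \<noteq> 0" for x y z w m
      using cj_rotation(2)[OF one that] by simp
    have \<theta>: "?\<theta> \<in> Aut_cp1" using cj_rotation(1)[OF one, of 1 0 0 0 1] by simp
    have "cj ?\<theta> (rquat 0 1 0 0) = rquat 0 1 0 0" "cj ?\<theta> (rquat 0 0 1 0) = rquat 0 0 0 1"
      using cjr[of 0 1 0 0 1] cjr[of 0 0 1 0 1] by simp_all
    then have IK: "rquat 0 1 0 0 \<in> cj ?\<theta> ` G" "rquat 0 0 0 1 \<in> cj ?\<theta> ` G"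
      using polyhedralD(6)[OF P] polyhedral_J[OF P] by (metis imageI)+
    have P': "polyhedral 5 (cj ?\<theta> ` G)" by (rule polyhedral_cj[OF P \<theta> IK])
    have n: "0\<^sup>2 + b\<^sup>2 + c\<^sup>2 + d\<^sup>2 = 4" using odd by (auto simp: ico_odd_def)
    have "cj ?\<theta> (rquat 0 b c d) = rquat 0 b (- d) c" by (rule cjr[OF n]) simp
    then have g': "rquat 0 b (- d) c \<in> cj ?\<theta> ` G" using g(1) by (metis imageI)
    have "(b\<^sup>2, (- d)\<^sup>2, c\<^sup>2) \<in> ico_even" using odd by (auto simp: ico_odd_def ico_even_def)
    then show ?thesis using icosahedral_standard_aux[OF P'] g' \<theta> by (metis of_real_0)
  qed
qed

subsection \<open>Isomorphic finite groups are conjugate\<close>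

lemma rot_funpow: "z \<noteq> 0 \<Longrightarrow> rot z ^^ j = rot (z ^ j)"
proof (induction j)
  case 0
  then show ?case using mob_id[of 1] by simp
next
  case (Suc j)
  then show ?case using affine_comp[of z "z ^ j" 0 0] by simp
qed

lemma stab_power_card:
  assumes G: "aut_group G" "finite G" and g: "g \<in> stab G p"
  shows "g ^^ card (stab G p) = id"
proof (cases "2 \<le> card (stab G p)")
  case True
  let ?m = "card (stab G p)"
  obtain \<eta> q where \<eta>: "\<eta> \<in> Aut_cp1" "\<eta> p = Infty" "\<eta> q = Fin 0" "q \<noteq> p" "stab G q = stab G p"
    "\<forall>h\<in>stab G p. h \<noteq> id \<longrightarrow> {x. h x = x} = {p, q}"
    and st: "stab (cj \<eta> ` G) Infty = rot ` {z. z ^ ?m = 1}" using normal_form[OF G True] by blast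
  have "cj \<eta> g \<in> stab (cj \<eta> ` G) (\<eta> p)" unfolding stab_cj[OF \<eta>(1)] using g by (rule imageI)
  then obtain z where z: "cj \<eta> g = rot z" "z ^ ?m = 1" unfolding \<eta>(2) st by blast
  have "z \<noteq> 0" using z(2) True by (auto simp: power_0_left)
  then have "cj \<eta> (g ^^ ?m) = rot 1" using cj_funpow[OF \<eta>(1)] rot_funpow z by metis
  also have "\<dots> = cj \<eta> id" using mob_id[of 1] cj_id[OF \<eta>(1)] by simp
  finally show ?thesis by (rule cj_inj[OF \<eta>(1)])
next
  case False
  then have "g = id" using g card_stab_ge_2[OF G, of p] by (auto simp: stab_def)
  then show ?thesis by simp
qed

text \<open>The pole must come from an orbit that is identified by its stabilizer order, so that
  both ends of the axis belong to it; order \<open>3\<close> would be ambiguous for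
  \<open>k = 3\<close>, which has two such orbits. A twofold axis gives \<open>- z\<close>. For
  \<open>k = 4\<close> a fourfold axis is taken instead, because it also supplies the quarter
  turn.\<close>

lemma polyhedral_normal_form:
  assumes G: "aut_group G" "finite G" and k: "(k, card G) \<in> {(3, 12), (4, 24), (5, 60)}"
    and p: "card (stab G p2) = 2" "card (stab G p3) = 3" "card (stab G pk) = k"
    and orbs: "\<And>p. 2 \<le> card (stab G p) \<Longrightarrow> p \<in> orb G p2 \<union> orb G p3 \<union> orb G pk"
  shows "\<exists>\<eta>\<in>Aut_cp1. polyhedral k (cj \<eta> ` G) \<and> (k = 4 \<longrightarrow> rquat 1 1 0 0 \<in> cj \<eta> ` G)"
proof -
  define r where "r = (if k = 4 then pk else p2)"
  define m where "m = card (stab G r)"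
  have m: "m = (if k = 4 then 4 else 2)" using p by (simp add: m_def r_def)
  have cst: "card (stab G q) = 2 \<or> card (stab G q) = 3 \<or> card (stab G q) = k" if "2 \<le> card (stab G q)" for q
    using orbs[OF that] stab_card_orb[OF G, of q] p by auto
  have "q \<in> orb G r" if q: "stab G q = stab G r" for q
  proof -
    have cq: "card (stab G q) = m" using q by (simp add: m_def)
    then have "q \<in> orb G p2 \<union> orb G p3 \<union> orb G pk" using m by (intro orbs) auto
    moreover have "q \<in> orb G p2 \<Longrightarrow> m = 2" "q \<in> orb G p3 \<Longrightarrow> m = 3" "q \<in> orb G pk \<Longrightarrow> m = k"
      using stab_card_orb[OF G, of q] cq p by auto
    ultimately show ?thesis using m k by (auto simp: r_def split: if_splits)
  qed
  moreover have "2 \<le> card (stab G r)" using m by (simp add: m_def)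
  ultimately obtain \<eta> where \<eta>: "\<eta> \<in> Aut_cp1" "stab (cj \<eta> ` G) Infty = rot ` {z. z ^ m = 1}"
    "invo \<in> cj \<eta> ` G" using normal_form_swap[OF G, of r] unfolding m_def by metis
  let ?G = "cj \<eta> ` G"
  have rotG: "rot z \<in> ?G" if "z ^ m = 1" for z
  proof -
    have "rot z \<in> stab ?G Infty" unfolding \<eta>(2) using that by blast
    then show ?thesis by (simp add: stab_def)
  qed
  have "quat 0 1 0 0 = rot (-1)" using mob_scale[of "- \<i>" "-1" 0 0 1] by (simp add: quat_def)
  then have I: "rquat 0 1 0 0 \<in> ?G" using rotG[of "-1"] m by auto
  have "quat 0 0 0 1 = invo" using mob_scale[of \<i> 0 1 1 0] by (simp add: quat_def)
  then have K: "rquat 0 0 0 1 \<in> ?G" using \<eta>(3) by simp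
  have "(1 - \<i>) * \<i> = 1 + \<i>" "1 - \<i> \<noteq> 0" by (auto simp: complex_eq_iff)
  then have "quat 1 1 0 0 = rot \<i>" using mob_scale[of "1 - \<i>" \<i> 0 0 1] by (simp add: quat_def)
  moreover have "\<i> ^ 4 = 1" by (simp add: numeral_eq_Suc)
  ultimately have R: "k = 4 \<longrightarrow> rquat 1 1 0 0 \<in> ?G" using rotG[of \<i>] m by auto
  have pow: "g = id \<or> g ^^ 2 = id \<or> g ^^ 3 = id \<or> g ^^ k = id" if g: "g \<in> G" for g
  proof (cases "g = id")
    case False
    obtain q where q: "g q = q" using Aut_has_fixed_point aut_groupD(4)[OF G(1) g] by blast
    then have "2 \<le> card (stab G q)" using card_stab_ge_2[OF G] g False by blast
    moreover have "g ^^ card (stab G q) = id" using stab_power_card[OF G] g q by (simp add: stab_def)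
    ultimately show ?thesis using cst[of q] by metis
  qed simp
  have "g = id \<or> g ^^ 2 = id \<or> g ^^ 3 = id \<or> g ^^ k = id" if gG: "g \<in> ?G" for g
  proof -
    obtain h where h: "h \<in> G" "g = cj \<eta> h" using gG by blast
    have pw: "g ^^ j = cj \<eta> (h ^^ j)" for j using cj_funpow[OF \<eta>(1)] h(2) by simp
    show ?thesis using pow[OF h(1)] pw cj_id[OF \<eta>(1)] h(2) by metis
  qed
  then have "polyhedral k ?G"
    using aut_group_cj[OF G(1) \<eta>(1)] G(2) k card_cj[OF \<eta>(1), of G] I K unfolding polyhedral_def by simp
  then show ?thesis using \<eta>(1) R by blast
qed

text \<open>The flags \<open>c\<close> and \<open>d\<close> are meant for the presence of elements
  of order at least \<open>n\<close> and at least \<open>n / 2\<close>, so the model depends on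
  isomorphism invariants only.\<close>

definition std_group :: "nat \<Rightarrow> bool \<Rightarrow> bool \<Rightarrow> (cp1 \<Rightarrow> cp1) set" where
  "std_group n c d =
     (if c then cyclic_std n
      else if d then cyclic_std (n div 2) \<union> (\<lambda>g. g \<circ> invo) ` cyclic_std (n div 2)
      else if n = 12 then rq ` set std3 else if n = 24 then rq ` set std4 else std5)"

lemma conjugate_std_group:
  assumes G: "aut_group G" "finite G" and N: "2 \<le> card G"
  shows "\<exists>\<eta>\<in>Aut_cp1. cj \<eta> ` G = std_group (card G) (has_element_of_large_order 1 G) (has_element_of_large_order 2 G)"
proof -
  note ex = cyclic_dihedral_orbit_types[OF G N]
  show ?thesis
  proof (cases "has_element_of_large_order 1 G")
    case True
    then obtain p where "card (stab G p) = card G" using ex(1) by blast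
    then show ?thesis using conjugate_cyclic[OF G N] True by (simp add: std_group_def)
  next
    case c: False
    show ?thesis
    proof (cases "has_element_of_large_order 2 G")
      case True
      then obtain p where "2 * card (stab G p) = card G" "2 \<le> card (stab G p)" using ex(2) c by blast
      then show ?thesis using conjugate_dihedral[OF G] c True by (simp add: std_group_def)
    next
      case d: False
      obtain k p2 p3 pk where k: "(k, card G) \<in> {(3, 12), (4, 24), (5, 60)}"
        and p: "card (stab G p2) = 2" "card (stab G p3) = 3" "card (stab G pk) = k"
        and orbs: "\<And>p. 2 \<le> card (stab G p) \<Longrightarrow> p \<in> orb G p2 \<union> orb G p3 \<union> orb G pk"
        by (rule orbit_types[OF G N]) (use ex(3,4) c d in blast)+
      obtain \<eta> where \<eta>: "\<eta> \<in> Aut_cp1" "polyhedral k (cj \<eta> ` G)" "k = 4 \<longrightarrow> rquat 1 1 0 0 \<in> cj \<eta> ` G"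
        using polyhedral_normal_form[OF G k p orbs] by blast
      have "\<exists>\<theta>\<in>Aut_cp1. cj \<theta> ` cj \<eta> ` G = std_group (card G) False False"
        using k
      proof (elim insertE emptyE)
        assume k: "(k, card G) = (3, 12)"
        have "cj id ` cj \<eta> ` G = cj \<eta> ` G" by (simp add: cj_def)
        then show ?thesis using tetrahedral_standard[of "cj \<eta> ` G"] \<eta>(2) k Aut_id by (auto simp: std_group_def)
      next
        assume "(k, card G) = (4, 24)"
        then show ?thesis using octahedral_standard[of "cj \<eta> ` G"] \<eta>(2,3) by (auto simp: std_group_def)
      next
        assume "(k, card G) = (5, 60)"
        then show ?thesis using icosahedral_standard[of "cj \<eta> ` G"] \<eta>(2) by (auto simp: std_group_def)
      qed
      then obtain \<theta> where \<theta>: "\<theta> \<in> Aut_cp1" "cj \<theta> ` cj \<eta> ` G = std_group (card G) False False" by blast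
      have "cj (\<theta> \<circ> \<eta>) ` G = cj \<theta> ` cj \<eta> ` G" unfolding image_image cj_cj[OF \<theta>(1) \<eta>(1)] ..
      then show ?thesis using \<theta> Aut_comp[OF \<theta>(1) \<eta>(1)] c d by (intro bexI[of _ "\<theta> \<circ> \<eta>"]) auto
    qed
  qed
qed

text \<open>The order of the group and both flags of \<open>std_group\<close> pass along
  \<open>\<psi>\<close>, so both groups are conjugate to the same model. Nothing is claimed about
  the isomorphism induced by \<open>\<eta>\<close>.\<close>

lemma isomorphic_conjugate:
  assumes G: "aut_group G" "finite G" "2 \<le> card G" and H: "aut_group H"
    and \<psi>: "bij_betw \<psi> G H" "\<And>f g. f \<in> G \<Longrightarrow> g \<in> G \<Longrightarrow> \<psi> (f \<circ> g) = \<psi> f \<circ> \<psi> g"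
  shows "\<exists>\<eta>\<in>Aut_cp1. G = cj \<eta> ` H"
proof -
  have card: "card H = card G" using bij_betw_same_card[OF \<psi>(1)] by simp
  have finH: "finite H" using bij_betw_finite[OF \<psi>(1)] G(2) by simp
  have img: "\<psi> ` G = H" and inj: "inj_on \<psi> G" using \<psi>(1) by (auto simp: bij_betw_def)
  have idG: "id \<in> G" by (rule aut_groupD(1)[OF G(1)])
  have "\<psi> id \<in> H" using img idG by blast
  moreover have "\<psi> id \<circ> \<psi> id = \<psi> id" using \<psi>(2)[OF idG idG] by simp
  ultimately have id: "\<psi> id = id" by (metis Aut_inv(3) aut_groupD(4)[OF H] comp_assoc comp_id id_comp)
  have pow: "g ^^ j \<in> G \<and> \<psi> (g ^^ j) = \<psi> g ^^ j" if "g \<in> G" for g j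
  proof (induction j)
    case 0
    show ?case using idG id by (simp only: funpow.simps(1))
  next
    case (Suc j)
    then show ?case using \<psi>(2)[OF that] aut_groupD(2)[OF G(1) that] by (simp only: funpow.simps(2))
  qed
  have "\<psi> (g ^^ j) = id \<longleftrightarrow> g ^^ j = id" if "g \<in> G" for g j
    using pow[OF that] inj idG id by (metis inj_onD)
  then have iff: "\<psi> g ^^ j = id \<longleftrightarrow> g ^^ j = id" if "g \<in> G" for g j using pow[OF that] that by metis
  have "has_element_of_large_order r H = has_element_of_large_order r G" for r
    unfolding has_element_of_large_order_def card img[symmetric] using iff by (auto simp: card_image[OF inj])
  then have "\<exists>\<theta>\<in>Aut_cp1. cj \<theta> ` H = std_group (card G) (has_element_of_large_order 1 G) (has_element_of_large_order 2 G)"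
    using conjugate_std_group[OF H finH] card G(3) by simp
  then obtain \<eta> \<theta> where \<eta>: "\<eta> \<in> Aut_cp1" "\<theta> \<in> Aut_cp1" "cj \<eta> ` G = cj \<theta> ` H"
    using conjugate_std_group[OF G(1-3)] by auto
  note ei = Aut_inv(1)[OF \<eta>(1)]
  have "G = cj (inv_into UNIV \<eta>) ` cj \<eta> ` G" unfolding image_image cj_inv_cancel(1)[OF \<eta>(1)] by simp
  also have "\<dots> = cj (inv_into UNIV \<eta> \<circ> \<theta>) ` H" unfolding \<eta>(3) image_image cj_cj[OF ei \<eta>(2)] ..
  finally show ?thesis using Aut_comp[OF ei \<eta>(2)] by blast
qed

lemma galois_deck_card:
  assumes B: "rational_fun B" "2 \<le> rat_degree B" and gal: "galois_covering B"
  shows "2 \<le> card (deck B)"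
proof -
  have B1: "1 \<le> rat_degree B" using B(2) by simp
  obtain y where y: "card {x. B x = y} = rat_degree B"
    using eventually_happens'[OF cofinite_cp1_bot generic_fibre[OF B(1) B1]] by blast
  obtain x where x: "B x = y" using rational_fun_surj[OF B(1) B1] by blast
  have "{x. B x = y} \<noteq> {x}" using y B(2) by auto
  then obtain z where z: "B z = y" "z \<noteq> x" using x by blast
  obtain \<mu> where \<mu>: "\<mu> \<in> deck B" "\<mu> x = z" using galois_fibre[OF gal, of x z] x z by auto
  have "card {id, \<mu>} \<le> card (deck B)"
    using finite_deck[OF B(1) B1] aut_groupD(1)[OF aut_group_deck] \<mu>(1) by (intro card_mono) auto
  moreover have "\<mu> \<noteq> id" using \<mu>(2) z(2) by auto
  ultimately show ?thesis by simp
qed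

theorem theorem3p3:
  fixes X Y A B :: "cp1 \<Rightarrow> cp1"
  assumes "rational_fun X" and "rational_fun Y" and "rational_fun A" and "rational_fun B"
    and "2 \<le> rat_degree X" and "2 \<le> rat_degree Y" and "2 \<le> rat_degree A" and "2 \<le> rat_degree B"
    and "galois_covering B"
  shows "good_solution X Y A B \<longleftrightarrow>
    (\<exists>\<eta> \<nu> V C. moebius \<eta> \<and> moebius \<nu> \<and> rational_fun V \<and> rational_fun C \<and>
       X \<circ> V = C \<circ> X \<and> B \<circ> \<eta> = \<nu> \<circ> X \<and> Y = \<eta> \<circ> V \<and> A = \<nu> \<circ> C \<and>
       equivariant X V)"
proof -
  have d: "1 \<le> rat_degree X" "1 \<le> rat_degree Y" "1 \<le> rat_degree A" "1 \<le> rat_degree B"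
    using assms(5-8) by auto
  note X = assms(1) d(1) and Y = assms(2) d(2) and A = assms(3) d(3) and B = assms(4) d(4)
    and gal = assms(9)
  show ?thesis
  proof
    assume good: "good_solution X Y A B"
    then have AB: "A \<circ> X = B \<circ> Y" and comp: "\<exists>!Z. irreducible_component (fiber_product A B) Z"
      and nf: "no_common_right_factor X Y" unfolding good_solution_def by blast+
    note sym = irreducible_fiber_product_symmetric[OF X Y A(1) B AB gal comp]
    obtain \<psi> where \<psi>: "bij_betw \<psi> (deck B) (deck X)"
      and hom: "\<And>\<mu> \<nu>. \<mu> \<in> deck B \<Longrightarrow> \<nu> \<in> deck B \<Longrightarrow> \<psi> (\<mu> \<circ> \<nu>) = \<psi> \<mu> \<circ> \<psi> \<nu>"
      and equi: "\<And>\<mu>. \<mu> \<in> deck B \<Longrightarrow> Y \<circ> \<psi> \<mu> = \<mu> \<circ> Y"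
      and fib: "\<forall>\<^sub>F t in cofinite. \<forall>s. X s = X t \<longrightarrow> (\<exists>\<tau>\<in>deck X. \<tau> t = s)"
      by (rule deck_group_isomorphism[OF X Y B AB gal nf sym]) blast+
    obtain \<eta> where \<eta>: "\<eta> \<in> Aut_cp1" "deck B = cj \<eta> ` deck X"
      using isomorphic_conjugate[OF aut_group_deck finite_deck[OF B] galois_deck_card[OF assms(4,8) gal]
          aut_group_deck \<psi> hom] by blast
    have conj: "deck B = (\<lambda>\<sigma>. \<eta> \<circ> \<sigma> \<circ> inv_into UNIV \<eta>) ` deck X" using \<eta>(2) by (simp add: cj_def)
    show "\<exists>\<eta> \<nu> V C. moebius \<eta> \<and> moebius \<nu> \<and> rational_fun V \<and> rational_fun C \<and>
       X \<circ> V = C \<circ> X \<and> B \<circ> \<eta> = \<nu> \<circ> X \<and> Y = \<eta> \<circ> V \<and> A = \<nu> \<circ> C \<and> equivariant X V"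
      by (rule diagram_of_conjugacy[OF X Y A B AB gal \<psi> hom equi fib \<eta>(1) conj])
  next
    assume "\<exists>\<eta> \<nu> V C. moebius \<eta> \<and> moebius \<nu> \<and> rational_fun V \<and> rational_fun C \<and>
       X \<circ> V = C \<circ> X \<and> B \<circ> \<eta> = \<nu> \<circ> X \<and> Y = \<eta> \<circ> V \<and> A = \<nu> \<circ> C \<and> equivariant X V"
    then show "good_solution X Y A B"
      using good_solution_of_diagram[OF X Y A(1) B(1) gal] by blast
  qed
qed

end
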